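(* Let $F$ be a non-archimedean local field with residue field of size $q$, and let $\mathcal{B}=\mathcal{B}_{3,F}$ be the Bruhat-Tits building of $\mathrm{PGL}_3(F)$. Simple random walk on the underlying graphs (1-skeletons) of Ramanujan complexes $X=\Gamma\backslash\mathcal{B}$ with $n$ vertices has total-variation cutoff at time $\frac{q^2+q+1}{q^2-1}\log_{q^2}n$ with a window of size $O(\sqrt{\log n})$. That is, for every $0<\varepsilon<1$ there are constants $A,N$ (depending on $F,\varepsilon$) such that for every Ramanujan complex $X=\Gamma\backslash\mathcal{B}$ with $n\ge N$ vertices, $$\Bigl|\,t_{mix}(\varepsilon,X)-\tfrac{q^2+q+1}{q^2-1}\log_{q^2}n\,\Bigr|\le A\sqrt{\log n}.$$
   Context: Building. $F$ has ring of integers $\mathcal{O}$ and uniformizer $\varpi$; $G=\mathrm{PGL}_3(F)$. $\mathcal{B}$ is the 2-dimensional simplicial complex whose vertices are the $F^\times$-homothety classes of $\mathcal{O}$-lattices in $F^3$; $\xi$ is the class of $\mathcal{O}^3$ and $g\xi$ the class of $g\mathcal{O}^3$. Vertices $g_0\xi,\dots,g_r\xi$ form an $r$-cell if, after reordering, there are $\alpha_i\in F^\times$ with $\varpi g_0\mathcal{O}^3<\alpha_r g_r\mathcal{O}^3<\dots<\alpha_1g_1\mathcal{O}^3<g_0\mathcal{O}^3$. The 1-skeleton is regular of degree $2(q^2+q+1)$. Ramanujan complexes. A geometric operator on a $G$-invariant set $\mathcal{C}$ of (possibly ordered) cells of $\mathcal{B}$ is a branching operator $T:\mathcal{C}\to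 2^{\mathcal{C}}$ (sending each cell to a finite set of cells) commuting with $G$. For a torsion-free lattice $\Gamma\le G$, $X=\Gamma\backslash\mathcal{B}$ is a finite complex with covering map $\varphi:\mathcal{B}\to X$, and $T$ induces the branching operator $T|_X=\varphi T\varphi^{-1}$ on $\Gamma\backslash\mathcal{C}$ (images counted with multiplicity). Branching operators act on functions via the adjacency operator of the associated digraph with edges $\sigma\to\sigma'$, $\sigma'\in T(\sigma)$. A function on (cells of) $X$ is trivial if its lift to $\mathcal{B}$ is constant on every orbit of $\mathrm{PSL}_3(F)$ (the image of $\mathrm{SL}_3(F)$ in $G$); $L^2_0(\Gamma\backslash\mathcal{C})$ is the orthogonal complement of the trivial functions in $L^2(\Gamma\backslash\mathcal{C})$. $X$ is a Ramanujan complex if for every geometric operator $T$ on every such $\mathcal{C}$, the spectrum of $T|_X$ on $L^2_0(\Gamma\backslash\mathcal{C})$ is contained in the spectrum of $T$ on $L^2(\mathcal{C})$. Random walk. SRW on $X$ starting at a vertex $v=\varphi(\zeta)$ is SRW on the 1-skeleton of $X$, i.e. the image under $\varphi$ of SRW on the 1-skeleton of $\mathcal{B}$ starting at $\zeta$. $\mu^t_{X,v}$ is its distribution at time $t$, $\pi_X$ the uniform distribution on the vertices $X^0$, $\|\mu-\nu\|_{TV}=\frac12\|\mu-\nu\|_1$, and $t_{mix}(\varepsilon,X)=\min\{t\in\mathbb{N}:\forall v\in X^0,\ \|\mu^t_{X,v}-\pi_X\|_{TV}<\varepsilon\}$. *)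

theory Defs
  imports "HOL-Algebra.Coset" "HOL-Probability.Probability"
begin

section \<open>Non-archimedean local fields\<close>

text \<open>
  A non-archimedean local field is a field which is complete with respect to a non-trivial discrete
  non-archimedean absolute value, with finite residue field. Non-triviality and discreteness are
  both contained in the existence of the uniformizer \<open>\<pi>\<close>, i.e. of a generator of the maximal ideal.
\<close>

definition ring_of_integers :: "('a::field \<Rightarrow> real) \<Rightarrow> 'a set" where
  "ring_of_integers abv = {x. abv x \<le> 1}"

definition maximal_ideal :: "('a::field \<Rightarrow> real) \<Rightarrow> 'a set" where
  "maximal_ideal abv = {x. abv x < 1}"

definition residue_field :: "('a::field \<Rightarrow> real) \<Rightarrow> 'a set set" where
  "residue_field abv =
     ring_of_integers abv //
       {(x, y). x \<in> ring_of_integers abv \<and> y \<in> ring_of_integers abv \<and> x - y \<in> maximal_ideal abv}"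

definition residue_card :: "('a::field \<Rightarrow> real) \<Rightarrow> nat" where
  "residue_card abv = card (residue_field abv)"

locale nonarch_local_field =
  fixes abv :: "'a::field \<Rightarrow> real" and \<pi> :: 'a
  assumes abv_nonneg: "0 \<le> abv x"
    and abv_eq_0_iff: "abv x = 0 \<longleftrightarrow> x = 0"
    and abv_mult: "abv (x * y) = abv x * abv y"
    and abv_add: "abv (x + y) \<le> max (abv x) (abv y)"
    and uniformizer_nonzero: "\<pi> \<noteq> 0"
    and uniformizer: "maximal_ideal abv = (\<lambda>x. \<pi> * x) ` ring_of_integers abv"
    and complete: "Metric_space.mcomplete UNIV (\<lambda>x y. abv (x - y))"
    and finite_residue_field: "finite (residue_field abv)"

section \<open>The group \<open>PGL\<^sub>3(F)\<close>\<close>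

definition GL3 :: "('a::field ^ 3 ^ 3) monoid" where
  "GL3 = \<lparr>carrier = {A. invertible A}, monoid.mult = (**), one = mat 1\<rparr>"

definition scalars3 :: "('a::field ^ 3 ^ 3) set" where
  "scalars3 = {mat c | c. c \<noteq> 0}"

lemma mat_mult_eq: "mat x ** A = (\<chi> i. x *s (A $ i) :: 'a::field ^ 3 ^ 3)"
  by (auto simp: mat_def matrix_matrix_mult_def vec_eq_iff if_distrib[of "\<lambda>u. u * _"] sum.delta vector_scalar_mult_def cong: if_cong)

lemma mat_mult_commute: "mat x ** A = A ** (mat x :: 'a::field ^ 3 ^ 3)"
  by (auto simp: mat_def matrix_matrix_mult_def vec_eq_iff if_distrib[of "\<lambda>u. u * _"] if_distrib[of "\<lambda>u. _ * u"] sum.delta mult.commute cong: if_cong)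

lemma mat_mult_mat: "mat x ** mat y = (mat (x * y) :: 'a::field ^ 3 ^ 3)"
  by (subst mat_mult_eq) (auto simp: mat_def vec_eq_iff)

lemma group_GL3: "group (GL3 :: ('a::field ^ 3 ^ 3) monoid)"
proof (rule groupI)
  fix A :: "'a ^ 3 ^ 3" assume "A \<in> carrier GL3"
  then obtain B where "A ** B = mat 1" "B ** A = mat 1" by (auto simp: GL3_def invertible_def)
  then show "\<exists>B\<in>carrier GL3. B \<otimes>\<^bsub>GL3\<^esub> A = \<one>\<^bsub>GL3\<^esub>" by (auto simp: GL3_def invertible_def)
next
  show "\<one>\<^bsub>GL3\<^esub> \<in> (carrier GL3 :: ('a ^ 3 ^ 3) set)"
    by (auto simp: GL3_def invertible_def intro: exI[of _ "mat 1"])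
qed (auto simp: GL3_def matrix_mul_assoc intro: invertible_mult)

lemma scalars3_normal: "scalars3 \<lhd> (GL3 :: ('a::field ^ 3 ^ 3) monoid)"
proof -
  interpret group GL3 by (rule group_GL3)
  have inv: "invertible (mat c :: 'a ^ 3 ^ 3)" if "c \<noteq> 0" for c
    unfolding invertible_def by (rule exI[of _ "mat (inverse c)"]) (simp add: mat_mult_mat that)
  have "subgroup scalars3 (GL3 :: ('a::field ^ 3 ^ 3) monoid)"
  proof (rule subgroupI)
    show "scalars3 \<subseteq> (carrier GL3 :: ('a ^ 3 ^ 3) set)" using inv by (auto simp: scalars3_def GL3_def)
    show "(scalars3 :: ('a ^ 3 ^ 3) set) \<noteq> {}" by (auto simp: scalars3_def intro: exI[of _ 1])
    fix a :: "'a ^ 3 ^ 3" assume "a \<in> scalars3"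
    then obtain c where c: "c \<noteq> 0" "a = mat c" by (auto simp: scalars3_def)
    have "inv\<^bsub>GL3\<^esub> a = mat (inverse c)"
      by (rule inv_equality) (use c inv in \<open>auto simp: GL3_def mat_mult_mat\<close>)
    then show "inv\<^bsub>GL3\<^esub> a \<in> scalars3" using c by (auto simp: scalars3_def)
  next
    fix a b :: "'a ^ 3 ^ 3" assume "a \<in> scalars3" "b \<in> scalars3"
    then show "a \<otimes>\<^bsub>GL3\<^esub> b \<in> scalars3" by (force simp: scalars3_def GL3_def mat_mult_mat)
  qed
  then show ?thesis
    by (rule normalI) (auto simp: r_coset_def l_coset_def GL3_def scalars3_def mat_mult_commute)
qed

definition PGL3 :: "('a::field ^ 3 ^ 3) set monoid" where
  "PGL3 = GL3 Mod scalars3"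

lemma group_PGL3: "group (PGL3 :: ('a::field ^ 3 ^ 3) set monoid)"
  unfolding PGL3_def by (rule normal.factorgroup_is_group[OF scalars3_normal])

lemma PGL3_coset_eq:
  assumes "c \<in> carrier PGL3" "d \<in> carrier PGL3" "A \<in> c" "A \<in> d"
  shows "c = d"
proof -
  interpret normal scalars3 GL3 by (rule scalars3_normal)
  have "c \<in> rcosets\<^bsub>GL3\<^esub> scalars3" "d \<in> rcosets\<^bsub>GL3\<^esub> scalars3"
    using assms by (auto simp: PGL3_def FactGroup_def)
  then show ?thesis
    using rcos_disjoint[OF is_subgroup] assms(3,4) by (force simp: pairwise_def disjnt_def)
qed

definition PSL3 :: "('a::field ^ 3 ^ 3) set set" where
  "PSL3 = {scalars3 #>\<^bsub>GL3\<^esub> A | A. det A = 1}"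

definition field_topology :: "('a::field \<Rightarrow> real) \<Rightarrow> 'a topology" where
  "field_topology abv = Metric_space.mtopology UNIV (\<lambda>x y. abv (x - y))"

definition GL3_topology :: "('a::field \<Rightarrow> real) \<Rightarrow> ('a ^ 3 ^ 3) topology" where
  "GL3_topology abv =
     subtopology
       (pullback_topology UNIV (\<lambda>A (i, j). A $ i $ j)
          (product_topology (\<lambda>_ :: 3 \<times> 3. field_topology abv) UNIV))
       (carrier GL3)"

text \<open>
  The quotient topology: elements of \<open>PGL\<^sub>3(F)\<close> are cosets, so the preimage in \<open>GL\<^sub>3(F)\<close> of a set
  \<open>U\<close> of elements is \<open>\<Union>U\<close>.
\<close>

definition PGL3_topology :: "('a::field \<Rightarrow> real) \<Rightarrow> ('a ^ 3 ^ 3) set topology" where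
  "PGL3_topology abv = topology (\<lambda>U. U \<subseteq> carrier PGL3 \<and> openin (GL3_topology abv) (\<Union>U))"

lemma istopology_PGL3:
  "istopology (\<lambda>U. U \<subseteq> carrier PGL3 \<and> openin (GL3_topology abv) (\<Union>U))"
proof -
  have "\<Union>(S \<inter> T) = \<Union>S \<inter> \<Union>T" if "S \<subseteq> carrier PGL3" "T \<subseteq> carrier PGL3"
    for S T :: "('a ^ 3 ^ 3) set set"
    using that PGL3_coset_eq by blast
  moreover have "openin (GL3_topology abv) (\<Union>(\<Union>K))"
    if "\<forall>S\<in>K. openin (GL3_topology abv) (\<Union>S)" for K
  proof -
    have "\<Union>(\<Union>K) = \<Union>(Union ` K)" by blast
    then show ?thesis using that by auto
  qed
  ultimately show ?thesis
    unfolding istopology_def by (simp add: openin_Int Sup_le_iff le_infI1)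
qed

definition PGL3_haar_measure :: "('a::field \<Rightarrow> real) \<Rightarrow> ('a ^ 3 ^ 3) set measure \<Rightarrow> bool" where
  "PGL3_haar_measure abv \<mu> \<longleftrightarrow>
     space \<mu> = carrier PGL3 \<and>
     sets \<mu> = sigma_sets (carrier PGL3) {U. openin (PGL3_topology abv) U} \<and>
     (\<forall>g\<in>carrier PGL3. \<forall>S\<in>sets \<mu>. emeasure \<mu> ((\<lambda>h. g \<otimes>\<^bsub>PGL3\<^esub> h) ` S) = emeasure \<mu> S) \<and>
     (\<forall>K. compactin (PGL3_topology abv) K \<longrightarrow> emeasure \<mu> K < \<infinity>) \<and>
     (\<forall>U. openin (PGL3_topology abv) U \<and> U \<noteq> {} \<longrightarrow> 0 < emeasure \<mu> U)"

text \<open>A discrete subgroup of finite covolume: a Borel set of finite Haar measure covers \<open>\<Gamma> \ G\<close>.\<close>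

definition PGL3_lattice :: "('a::field \<Rightarrow> real) \<Rightarrow> ('a ^ 3 ^ 3) set set \<Rightarrow> bool" where
  "PGL3_lattice abv \<Gamma> \<longleftrightarrow>
     subgroup \<Gamma> PGL3 \<and>
     subtopology (PGL3_topology abv) \<Gamma> = discrete_topology \<Gamma> \<and>
     (\<exists>\<mu> D. PGL3_haar_measure abv \<mu> \<and> D \<in> sets \<mu> \<and> emeasure \<mu> D < \<infinity> \<and>
        (\<Union>\<gamma>\<in>\<Gamma>. (\<lambda>h. \<gamma> \<otimes>\<^bsub>PGL3\<^esub> h) ` D) = carrier PGL3)"

definition torsion_free :: "('a::field ^ 3 ^ 3) set set \<Rightarrow> bool" where
  "torsion_free \<Gamma> \<longleftrightarrow>
     (\<forall>\<gamma>\<in>\<Gamma>. \<forall>k::nat. 0 < k \<and> \<gamma> [^]\<^bsub>PGL3\<^esub> k = \<one>\<^bsub>PGL3\<^esub> \<longrightarrow> \<gamma> = \<one>\<^bsub>PGL3\<^esub>)"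

section \<open>The building\<close>

definition standard_lattice :: "('a::field \<Rightarrow> real) \<Rightarrow> ('a ^ 3) set" where
  "standard_lattice abv = {x. \<forall>i. x $ i \<in> ring_of_integers abv}"

text \<open>
  \<open>A\<O>\<^sup>3\<close> with \<open>A\<close> invertible is the \<open>\<O>\<close>-span of a basis of \<open>F\<^sup>3\<close>, namely of the columns of \<open>A\<close>.
\<close>

definition O_lattice :: "('a::field \<Rightarrow> real) \<Rightarrow> ('a ^ 3) set \<Rightarrow> bool" where
  "O_lattice abv L \<longleftrightarrow> (\<exists>A. invertible A \<and> L = (\<lambda>x. A *v x) ` standard_lattice abv)"

definition scale_set :: "'a::field \<Rightarrow> ('a ^ 3) set \<Rightarrow> ('a ^ 3) set" where
  "scale_set c L = (\<lambda>x. c *s x) ` L"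

definition homothety_class :: "('a::field ^ 3) set \<Rightarrow> ('a ^ 3) set set" where
  "homothety_class L = {scale_set c L | c. c \<noteq> 0}"

definition vertices :: "('a::field \<Rightarrow> real) \<Rightarrow> ('a ^ 3) set set set" where
  "vertices abv = homothety_class ` {L. O_lattice abv L}"

text \<open>
  The list \<open>[L\<^sub>0, L\<^sub>1, \<dots>, L\<^sub>r]\<close> consists of the representatives
  \<open>g\<^sub>0\<O>\<^sup>3 > \<alpha>\<^sub>1g\<^sub>1\<O>\<^sup>3 > \<dots> > \<alpha>\<^sub>rg\<^sub>r\<O>\<^sup>3 > \<pi>g\<^sub>0\<O>\<^sup>3\<close> of the vertices of the cell.
\<close>

definition cells :: "('a::field \<Rightarrow> real) \<Rightarrow> 'a \<Rightarrow> ('a ^ 3) set set set set" where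
  "cells abv \<pi> = {homothety_class ` set Ls | Ls.
     Ls \<noteq> [] \<and> (\<forall>L\<in>set Ls. O_lattice abv L) \<and>
     sorted_wrt (\<lambda>L M. M \<subset> L) Ls \<and> scale_set \<pi> (hd Ls) \<subset> last Ls}"

definition ordered_cells :: "('a::field \<Rightarrow> real) \<Rightarrow> 'a \<Rightarrow> ('a ^ 3) set set list set" where
  "ordered_cells abv \<pi> = {Vs. distinct Vs \<and> set Vs \<in> cells abv \<pi>}"

definition vertex_act :: "('a::field ^ 3 ^ 3) set \<Rightarrow> ('a ^ 3) set set \<Rightarrow> ('a ^ 3) set set" where
  "vertex_act g V = {(\<lambda>x. A *v x) ` L | A L. A \<in> g \<and> L \<in> V}"

definition cell_act :: "('a::field ^ 3 ^ 3) set \<Rightarrow> ('a ^ 3) set set set \<Rightarrow> ('a ^ 3) set set set" where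
  "cell_act g \<sigma> = vertex_act g ` \<sigma>"

definition ordered_cell_act ::
  "('a::field ^ 3 ^ 3) set \<Rightarrow> ('a ^ 3) set set list \<Rightarrow> ('a ^ 3) set set list" where
  "ordered_cell_act g \<sigma> = map (vertex_act g) \<sigma>"

section \<open>Quotients by group actions\<close>

text \<open>
  \<open>orbit act \<Gamma>\<close> is the covering map \<open>\<phi>\<close>; points of a quotient by \<open>\<Gamma>\<close> are orbits, as sets.
\<close>

definition orbit :: "('g \<Rightarrow> 'c \<Rightarrow> 'c) \<Rightarrow> 'g set \<Rightarrow> 'c \<Rightarrow> 'c set" where
  "orbit act \<Gamma> \<sigma> = (\<lambda>\<gamma>. act \<gamma> \<sigma>) ` \<Gamma>"

definition quotient_set :: "('g \<Rightarrow> 'c \<Rightarrow> 'c) \<Rightarrow> 'g set \<Rightarrow> 'c set \<Rightarrow> 'c set set" where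
  "quotient_set act \<Gamma> C = orbit act \<Gamma> ` C"

definition some_lift :: "'c set \<Rightarrow> 'c" where
  "some_lift x = (SOME \<sigma>. \<sigma> \<in> x)"

section \<open>\<open>L\<^sup>2\<close>-spaces and spectra\<close>

text \<open>Functions on \<open>C\<close> are represented by their extension by zero to the whole type.\<close>

definition l2_space :: "'c set \<Rightarrow> ('c \<Rightarrow> complex) set" where
  "l2_space C = {f. (\<forall>x. x \<notin> C \<longrightarrow> f x = 0) \<and> (\<lambda>x. (cmod (f x))\<^sup>2) summable_on C}"

definition l2_norm :: "('c \<Rightarrow> complex) \<Rightarrow> real" where
  "l2_norm f = sqrt (\<Sum>\<^sub>\<infinity>x. (cmod (f x))\<^sup>2)"

definition l2_inner :: "('c \<Rightarrow> complex) \<Rightarrow> ('c \<Rightarrow> complex) \<Rightarrow> complex" where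
  "l2_inner f h = (\<Sum>\<^sub>\<infinity>x. f x * cnj (h x))"

text \<open>The complement of the set of all \<open>z\<close> for which \<open>A - z\<close> has a bounded inverse on \<open>H\<close>.\<close>

definition op_spectrum ::
  "('c \<Rightarrow> complex) set \<Rightarrow> (('c \<Rightarrow> complex) \<Rightarrow> 'c \<Rightarrow> complex) \<Rightarrow> complex set" where
  "op_spectrum H A = {z. \<not>
     (bij_betw (\<lambda>f x. A f x - z * f x) H H \<and>
      (\<exists>K. \<forall>f\<in>H. l2_norm f \<le> K * l2_norm (\<lambda>x. A f x - z * f x)))}"

section \<open>Geometric operators and Ramanujan complexes\<close>

definition geometric_operator ::
  "('g \<Rightarrow> 'c \<Rightarrow> 'c) \<Rightarrow> 'g set \<Rightarrow> 'c set \<Rightarrow> ('c \<Rightarrow> 'c set) \<Rightarrow> bool" where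
  "geometric_operator act G C T \<longleftrightarrow>
     (\<forall>\<sigma>\<in>C. finite (T \<sigma>) \<and> T \<sigma> \<subseteq> C) \<and>
     (\<forall>g\<in>G. \<forall>\<sigma>\<in>C. T (act g \<sigma>) = act g ` T \<sigma>)"

definition adjacency :: "'c set \<Rightarrow> ('c \<Rightarrow> 'c set) \<Rightarrow> ('c \<Rightarrow> complex) \<Rightarrow> 'c \<Rightarrow> complex" where
  "adjacency C T f \<sigma> = (if \<sigma> \<in> C then \<Sum>\<sigma>'\<in>T \<sigma>. f \<sigma>' else 0)"

text \<open>
  The adjacency operator of \<open>T|\<^sub>X = \<phi>T\<phi>\<^sup>-\<^sup>1\<close>. Summing over \<open>T \<sigma>\<close>, and not over its image in the
  quotient, counts the images with multiplicity. As \<open>T\<close> commutes with \<open>G\<close>, nothing depends on the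
  choice of the lift.
\<close>

definition quotient_adjacency ::
  "('g \<Rightarrow> 'c \<Rightarrow> 'c) \<Rightarrow> 'g set \<Rightarrow> 'c set \<Rightarrow> ('c \<Rightarrow> 'c set) \<Rightarrow> ('c set \<Rightarrow> complex) \<Rightarrow> 'c set \<Rightarrow> complex"
where
  "quotient_adjacency act \<Gamma> C T f x =
     (if x \<in> quotient_set act \<Gamma> C then \<Sum>\<sigma>'\<in>T (some_lift x). f (orbit act \<Gamma> \<sigma>') else 0)"

definition trivial_function ::
  "('g \<Rightarrow> 'c \<Rightarrow> 'c) \<Rightarrow> 'g set \<Rightarrow> 'g set \<Rightarrow> 'c set \<Rightarrow> ('c set \<Rightarrow> complex) \<Rightarrow> bool" where
  "trivial_function act S \<Gamma> C h \<longleftrightarrow>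
     (\<forall>s\<in>S. \<forall>\<sigma>\<in>C. h (orbit act \<Gamma> (act s \<sigma>)) = h (orbit act \<Gamma> \<sigma>))"

definition l2_nontrivial ::
  "('g \<Rightarrow> 'c \<Rightarrow> 'c) \<Rightarrow> 'g set \<Rightarrow> 'g set \<Rightarrow> 'c set \<Rightarrow> ('c set \<Rightarrow> complex) set" where
  "l2_nontrivial act S \<Gamma> C =
     {f \<in> l2_space (quotient_set act \<Gamma> C).
        \<forall>h \<in> l2_space (quotient_set act \<Gamma> C). trivial_function act S \<Gamma> C h \<longrightarrow> l2_inner f h = 0}"

definition ramanujan_on ::
  "(('a::field ^ 3 ^ 3) set \<Rightarrow> 'c \<Rightarrow> 'c) \<Rightarrow> 'c set \<Rightarrow> ('a ^ 3 ^ 3) set set \<Rightarrow> bool" where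
  "ramanujan_on act all_cells \<Gamma> \<longleftrightarrow>
     (\<forall>C T. C \<subseteq> all_cells \<and> (\<forall>g\<in>carrier PGL3. act g ` C \<subseteq> C) \<and>
        geometric_operator act (carrier PGL3) C T \<longrightarrow>
        op_spectrum (l2_nontrivial act PSL3 \<Gamma> C) (quotient_adjacency act \<Gamma> C T)
          \<subseteq> op_spectrum (l2_space C) (adjacency C T))"

text \<open>\<open>\<Gamma> \ \<B>\<close> is a Ramanujan complex.\<close>

definition ramanujan_complex ::
  "('a::field \<Rightarrow> real) \<Rightarrow> 'a \<Rightarrow> ('a ^ 3 ^ 3) set set \<Rightarrow> bool" where
  "ramanujan_complex abv \<pi> \<Gamma> \<longleftrightarrow>
     PGL3_lattice abv \<Gamma> \<and> torsion_free \<Gamma> \<and>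
     ramanujan_on cell_act (cells abv \<pi>) \<Gamma> \<and>
     ramanujan_on ordered_cell_act (ordered_cells abv \<pi>) \<Gamma>"

section \<open>Simple random walk and mixing time\<close>

definition neighbours :: "('a::field \<Rightarrow> real) \<Rightarrow> 'a \<Rightarrow> ('a ^ 3) set set \<Rightarrow> ('a ^ 3) set set set" where
  "neighbours abv \<pi> V = {W. W \<noteq> V \<and> {V, W} \<in> cells abv \<pi>}"

primrec building_srw ::
  "('a::field \<Rightarrow> real) \<Rightarrow> 'a \<Rightarrow> ('a ^ 3) set set \<Rightarrow> nat \<Rightarrow> ('a ^ 3) set set pmf" where
  "building_srw abv \<pi> \<zeta> 0 = return_pmf \<zeta>"
| "building_srw abv \<pi> \<zeta> (Suc t) =
     bind_pmf (building_srw abv \<pi> \<zeta> t) (\<lambda>V. pmf_of_set (neighbours abv \<pi> V))"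

definition quotient_vertices ::
  "('a::field \<Rightarrow> real) \<Rightarrow> ('a ^ 3 ^ 3) set set \<Rightarrow> ('a ^ 3) set set set set" where
  "quotient_vertices abv \<Gamma> = quotient_set vertex_act \<Gamma> (vertices abv)"

definition quotient_srw ::
  "('a::field \<Rightarrow> real) \<Rightarrow> 'a \<Rightarrow> ('a ^ 3 ^ 3) set set \<Rightarrow> ('a ^ 3) set set set \<Rightarrow> nat
     \<Rightarrow> ('a ^ 3) set set set pmf" where
  "quotient_srw abv \<pi> \<Gamma> v t =
     map_pmf (orbit vertex_act \<Gamma>) (building_srw abv \<pi> (some_lift v) t)"

definition tv_dist :: "'v pmf \<Rightarrow> 'v pmf \<Rightarrow> real" where
  "tv_dist \<mu> \<nu> = 1 / 2 * (\<Sum>\<^sub>\<infinity>x. \<bar>pmf \<mu> x - pmf \<nu> x\<bar>)"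

definition t_mix ::
  "('a::field \<Rightarrow> real) \<Rightarrow> 'a \<Rightarrow> ('a ^ 3 ^ 3) set set \<Rightarrow> real \<Rightarrow> nat" where
  "t_mix abv \<pi> \<Gamma> \<epsilon> =
     (LEAST t. \<forall>v\<in>quotient_vertices abv \<Gamma>.
        tv_dist (quotient_srw abv \<pi> \<Gamma> v t) (pmf_of_set (quotient_vertices abv \<Gamma>)) < \<epsilon>)"

end

theory Submission
  imports Defs "HOL-Real_Asymp.Real_Asymp"
begin

text \<open>
  Let \<open>D\<^sub>a\<^sub>b = diag(\<pi>\<^sup>a\<^sup>+\<^sup>b, \<pi>\<^sup>b, 1)\<close>. By Cartan decomposition, the spheres \<open>{gD\<^sub>a\<^sub>b\<xi> | g\<xi> = V}\<close> around a vertex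
  \<open>V\<close> are the orbits of its stabilizer, and up to the symmetry \<open>(a, b) \<leftrightarrow> (b, a)\<close> they are the neighbourhoods of
  \<open>V\<close> for self-adjoint geometric operators. The simple random walk is a mixture of uniform distributions on them.

  Let \<open>h\<close> be the Busemann function of the standard flag, which is read off from Iwasawa decomposition. Counting
  Hermite normal forms, \<open>q\<^sup>-\<^sup>h\<close> is a Schur test function that bounds the norm of the operator of a sphere of radius
  \<open>d = a + b\<close> by \<open>O(d\<^sup>4 q\<^sup>d)\<close>, about the square root of the size \<open>q\<^sup>2\<^sup>d\<close> of the sphere. On a Ramanujan complex
  this norm bound is inherited by the nontrivial functions, so as soon as \<open>q\<^sup>2\<^sup>d\<close> exceeds \<open>n\<close> times a polynomial in
  \<open>d\<close>, the sphere equidistributes within its colours; the colours mix exponentially fast.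

  Under the walk, \<open>h\<close> has independent increments: \<open>1\<close>, \<open>0\<close>, \<open>-1\<close> in proportion \<open>q\<^sup>2 : q : 1\<close>. A positive proportion
  of every sphere of radius \<open>d\<close> has the maximal height \<open>d\<close>, hence the distance from the origin at time \<open>t\<close> is
  \<open>(q\<^sup>2 - 1) / (q\<^sup>2 + q + 1) t + O(\<surd>t)\<close> with high probability. For the lower bound, the walk is then still in a
  ball of size much smaller than \<open>n\<close>.
\<close>

section \<open>Spectra of geometric operators\<close>

text \<open>The Ramanujan condition compares spectra, not norms. On the building the Schur test
  bounds a norm, hence a spectrum; on X a bound on the spectrum is turned back into one on the norm
  by self-adjointness. This is why opposite spheres are merged. Self-adjointness on X rests in turn
  on Gamma acting freely on vertices: powers of an element that fixes a vertex come arbitrarily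
  close to the identity, so discreteness makes it a torsion element. The weight q^(-h) is the
  balanced one: there are q^(2k+l) Hermite forms with diagonal exponents k, l, m, each changes h by
  k - m, and q^(2k+l) q^(m-k) = q^(k+l+m) is the same for all types. Only the number of types
  remains as a polynomial loss. With L = log n to the base q^2, radius L + sqrt L absorbs this loss,
  because q^(-sqrt L) decays faster than any power of L. Fluctuations of the height at time t of
  order L are also of order sqrt L; hence the window. Trivial functions need not be constant, since
  PSL_3 preserves colours. A point mass is therefore compared first with the uniform distribution on
  the vertices of X that trivial functions cannot separate from it.\<close>

lemma l2_norm_nonneg: "0 \<le> l2_norm f"
  unfolding l2_norm_def by (simp add: infsum_nonneg)

lemma l2_summable_UNIV:
  assumes "f \<in> l2_space C"
  shows "(\<lambda>x. (cmod (f x))\<^sup>2) summable_on UNIV"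
proof -
  have "(\<lambda>x. (cmod (f x))\<^sup>2) summable_on UNIV \<longleftrightarrow> (\<lambda>x. (cmod (f x))\<^sup>2) summable_on C"
    by (rule summable_on_cong_neutral) (use assms in \<open>auto simp: l2_space_def\<close>)
  then show ?thesis using assms by (auto simp: l2_space_def)
qed

lemma L2_set_le_l2_norm:
  assumes "f \<in> l2_space C" "finite F"
  shows "L2_set (\<lambda>x. cmod (f x)) F \<le> l2_norm f"
proof -
  have "(\<Sum>x\<in>F. (cmod (f x))\<^sup>2) \<le> (\<Sum>\<^sub>\<infinity>x. (cmod (f x))\<^sup>2)"
    by (rule finite_sum_le_infsum) (use l2_summable_UNIV[OF assms(1)] assms(2) in auto)
  then show ?thesis by (simp add: L2_set_def l2_norm_def)
qed

lemma cmod_le_l2_norm: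
  assumes "f \<in> l2_space C"
  shows "cmod (f x) \<le> l2_norm f"
  using L2_set_le_l2_norm[OF assms, of "{x}"] by simp

text \<open>Reduces membership and norm bound together to finite partial sums, so that operators are
  estimated with finite sums only.\<close>

lemma l2_spaceI:
  assumes "\<And>x. x \<notin> C \<Longrightarrow> f x = 0"
    and le: "\<And>F. finite F \<Longrightarrow> F \<subseteq> C \<Longrightarrow> L2_set (\<lambda>x. cmod (f x)) F \<le> B"
  shows "f \<in> l2_space C" "l2_norm f \<le> B"
proof -
  have B: "0 \<le> B" using le[of "{}"] by simp
  have le2: "(\<Sum>x\<in>F. (cmod (f x))\<^sup>2) \<le> B\<^sup>2" if "finite F" "F \<subseteq> C" for F
    using power_mono[OF le[OF that], of 2] by (simp add: L2_set_def sum_nonneg)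
  have sC: "(\<lambda>x. (cmod (f x))\<^sup>2) summable_on C"
    by (rule nonneg_bdd_above_summable_on) (use le2 in \<open>auto intro!: bdd_aboveI2\<close>)
  then show 1: "f \<in> l2_space C" using assms(1) by (auto simp: l2_space_def)
  have "(\<Sum>\<^sub>\<infinity>x. (cmod (f x))\<^sup>2) = (\<Sum>\<^sub>\<infinity>x\<in>C. (cmod (f x))\<^sup>2)"
    by (rule infsum_cong_neutral) (use assms(1) in auto)
  also have "\<dots> \<le> B\<^sup>2"
    by (rule infsum_le_finite_sums[OF sC]) (use le2 in auto)
  finally show "l2_norm f \<le> B" unfolding l2_norm_def using B by (simp add: real_le_lsqrt)
qed

text \<open>Cauchy-Schwarz with weight \<open>w\<close> bounds |Af(x)|^2 by c w(x) times the sum of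
  |f(y)|^2 / w(y) over y in T x. Summing over x and exchanging the sums, symmetry of T turns the
  inner sum into one over T y, where the inequality for \<open>w\<close> applies a second
  time.\<close>

lemma schur_test:
  assumes T: "\<And>x. x \<in> C \<Longrightarrow> finite (T x)" "\<And>x. x \<in> C \<Longrightarrow> T x \<subseteq> C"
    and sym: "\<And>x y. x \<in> C \<Longrightarrow> y \<in> C \<Longrightarrow> y \<in> T x \<longleftrightarrow> x \<in> T y"
    and pos: "\<And>x. x \<in> C \<Longrightarrow> 0 < w x"
    and w: "\<And>x. x \<in> C \<Longrightarrow> (\<Sum>y\<in>T x. w y) \<le> c * w x"
    and c: "0 \<le> (c::real)" and f: "f \<in> l2_space C"
  shows "adjacency C T f \<in> l2_space C" "l2_norm (adjacency C T f) \<le> c * l2_norm f"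
proof -
  have main: "L2_set (\<lambda>x. cmod (adjacency C T f x)) F \<le> c * l2_norm f" if F: "finite F" "F \<subseteq> C" for F
  proof -
    let ?Y = "\<Union>x\<in>F. T x"
    have Y: "finite ?Y" "?Y \<subseteq> C" using T F by auto
    have "(cmod (adjacency C T f x))\<^sup>2 \<le> (\<Sum>y | y \<in> ?Y \<and> y \<in> T x. c * w x * ((cmod (f y))\<^sup>2 / w y))" if x: "x \<in> F" for x
    proof -
      have xC: "x \<in> C" using x F by auto
      have "cmod (adjacency C T f x) \<le> (\<Sum>y\<in>T x. cmod (f y))"
        using xC by (simp add: adjacency_def norm_sum)
      also have "\<dots> = (\<Sum>y\<in>T x. sqrt (w y) * (cmod (f y) / sqrt (w y)))"
      proof (rule sum.cong)
        fix y assume "y \<in> T x"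
        then have "0 < w y" using pos T(2)[OF xC] by auto
        then show "cmod (f y) = sqrt (w y) * (cmod (f y) / sqrt (w y))" by simp
      qed simp
      finally have "(cmod (adjacency C T f x))\<^sup>2 \<le> (\<Sum>y\<in>T x. sqrt (w y) * (cmod (f y) / sqrt (w y)))\<^sup>2"
        by (rule power_mono) simp
      also have "\<dots> \<le> (\<Sum>y\<in>T x. (sqrt (w y))\<^sup>2) * (\<Sum>y\<in>T x. (cmod (f y) / sqrt (w y))\<^sup>2)"
        by (rule Cauchy_Schwarz_ineq_sum)
      also have "\<dots> = (\<Sum>y\<in>T x. w y) * (\<Sum>y\<in>T x. (cmod (f y))\<^sup>2 / w y)"
      proof -
        have "0 \<le> w y" if "y \<in> T x" for y using pos[of y] T(2)[OF xC] that by force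
        then show ?thesis by (intro arg_cong2[of _ _ _ _ "(*)"] sum.cong) (auto simp: power_divide)
      qed
      also have "\<dots> \<le> c * w x * (\<Sum>y\<in>T x. (cmod (f y))\<^sup>2 / w y)"
        by (rule mult_right_mono[OF w[OF xC]]) (rule sum_nonneg, use pos T(2)[OF xC] in \<open>auto intro!: divide_nonneg_pos\<close>)
      also have "\<dots> = (\<Sum>y\<in>T x. c * w x * ((cmod (f y))\<^sup>2 / w y))" by (rule sum_distrib_left)
      also have "T x = {y. y \<in> ?Y \<and> y \<in> T x}" using x by auto
      finally show ?thesis .
    qed
    then have "(\<Sum>x\<in>F. (cmod (adjacency C T f x))\<^sup>2)
        \<le> (\<Sum>x\<in>F. \<Sum>y | y \<in> ?Y \<and> y \<in> T x. c * w x * ((cmod (f y))\<^sup>2 / w y))"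
      by (rule sum_mono)
    also have "\<dots> = (\<Sum>y\<in>?Y. \<Sum>x | x \<in> F \<and> y \<in> T x. c * w x * ((cmod (f y))\<^sup>2 / w y))"
      by (rule sum.swap_restrict) (use F Y in auto)
    also have "\<dots> \<le> (\<Sum>y\<in>?Y. c\<^sup>2 * (cmod (f y))\<^sup>2)"
    proof (rule sum_mono)
      fix y assume "y \<in> ?Y"
      then have yC: "y \<in> C" using Y by auto
      have "(\<Sum>x | x \<in> F \<and> y \<in> T x. c * w x * ((cmod (f y))\<^sup>2 / w y))
         = c * ((cmod (f y))\<^sup>2 / w y) * (\<Sum>x | x \<in> F \<and> y \<in> T x. w x)"
        unfolding sum_distrib_left by (intro sum.cong refl) simp
      also have "\<dots> \<le> c * ((cmod (f y))\<^sup>2 / w y) * (\<Sum>x\<in>T y. w x)"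
      proof (intro mult_left_mono sum_mono2)
        show "finite (T y)" using T(1)[OF yC] .
        show "{x. x \<in> F \<and> y \<in> T x} \<subseteq> T y" using F(2) sym[OF _ yC] by blast
        show "0 \<le> w x" if "x \<in> T y - {x. x \<in> F \<and> y \<in> T x}" for x
          using that T(2)[OF yC] pos[of x] by fastforce
        show "0 \<le> c * ((cmod (f y))\<^sup>2 / w y)" using c pos[OF yC] by simp
      qed
      also have "\<dots> \<le> c * ((cmod (f y))\<^sup>2 / w y) * (c * w y)"
        by (intro mult_left_mono w yC mult_nonneg_nonneg c divide_nonneg_pos pos) auto
      also have "\<dots> = c\<^sup>2 * (cmod (f y))\<^sup>2" using pos[OF yC] by (simp add: power2_eq_square)
      finally show "(\<Sum>x | x \<in> F \<and> y \<in> T x. c * w x * ((cmod (f y))\<^sup>2 / w y)) \<le> c\<^sup>2 * (cmod (f y))\<^sup>2" .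
    qed
    also have "\<dots> = c\<^sup>2 * (L2_set (\<lambda>x. cmod (f x)) ?Y)\<^sup>2"
      by (simp add: L2_set_def sum_nonneg sum_distrib_left)
    also have "\<dots> \<le> c\<^sup>2 * (l2_norm f)\<^sup>2"
      by (intro mult_left_mono power_mono L2_set_le_l2_norm[OF f] Y) (auto simp: L2_set_nonneg)
    finally have "(\<Sum>x\<in>F. (cmod (adjacency C T f x))\<^sup>2) \<le> (c * l2_norm f)\<^sup>2" by (simp add: power_mult_distrib)
    from real_sqrt_le_mono[OF this] show ?thesis
      unfolding L2_set_def by (simp add: c l2_norm_nonneg)
  qed
  have z: "x \<notin> C \<Longrightarrow> adjacency C T f x = 0" for x by (simp add: adjacency_def)
  show "adjacency C T f \<in> l2_space C" "l2_norm (adjacency C T f) \<le> c * l2_norm f"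
    using l2_spaceI[of C "adjacency C T f", OF z main] by auto
qed

lemma L2_set_cmod_add:
  "L2_set (\<lambda>x. cmod (f x + g x)) F \<le> L2_set (\<lambda>x. cmod (f x)) F + L2_set (\<lambda>x. cmod (g x)) F"
  by (rule order_trans[OF _ L2_set_triangle_ineq], rule L2_set_mono) (auto intro: norm_triangle_ineq)

lemma L2_set_cmod_scale: "L2_set (\<lambda>x. cmod (c * f x)) F = cmod c * L2_set (\<lambda>x. cmod (f x)) F"
  by (simp add: norm_mult L2_set_right_distrib)

lemma l2_space_add_scaled:
  assumes "f \<in> l2_space C" "g \<in> l2_space C"
  shows "(\<lambda>x. f x + c * g x) \<in> l2_space C" "l2_norm (\<lambda>x. f x + c * g x) \<le> l2_norm f + cmod c * l2_norm g"
proof -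
  have z: "f x + c * g x = 0" if "x \<notin> C" for x using that assms by (simp add: l2_space_def)
  have le: "L2_set (\<lambda>x. cmod (f x + c * g x)) F \<le> l2_norm f + cmod c * l2_norm g" if "finite F" for F
  proof -
    have "L2_set (\<lambda>x. cmod (f x + c * g x)) F \<le> L2_set (\<lambda>x. cmod (f x)) F + cmod c * L2_set (\<lambda>x. cmod (g x)) F"
      using L2_set_cmod_add[of f "\<lambda>x. c * g x" F] by (simp add: L2_set_cmod_scale)
    also have "\<dots> \<le> l2_norm f + cmod c * l2_norm g"
      by (intro add_mono mult_left_mono L2_set_le_l2_norm[OF assms(1) that] L2_set_le_l2_norm[OF assms(2) that]) auto
    finally show ?thesis .
  qed
  show "(\<lambda>x. f x + c * g x) \<in> l2_space C" "l2_norm (\<lambda>x. f x + c * g x) \<le> l2_norm f + cmod c * l2_norm g"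
    using l2_spaceI[of C "\<lambda>x. f x + c * g x", OF z le] by auto
qed

text \<open>The Neumann series is summed pointwise, so completeness of \<open>l2_space\<close> is not required.\<close>

lemma op_spectrum_adjacency_subset:
  assumes T: "\<And>x. x \<in> C \<Longrightarrow> finite (T x)" "\<And>x. x \<in> C \<Longrightarrow> T x \<subseteq> C"
    and sym: "\<And>x y. x \<in> C \<Longrightarrow> y \<in> C \<Longrightarrow> y \<in> T x \<longleftrightarrow> x \<in> T y"
    and pos: "\<And>x. x \<in> C \<Longrightarrow> 0 < w x"
    and w: "\<And>x. x \<in> C \<Longrightarrow> (\<Sum>y\<in>T x. w y) \<le> c * w x"
    and c: "0 \<le> (c::real)"
  shows "op_spectrum (l2_space C) (adjacency C T) \<subseteq> {z. cmod z \<le> c}"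
proof (rule subsetI, rule CollectI, rule ccontr)
  fix z assume zs: "z \<in> op_spectrum (l2_space C) (adjacency C T)" and "\<not> cmod z \<le> c"
  then have z: "c < cmod z" by simp
  let ?A = "adjacency C T" and ?H = "l2_space C"
  have AH: "?A f \<in> ?H" and An: "l2_norm (?A f) \<le> c * l2_norm f" if "f \<in> ?H" for f
    using schur_test[OF T sym pos w c that] by auto
  have lin: "?A (\<lambda>x. f x + a * g x) = (\<lambda>x. ?A f x + a * ?A g x)" for f g a
    by (rule ext) (auto simp: adjacency_def sum.distrib sum_distrib_left)
  \<comment> \<open>From z f = A f - g follows |z| |f| <= c |f| + |g|, so A - z is bounded below by
    |z| - c.\<close>
  have Bn: "l2_norm f \<le> 1 / (cmod z - c) * l2_norm (\<lambda>x. ?A f x - z * f x)" if f: "f \<in> ?H" for f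
  proof -
    let ?g = "\<lambda>x. ?A f x - z * f x"
    have g: "?g \<in> ?H" using l2_space_add_scaled(1)[OF AH[OF f] f, of "-z"] by simp
    have b: "cmod z * L2_set (\<lambda>x. cmod (f x)) F \<le> c * l2_norm f + l2_norm ?g" if F: "finite F" for F
    proof -
      have "cmod z * L2_set (\<lambda>x. cmod (f x)) F = L2_set (\<lambda>x. cmod (?A f x + (-1) * ?g x)) F"
        by (simp add: L2_set_cmod_scale)
      also have "\<dots> \<le> L2_set (\<lambda>x. cmod (?A f x)) F + L2_set (\<lambda>x. cmod ((-1) * ?g x)) F"
        by (rule L2_set_cmod_add)
      also have "\<dots> \<le> c * l2_norm f + l2_norm ?g"
        by (subst L2_set_cmod_scale)
          (use L2_set_le_l2_norm[OF AH[OF f] F] L2_set_le_l2_norm[OF g F] An[OF f] in simp)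
      finally show ?thesis .
    qed
    have "L2_set (\<lambda>x. cmod (f x)) F \<le> (c * l2_norm f + l2_norm ?g) / cmod z" if F: "finite F" for F
    proof -
      have "0 < cmod z" using z c by linarith
      then show ?thesis using b[OF F] by (simp add: pos_le_divide_eq mult.commute)
    qed
    then have "l2_norm f \<le> (c * l2_norm f + l2_norm ?g) / cmod z"
      using f by (intro l2_spaceI(2)[of C]) (auto simp: l2_space_def)
    moreover have "0 < cmod z" "0 < cmod z - c" using z c by linarith+
    ultimately show ?thesis by (simp add: pos_le_divide_eq algebra_simps)
  qed
  have "bij_betw (\<lambda>f x. ?A f x - z * f x) ?H ?H"
    unfolding bij_betw_def
  proof (intro conjI inj_onI equalityI subsetI)
    fix f h assume fh: "f \<in> ?H" "h \<in> ?H" and eq: "(\<lambda>x. ?A f x - z * f x) = (\<lambda>x. ?A h x - z * h x)"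
    define d where "d = (\<lambda>x. f x + (-1) * h x)"
    have d: "d \<in> ?H" unfolding d_def by (rule l2_space_add_scaled(1)[OF fh])
    have "(\<lambda>x. ?A d x - z * d x) = (\<lambda>x. 0)"
    proof
      fix x
      have "?A f x - z * f x = ?A h x - z * h x" by (rule fun_cong[OF eq])
      then show "?A d x - z * d x = 0" unfolding d_def lin by (simp add: algebra_simps)
    qed
    then have "l2_norm d \<le> 0" using Bn[OF d] by (simp add: l2_norm_def)
    then have "cmod (d x) \<le> 0" for x using cmod_le_l2_norm[OF d, of x] by linarith
    then show "f = h" by (auto simp: d_def fun_eq_iff)
  next
    fix g assume "g \<in> (\<lambda>f x. ?A f x - z * f x) ` ?H"
    then obtain f where f: "f \<in> ?H" "g = (\<lambda>x. ?A f x - z * f x)" by blast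
    show "g \<in> ?H" using l2_space_add_scaled(1)[OF AH[OF f(1)] f(1), of "-z"] by (simp add: f(2))
  next
    fix g assume g: "g \<in> ?H"
    define P where "P k = (?A ^^ k) g" for k
    have P: "P k \<in> ?H" "l2_norm (P k) \<le> c ^ k * l2_norm g" for k
    proof (induction k)
      case (Suc k)
      show "P (Suc k) \<in> ?H" using AH[OF Suc(1)] by (simp add: P_def)
      show "l2_norm (P (Suc k)) \<le> c ^ Suc k * l2_norm g"
        using An[OF Suc(1)] mult_left_mono[OF Suc(2) c] by (simp add: P_def mult.assoc)
    qed (simp_all add: P_def g)
    \<comment> \<open>Terms of the Neumann series - sum_k A^k g / z^(k+1), the candidate for a
      preimage of g under A - z.\<close>
    define t where "t k x = - P k x / z ^ Suc k" for k x
    have z0: "z \<noteq> 0" using z c by auto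
    define r where "r = c / cmod z"
    have zp: "0 < cmod z" using z c by linarith
    have r: "0 \<le> r" "r < 1" using z c zp by (simp_all add: r_def)
    have rb: "1 / cmod z ^ Suc k * B \<le> l2_norm g / cmod z * r ^ k" if "B \<le> c ^ k * l2_norm g" for B k
    proof -
      have "1 / cmod z ^ Suc k * B \<le> 1 / cmod z ^ Suc k * (c ^ k * l2_norm g)"
        by (rule mult_left_mono[OF that]) simp
      also have "\<dots> = l2_norm g / cmod z * r ^ k" by (simp add: r_def power_divide)
      finally show ?thesis .
    qed
    have tb: "cmod (t k x) \<le> l2_norm g / cmod z * r ^ k" for k x
    proof -
      have "cmod (P k x) \<le> c ^ k * l2_norm g" using cmod_le_l2_norm[OF P(1)] P(2) order_trans by blast
      from rb[OF this] show ?thesis by (simp add: t_def norm_divide norm_mult norm_power)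
    qed
    have st: "summable (\<lambda>k. t k x)" for x
    proof (rule summable_comparison_test')
      show "summable (\<lambda>k. l2_norm g / cmod z * r ^ k)"
        using r by (intro summable_mult summable_geometric) auto
    qed (rule tb)
    define f where "f x = (\<Sum>k. t k x)" for x
    have fz: "f x = 0" if "x \<notin> C" for x
      using P(1) that by (auto simp: f_def t_def l2_space_def)
    have fF: "L2_set (\<lambda>x. cmod (f x)) F \<le> l2_norm g / cmod z / (1 - r)" if F: "finite F" for F
    proof -
      \<comment> \<open>On a fixed finite set F the bound holds for partial sums by the triangle
        inequality and survives the pointwise limit.\<close>
      have part: "L2_set (\<lambda>x. cmod (\<Sum>k<K. t k x)) F \<le> (\<Sum>k<K. l2_norm g / cmod z * r ^ k)" for K
      proof (induction K)
        case (Suc K)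
        have "L2_set (\<lambda>x. cmod (\<Sum>k<Suc K. t k x)) F
           \<le> L2_set (\<lambda>x. cmod (\<Sum>k<K. t k x)) F + L2_set (\<lambda>x. cmod (t K x)) F"
          using L2_set_cmod_add[of "\<lambda>x. \<Sum>k<K. t k x" "t K" F] by simp
        also have "L2_set (\<lambda>x. cmod (t K x)) F = L2_set (\<lambda>x. cmod ((- 1 / z ^ Suc K) * P K x)) F"
          by (simp add: t_def)
        also have "\<dots> \<le> l2_norm g / cmod z * r ^ K"
        proof -
          have "L2_set (\<lambda>x. cmod (P K x)) F \<le> c ^ K * l2_norm g"
            using L2_set_le_l2_norm[OF P(1) F] P(2) order_trans by blast
          from rb[OF this] show ?thesis
            unfolding L2_set_cmod_scale by (simp add: norm_divide norm_mult norm_power)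
        qed
        finally show ?case using Suc by simp
      qed (simp add: L2_set_def)
      have sg: "summable (\<lambda>k. l2_norm g / cmod z * r ^ k)"
        using r by (intro summable_mult summable_geometric) auto
      have s1: "(\<Sum>k<K. l2_norm g / cmod z * r ^ k) \<le> (\<Sum>k. l2_norm g / cmod z * r ^ k)" for K
        by (rule sum_le_suminf[OF sg]) (use r in \<open>auto simp: l2_norm_nonneg\<close>)
      have s2: "(\<Sum>k. l2_norm g / cmod z * r ^ k) = l2_norm g / cmod z / (1 - r)"
        using r by (subst suminf_mult) (auto simp: suminf_geometric summable_geometric)
      have part': "L2_set (\<lambda>x. cmod (\<Sum>k<K. t k x)) F \<le> l2_norm g / cmod z / (1 - r)" for K
        unfolding s2[symmetric] by (rule order_trans[OF part s1])
      have "(\<lambda>K. L2_set (\<lambda>x. cmod (\<Sum>k<K. t k x)) F) \<longlonglongrightarrow> L2_set (\<lambda>x. cmod (f x)) F"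
        unfolding L2_set_def f_def
        by (intro tendsto_real_sqrt tendsto_sum tendsto_power tendsto_norm summable_LIMSEQ st)
      then show ?thesis by (rule LIMSEQ_le_const2) (use part' in auto)
    qed
    have fH: "f \<in> ?H" by (rule l2_spaceI(1)[of C f, OF fz fF])
    have "?A f x - z * f x = g x" for x
    proof (cases "x \<in> C")
      case True
      \<comment> \<open>\<open>T x\<close> is finite, so A can be applied term by term; this shifts
        the index of the series by one.\<close>
      have "?A f x = (\<Sum>k. \<Sum>y\<in>T x. t k y)"
        using True st by (simp add: adjacency_def f_def suminf_sum)
      also have "\<dots> = (\<Sum>k. z * t (Suc k) x)"
        using True z0 by (simp add: t_def P_def adjacency_def sum_negf sum_divide_distrib[symmetric])
      also have "\<dots> = z * (\<Sum>k. t (Suc k) x)"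
        by (rule suminf_mult) (subst summable_Suc_iff, rule st)
      also have "(\<Sum>k. t (Suc k) x) = f x - t 0 x" unfolding f_def by (rule suminf_split_head[OF st[of x]])
      finally show ?thesis using z0 by (simp add: t_def P_def algebra_simps)
    next
      case False
      then show ?thesis using fz g by (simp add: adjacency_def l2_space_def)
    qed
    then have "g = (\<lambda>x. ?A f x - z * f x)" by auto
    then show "g \<in> (\<lambda>f x. ?A f x - z * f x) ` ?H" using fH by blast
  qed
  moreover have "\<exists>K. \<forall>f\<in>?H. l2_norm f \<le> K * l2_norm (\<lambda>x. ?A f x - z * f x)"
    by (intro exI[of _ "1 / (cmod z - c)"] ballI Bn)
  ultimately have "z \<notin> op_spectrum ?H ?A" by (simp add: op_spectrum_def)
  then show False using zs by simp
qed

section \<open>Self-adjoint operators on functions of finite support\<close>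

lemma l2_norm_finite:
  assumes "finite Q" "\<And>x. x \<notin> Q \<Longrightarrow> f x = 0"
  shows "l2_norm f = L2_set (\<lambda>x. cmod (f x)) Q"
proof -
  have "(\<Sum>\<^sub>\<infinity>x. (cmod (f x))\<^sup>2) = (\<Sum>\<^sub>\<infinity>x\<in>Q. (cmod (f x))\<^sup>2)"
    by (rule infsum_cong_neutral) (use assms(2) in auto)
  then show ?thesis using assms(1) by (simp add: l2_norm_def L2_set_def)
qed

lemma l2_inner_finite:
  assumes "finite Q" "\<And>x. x \<notin> Q \<Longrightarrow> f x = 0"
  shows "l2_inner f h = (\<Sum>x\<in>Q. f x * cnj (h x))"
proof -
  have "(\<Sum>\<^sub>\<infinity>x. f x * cnj (h x)) = (\<Sum>\<^sub>\<infinity>x\<in>Q. f x * cnj (h x))"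
    by (rule infsum_cong_neutral) (use assms(2) in auto)
  then show ?thesis using assms(1) by (simp add: l2_inner_def)
qed

text \<open>
  With \<open>m\<^sup>2\<close> the supremum of the Rayleigh quotients \<open>\<parallel>A f\<parallel>\<^sup>2 / \<parallel>f\<parallel>\<^sup>2\<close>, one has
  \<open>\<parallel>(A\<^sup>2 - m\<^sup>2) f\<parallel>\<^sup>2 \<le> m\<^sup>2 (m\<^sup>2 \<parallel>f\<parallel>\<^sup>2 - \<parallel>A f\<parallel>\<^sup>2)\<close>, so \<open>A - m\<close> and \<open>A + m\<close> are not both bounded below.
\<close>

lemma selfadjoint_norm_le_spectrum:
  fixes A :: "('c \<Rightarrow> complex) \<Rightarrow> 'c \<Rightarrow> complex"
  assumes Q: "finite Q" and supp: "\<And>f x. f \<in> H \<Longrightarrow> x \<notin> Q \<Longrightarrow> f x = 0"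
    and comb: "\<And>f g a. f \<in> H \<Longrightarrow> g \<in> H \<Longrightarrow> (\<lambda>x. f x + a * g x) \<in> H"
    and AH: "\<And>f. f \<in> H \<Longrightarrow> A f \<in> H"
    and lin: "\<And>f g a. f \<in> H \<Longrightarrow> g \<in> H \<Longrightarrow> A (\<lambda>x. f x + a * g x) = (\<lambda>x. A f x + a * A g x)"
    and sa: "\<And>f g. f \<in> H \<Longrightarrow> g \<in> H \<Longrightarrow> (\<Sum>x\<in>Q. A f x * cnj (g x)) = (\<Sum>x\<in>Q. f x * cnj (A g x))"
    and bdd: "\<And>f. f \<in> H \<Longrightarrow> l2_norm (A f) \<le> B * l2_norm f"
    and spec: "op_spectrum H A \<subseteq> {z. cmod z \<le> \<rho>}" and \<rho>: "0 \<le> \<rho>" and f: "f \<in> H"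
  shows "l2_norm (A f) \<le> \<rho> * l2_norm f"
proof (rule ccontr)
  assume "\<not> l2_norm (A f) \<le> \<rho> * l2_norm f"
  then have f1: "\<rho> * l2_norm f < l2_norm (A f)" by simp
  define S where "S h = (l2_norm h)\<^sup>2" for h :: "'c \<Rightarrow> complex"
  have S: "S h = (\<Sum>x\<in>Q. (cmod (h x))\<^sup>2)" if "h \<in> H" for h
    using l2_norm_finite[OF Q supp[OF that]] by (simp add: S_def L2_set_def sum_nonneg)
  have nn: "0 \<le> l2_norm h" for h :: "'c \<Rightarrow> complex" unfolding l2_norm_def by (simp add: infsum_nonneg)
  have fpos: "0 < l2_norm f"
  proof (rule ccontr)
    assume "\<not> 0 < l2_norm f"
    then have "l2_norm f = 0" using nn[of f] by simp
    then show False using bdd[OF f] f1 by simp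
  qed
  let ?R = "{S (A h) / S h | h. h \<in> H \<and> 0 < S h}"
  have Rb: "S (A h) / S h \<le> B\<^sup>2" if "h \<in> H" "0 < S h" for h
  proof -
    have "S (A h) \<le> (B * l2_norm h)\<^sup>2" unfolding S_def by (rule power_mono[OF bdd nn]) (use that in auto)
    then show ?thesis using that(2) by (simp add: S_def power_mult_distrib pos_divide_le_eq)
  qed
  then have bd: "bdd_above ?R" by (auto intro!: bdd_aboveI[of _ "B\<^sup>2"])
  define M where "M = Sup ?R"
  have fR: "S (A f) / S f \<in> ?R" using f fpos by (auto simp: S_def)
  have "\<rho>\<^sup>2 * S f < S (A f)"
    using power_strict_mono[OF f1, of 2] nn[of f] \<rho> by (simp add: S_def power_mult_distrib)
  then have "\<rho>\<^sup>2 < S (A f) / S f" using fpos by (simp add: S_def pos_less_divide_eq)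
  also have "\<dots> \<le> M" unfolding M_def by (rule cSup_upper[OF fR bd])
  finally have M: "\<rho>\<^sup>2 < M" .
  then have M0: "0 < M" using zero_le_power2[of \<rho>] by linarith
  have leM: "S (A h) \<le> M * S h" if h: "h \<in> H" for h :: "'c \<Rightarrow> complex"
  proof (cases "0 < S h")
    case True
    then have "S (A h) / S h \<le> M" unfolding M_def using h by (intro cSup_upper[OF _ bd]) auto
    then show ?thesis using True by (simp add: pos_divide_le_eq)
  next
    case False
    then have "l2_norm h = 0" by (simp add: S_def)
    then have "l2_norm (A h) = 0" using bdd[OF h] nn[of "A h"] by simp
    then show ?thesis using M0 by (simp add: S_def)
  qed
  define m where "m = sqrt M"
  have m: "\<rho> < m" "m * m = M" using M M0 \<rho> by (auto simp: m_def real_less_rsqrt)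
  \<comment> \<open>Both m and -m lie outside the disc of radius \<open>\<rho>\<close>, so A - m and
    A + m are both bounded below.\<close>
  have "complex_of_real s \<notin> op_spectrum H A" if "\<bar>s\<bar> = m" for s
    using spec that m(1) by (auto dest!: subsetD)
  then have "\<exists>K. \<forall>h\<in>H. l2_norm h \<le> K * l2_norm (\<lambda>x. A h x - complex_of_real s * h x)" if "\<bar>s\<bar> = m" for s
    using that by (simp add: op_spectrum_def)
  from this[of m] this[of "-m"] obtain K1 K2
    where K1: "\<And>h. h \<in> H \<Longrightarrow> l2_norm h \<le> K1 * l2_norm (\<lambda>x. A h x - complex_of_real m * h x)"
      and K2: "\<And>h. h \<in> H \<Longrightarrow> l2_norm h \<le> K2 * l2_norm (\<lambda>x. A h x - complex_of_real (-m) * h x)"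
    using m(1) \<rho> by auto
  define K where "K = \<bar>K1\<bar> * \<bar>K2\<bar>"
  \<comment> \<open>The two lower bounds compose, as (A + m)(A - m) = A^2 - M.\<close>
  have K: "S h \<le> K\<^sup>2 * S (\<lambda>x. A (A h) x - complex_of_real M * h x)" if h: "h \<in> H" for h :: "'c \<Rightarrow> complex"
  proof -
    let ?g = "\<lambda>x. A h x - complex_of_real m * h x"
    have g: "?g \<in> H" using comb[OF AH[OF h] h, of "-m"] by simp
    have "(\<lambda>x. A ?g x - complex_of_real (-m) * ?g x) = (\<lambda>x. A (A h) x - complex_of_real M * h x)"
      using lin[OF AH[OF h] h, of "-m"] by (simp add: fun_eq_iff algebra_simps m(2)[symmetric])
    then have *: "l2_norm ?g \<le> K2 * l2_norm (\<lambda>x. A (A h) x - complex_of_real M * h x)" using K2[OF g] by simp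
    have "l2_norm h \<le> \<bar>K1\<bar> * l2_norm ?g"
      by (rule order_trans[OF K1[OF h] mult_right_mono[OF abs_ge_self nn]])
    also have "\<dots> \<le> \<bar>K1\<bar> * (\<bar>K2\<bar> * l2_norm (\<lambda>x. A (A h) x - complex_of_real M * h x))"
      by (rule mult_left_mono[OF order_trans[OF * mult_right_mono[OF abs_ge_self nn]] abs_ge_zero])
    finally have "l2_norm h \<le> K * l2_norm (\<lambda>x. A (A h) x - complex_of_real M * h x)" by (simp add: K_def mult.assoc)
    from power_mono[OF this nn, of 2] show ?thesis by (simp add: S_def power_mult_distrib)
  qed
  have key: "S (\<lambda>x. A (A h) x - complex_of_real M * h x) \<le> M * (M * S h - S (A h))" if h: "h \<in> H" for h :: "'c \<Rightarrow> complex"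
  proof -
    have gH: "(\<lambda>x. A (A h) x - complex_of_real M * h x) \<in> H" using comb[OF AH[OF AH[OF h]] h, of "- of_real M"] by simp
    have "(cmod (a - M * b))\<^sup>2 = (cmod a)\<^sup>2 - 2 * M * Re (a * cnj b) + M\<^sup>2 * (cmod b)\<^sup>2" for a b :: complex
      unfolding cmod_power2 by (simp add: power2_eq_square algebra_simps)
    then have "S (\<lambda>x. A (A h) x - complex_of_real M * h x)
      = S (A (A h)) - 2 * M * Re (\<Sum>x\<in>Q. A (A h) x * cnj (h x)) + M\<^sup>2 * S h"
      by (simp add: S gH h AH sum.distrib sum_subtractf sum_distrib_left distrib_left mult.assoc)
    also have "(\<Sum>x\<in>Q. A (A h) x * cnj (h x)) = (\<Sum>x\<in>Q. A h x * cnj (A h x))"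
      by (rule sa[OF AH[OF h] h])
    also have "Re \<dots> = S (A h)" by (simp add: S AH h cmod_power2 flip: power2_eq_square)
    also have "S (A (A h)) \<le> M * S (A h)" by (rule leM[OF AH[OF h]])
    finally show ?thesis by (simp add: power2_eq_square algebra_simps)
  qed
  \<comment> \<open>Chosen so that \<open>K\<^sup>2 * M * d < 1\<close>: by \<open>key\<close>, a
    vector whose Rayleigh quotient exceeds M - d violates the lower bound \<open>K\<close>. The
    added 1 keeps the denominator positive when K = 0.\<close>
  define d where "d = 1 / (2 * (K\<^sup>2 * M + 1))"
  have KM: "0 \<le> K\<^sup>2 * M" using M0 by simp
  have "0 < 1 / (2 * (X + 1)) \<and> X * (1 / (2 * (X + 1))) < 1" if "0 \<le> X" for X :: real
    using that by (simp add: field_simps)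
  from this[OF KM] have d: "0 < d" "K\<^sup>2 * M * d < 1" by (simp_all only: d_def)
  have "M - d < Sup ?R" using d by (simp add: M_def)
  then obtain h where h: "h \<in> H" "0 < S h" "M - d < S (A h) / S h"
    using less_cSup_iff[OF _ bd] fR by blast
  from h have "M * S h - S (A h) < d * S h" by (simp add: field_simps)
  then have "S (\<lambda>x. A (A h) x - complex_of_real M * h x) \<le> M * (d * S h)"
    using key[OF h(1)] M0 by (meson less_imp_le mult_left_mono order_trans)
  then have "S h \<le> K\<^sup>2 * (M * (d * S h))" using K[OF h(1)] by (meson mult_left_mono order_trans zero_le_power2)
  also have "\<dots> = (K\<^sup>2 * M * d) * S h" by simp
  also have "\<dots> < S h" using mult_strict_right_mono[OF d(2) h(2)] by simp
  finally show False by simp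
qed

section \<open>Valuations and residues\<close>

context nonarch_local_field begin

section \<open>The discrete valuation\<close>

lemma abv_0 [simp]: "abv 0 = 0" by (simp add: abv_eq_0_iff)

lemma abv_1 [simp]: "abv 1 = 1"
proof -
  have "abv 1 * abv 1 = abv 1" using abv_mult[of 1 1] by simp
  moreover have "abv 1 \<noteq> 0" by (simp add: abv_eq_0_iff)
  ultimately show ?thesis by simp
qed

lemma abv_pos: "x \<noteq> 0 \<Longrightarrow> 0 < abv x"
  using abv_nonneg[of x] abv_eq_0_iff[of x] by linarith

lemma abv_power: "abv (x ^ k) = abv x ^ k"
  by (induction k) (simp_all add: abv_mult)

lemma abv_minus [simp]: "abv (- x) = abv x"
proof -
  have "abv (-1) * abv (-1) = 1" using abv_mult[of "-1" "-1"] by simp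
  then have "abv (-1) = 1" using abv_nonneg[of "-1"] by (simp add: square_eq_1_iff)
  then show ?thesis using abv_mult[of "-1" x] by simp
qed

lemma abv_minus_commute: "abv (x - y) = abv (y - x)"
  using abv_minus[of "x - y"] by simp

lemma abv_inverse: "abv (inverse x) = inverse (abv x)"
proof (cases "x = 0")
  case False
  then have "abv (inverse x) * abv x = 1" using abv_mult[of "inverse x" x] by simp
  then show ?thesis by (metis inverse_unique mult.commute)
qed simp

lemma abv_divide: "abv (x / y) = abv x / abv y"
  by (simp add: divide_inverse abv_mult abv_inverse)

lemma abv_add_le: "abv x \<le> c \<Longrightarrow> abv y \<le> c \<Longrightarrow> abv (x + y) \<le> c"
  using abv_add[of x y] by auto

lemma abv_diff_le: "abv x \<le> c \<Longrightarrow> abv y \<le> c \<Longrightarrow> abv (x - y) \<le> c"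
  using abv_add_le[of x c "-y"] by simp

lemma abv_mult_le_1: "abv x \<le> 1 \<Longrightarrow> abv y \<le> 1 \<Longrightarrow> abv (x * y) \<le> 1"
  by (simp add: abv_mult abv_nonneg mult_le_one)

lemma abv_unif: "0 < abv \<pi>" "abv \<pi> < 1"
proof -
  show "0 < abv \<pi>" by (rule abv_pos[OF uniformizer_nonzero])
  have "\<pi> * 1 \<in> maximal_ideal abv" unfolding uniformizer by (auto simp: ring_of_integers_def)
  then show "abv \<pi> < 1" by (simp add: maximal_ideal_def)
qed

lemma abv_powi: "abv (x powi k) = abv x powi k"
  by (auto simp: power_int_def abv_power abv_inverse)

text \<open>The exponent k is taken with |pi|^(k+1) < |x| <= |pi|^k. Then y = x / pi^k satisfies
  |pi| < |y| <= 1, and |y| = 1 because every element of the maximal ideal is a multiple of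
  pi.\<close>

lemma ex_val:
  assumes x: "x \<noteq> 0"
  shows "\<exists>k::int. abv x = abv \<pi> powi k"
proof -
  let ?p = "abv \<pi>"
  note p = abv_unif
  define k where "k = \<lfloor>ln (abv x) / ln ?p\<rfloor>"
  have lp: "ln ?p < 0" using p by (simp add: ln_less_zero)
  have x0: "0 < abv x" by (rule abv_pos[OF x])
  define y where "y = x / \<pi> powi k"
  have y: "abv y = abv x / ?p powi k" by (simp add: y_def abv_divide abv_powi)
  have pk: "?p powi j = exp (of_int j * ln ?p)" for j :: int
    using p by (metis exp_ln exp_power_int mult.commute)
  have k1: "of_int k \<le> ln (abv x) / ln ?p" "ln (abv x) / ln ?p < of_int k + 1"
    by (simp_all add: k_def)
  have "ln (abv x) \<le> of_int k * ln ?p" using k1(1) lp by (simp add: neg_le_divide_eq)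
  then have "abv x \<le> ?p powi k" using x0 by (metis exp_ln exp_le_cancel_iff pk)
  then have y1: "abv y \<le> 1" using p by (simp add: y)
  have "of_int (k + 1) * ln ?p < ln (abv x)" using k1(2) lp by (simp add: neg_divide_less_eq)
  then have "?p powi (k + 1) < abv x" using x0 by (metis exp_ln exp_less_cancel_iff pk)
  then have y2: "?p < abv y" using p by (simp add: y power_int_add_1 pos_less_divide_eq mult.commute)
  have "abv y = 1"
  proof (rule ccontr)
    assume "abv y \<noteq> 1"
    then have "y \<in> maximal_ideal abv" using y1 by (simp add: maximal_ideal_def)
    then obtain z where "y = \<pi> * z" "abv z \<le> 1" unfolding uniformizer by (auto simp: ring_of_integers_def)
    then have "abv y \<le> ?p" using p by (simp add: abv_mult mult_left_le)
    then show False using y2 by simp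
  qed
  then show ?thesis using y p by (intro exI[of _ k]) (simp add: divide_eq_1_iff)
qed

text \<open>The exponent is unique by \<open>powi_unif_inj\<close>. At 0 there is none and the value
  is arbitrary.\<close>

definition val :: "'a \<Rightarrow> int" where
  "val x = (SOME k. abv x = abv \<pi> powi k)"

lemma abv_eq_val: "x \<noteq> 0 \<Longrightarrow> abv x = abv \<pi> powi val x"
  unfolding val_def by (rule someI_ex[OF ex_val])

lemma powi_unif_inj: "abv \<pi> powi j = abv \<pi> powi k \<longleftrightarrow> j = k"
proof -
  have "j = k" if "abv \<pi> powi j = abv \<pi> powi k" for j k
  proof -
    have "exp (of_int j * ln (abv \<pi>)) = exp (of_int k * ln (abv \<pi>))"
      using that abv_unif by (metis exp_ln exp_power_int mult.commute)
    then show ?thesis using abv_unif by simp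
  qed
  then show ?thesis by auto
qed

lemma powi_unif_le: "abv \<pi> powi j \<le> abv \<pi> powi k \<longleftrightarrow> k \<le> j"
proof -
  have e: "abv \<pi> powi j = exp (of_int j * ln (abv \<pi>))" for j :: int
    using abv_unif by (metis exp_ln exp_power_int mult.commute)
  have "ln (abv \<pi>) < 0" using abv_unif by (simp add: ln_less_zero)
  then show ?thesis unfolding e by (simp add: mult_le_cancel_right)
qed

lemma val_eqI: "abv x = abv \<pi> powi k \<Longrightarrow> val x = k"
  by (metis abv_eq_val abv_eq_0_iff abv_unif(1) less_irrefl power_int_eq_0_iff powi_unif_inj)

lemma val_mult: "x \<noteq> 0 \<Longrightarrow> y \<noteq> 0 \<Longrightarrow> val (x * y) = val x + val y"
  using abv_unif by (intro val_eqI) (simp add: abv_mult abv_eq_val power_int_add)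

lemma val_unif_powi [simp]: "val (\<pi> powi k) = k"
  by (rule val_eqI) (simp add: abv_powi)

lemma val_unit [simp]: "abv x = 1 \<Longrightarrow> val x = 0"
  by (rule val_eqI) simp

lemma powi_unif_nonzero [simp]: "\<pi> powi k \<noteq> 0"
  using uniformizer_nonzero by simp

lemma abv_powi_le_1 [simp]: "abv (\<pi> powi k) \<le> 1 \<longleftrightarrow> 0 \<le> k"
  using powi_unif_le[of k 0] by (simp add: abv_powi)

lemma abv_unif_power_le_1 [simp]: "abv (\<pi> ^ k) \<le> 1"
  using abv_unif by (simp add: abv_power power_le_one)

section \<open>Representatives of the integers modulo powers of the uniformizer\<close>

definition reps :: "nat \<Rightarrow> 'a set \<Rightarrow> bool" where
  "reps k R \<longleftrightarrow> finite R \<and> card R = residue_card abv ^ k \<and> R \<subseteq> ring_of_integers abv \<and>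
     (\<forall>x. abv x \<le> 1 \<longrightarrow> (\<exists>r\<in>R. abv (x - r) \<le> abv \<pi> ^ k)) \<and>
     (\<forall>r\<in>R. \<forall>s\<in>R. abv (r - s) \<le> abv \<pi> ^ k \<longrightarrow> r = s)"

definition residue_rel :: "('a \<times> 'a) set" where
  "residue_rel = {(x, y). x \<in> ring_of_integers abv \<and> y \<in> ring_of_integers abv \<and> x - y \<in> maximal_ideal abv}"

lemma abv_less_1_iff: "abv x < 1 \<longleftrightarrow> abv x \<le> abv \<pi>"
proof
  assume "abv x < 1"
  then have "x \<in> maximal_ideal abv" by (simp add: maximal_ideal_def)
  then obtain z where "x = \<pi> * z" "abv z \<le> 1" unfolding uniformizer by (auto simp: ring_of_integers_def)
  then show "abv x \<le> abv \<pi>" using abv_unif by (simp add: abv_mult mult_left_le)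
qed (use abv_unif in simp)

lemma equiv_residue_rel: "equiv (ring_of_integers abv) residue_rel"
proof (rule equivI)
  show "refl_on (ring_of_integers abv) residue_rel"
    by (auto simp: refl_on_def residue_rel_def maximal_ideal_def)
  show "sym residue_rel" by (auto simp: sym_def residue_rel_def maximal_ideal_def abv_minus_commute)
  show "trans residue_rel"
  proof (rule transI)
    fix x y z assume "(x, y) \<in> residue_rel" "(y, z) \<in> residue_rel"
    then show "(x, z) \<in> residue_rel"
      using abv_add[of "x - y" "y - z"] by (auto simp: residue_rel_def maximal_ideal_def)
  qed
qed (auto simp: residue_rel_def)

lemma ex_reps_1: "\<exists>R. reps 1 R"
proof -
  let ?O = "ring_of_integers abv"
  have Q: "residue_field abv = ?O // residue_rel" by (simp add: residue_field_def residue_rel_def)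
  define R where "R = (\<lambda>c. SOME x. x \<in> c) ` residue_field abv"
  have some: "(SOME x. x \<in> c) \<in> c" if "c \<in> residue_field abv" for c
    using that in_quotient_imp_non_empty[OF equiv_residue_rel] unfolding Q by (auto simp: some_in_eq)
  have inj: "inj_on (\<lambda>c. SOME x. x \<in> c) (residue_field abv)"
  proof (rule inj_onI)
    fix c d assume cd: "c \<in> residue_field abv" "d \<in> residue_field abv" and "(SOME x. x \<in> c) = (SOME x. x \<in> d)"
    then have "c \<inter> d \<noteq> {}" using some[of c] some[of d] by auto
    then show "c = d" using quotient_disj[OF equiv_residue_rel, of c d] cd unfolding Q by blast
  qed
  have "reps 1 R" unfolding reps_def
  proof (intro conjI allI impI ballI)
    show "finite R" using finite_residue_field by (simp add: R_def)
    show "card R = residue_card abv ^ 1" using card_image[OF inj] by (simp add: R_def residue_card_def)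
    show "R \<subseteq> ?O"
      using some in_quotient_imp_subset[OF equiv_residue_rel] unfolding R_def Q by blast
  next
    fix x assume x: "abv x \<le> 1"
    then have c: "residue_rel `` {x} \<in> residue_field abv"
      unfolding Q by (intro quotientI) (simp add: ring_of_integers_def)
    define y where "y = (SOME y. y \<in> residue_rel `` {x})"
    have "(x, y) \<in> residue_rel" using some[OF c] unfolding y_def by (simp only: Image_singleton_iff)
    then have "abv (x - y) < 1" by (simp add: residue_rel_def maximal_ideal_def)
    moreover have "y \<in> R" unfolding R_def y_def by (rule imageI[OF c])
    ultimately show "\<exists>r\<in>R. abv (x - r) \<le> abv \<pi> ^ 1" by (auto simp: abv_less_1_iff)
  next
    fix r s assume rs: "r \<in> R" "s \<in> R" "abv (r - s) \<le> abv \<pi> ^ 1"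
    then obtain c d where cd: "c \<in> residue_field abv" "d \<in> residue_field abv" "r = (SOME y. y \<in> c)" "s = (SOME y. y \<in> d)"
      by (auto simp: R_def)
    have rc: "r \<in> c" "s \<in> d" using some cd by auto
    have "r \<in> ?O" "s \<in> ?O"
      using rc cd in_quotient_imp_subset[OF equiv_residue_rel] unfolding Q by blast+
    then have "(r, s) \<in> residue_rel" using rs(3) by (simp add: residue_rel_def maximal_ideal_def abv_less_1_iff)
    then have "c = d" using quotient_eqI[OF equiv_residue_rel] cd(1,2) rc unfolding Q by blast
    then show "r = s" using cd by simp
  qed
  then show ?thesis ..
qed

text \<open>The representatives of 0 and 1 differ, since a common one would put 1 into the maximal
  ideal.\<close>

lemma residue_card_ge_2: "2 \<le> residue_card abv"
proof -
  obtain R where R: "reps 1 R" using ex_reps_1 by blast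
  then obtain r s where rs: "r \<in> R" "s \<in> R" "abv (0 - r) \<le> abv \<pi>" "abv (1 - s) \<le> abv \<pi>"
    unfolding reps_def by (metis abv_0 abv_1 order_refl power_one_right zero_le_one)
  have "r \<noteq> s"
  proof
    assume "r = s"
    then have "abv (1 - 0) \<le> abv \<pi>" using abv_add_le[of "1 - s" "abv \<pi>" "s"] rs by simp
    then show False using abv_unif by simp
  qed
  then have "card {r, s} = 2" by simp
  moreover have "card {r, s} \<le> card R" using rs R by (intro card_mono) (auto simp: reps_def)
  ultimately show ?thesis using R by (simp add: reps_def)
qed

text \<open>Expansion in powers of pi: with r running through representatives modulo pi^k and s
  modulo pi, the sums r + pi^k s represent the residues modulo pi^(k+1).\<close>

lemma ex_reps: "\<exists>R. reps k R"
proof (induction k)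
  case 0
  have "reps 0 {0}" by (auto simp: reps_def ring_of_integers_def)
  then show ?case ..
next
  case (Suc k)
  then obtain R S where R: "reps k R" and S: "reps 1 S" using ex_reps_1 by blast
  let ?f = "\<lambda>(r, s). r + \<pi> ^ k * s"
  have pk: "0 < abv \<pi> ^ k" using abv_unif by simp
  \<comment> \<open>One estimate serves twice: for distinctness of the sums, hence the cardinality,
    and for uniqueness of the representative.\<close>
  have eq: "r = r' \<and> s = s'" if "r \<in> R" "r' \<in> R" "s \<in> S" "s' \<in> S"
    and le: "abv ((r + \<pi> ^ k * s) - (r' + \<pi> ^ k * s')) \<le> abv \<pi> ^ Suc k" for r r' s s'
  proof -
    have ss: "abv (s' - s) \<le> 1" using that S by (intro abv_diff_le) (auto simp: reps_def ring_of_integers_def)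
    have "abv (\<pi> ^ k * (s' - s)) \<le> abv \<pi> ^ k"
      using ss pk by (simp add: abv_mult abv_power mult_left_le)
    moreover have "abv \<pi> ^ Suc k \<le> abv \<pi> ^ k" using abv_unif by (intro power_decreasing) auto
    ultimately have "abv (((r + \<pi> ^ k * s) - (r' + \<pi> ^ k * s')) + \<pi> ^ k * (s' - s)) \<le> abv \<pi> ^ k"
      using le by (intro abv_add_le) auto
    then have "abv (r - r') \<le> abv \<pi> ^ k" by (simp add: algebra_simps)
    then have r: "r = r'" using R that by (auto simp: reps_def)
    then have "abv (\<pi> ^ k * (s - s')) \<le> abv \<pi> ^ k * abv \<pi>" using le by (simp add: algebra_simps)
    then have "abv (s - s') \<le> abv \<pi>" using pk by (simp add: abv_mult abv_power)
    then have "s = s'" using S that by (auto simp: reps_def)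
    with r show ?thesis by simp
  qed
  have inj: "inj_on ?f (R \<times> S)"
  proof (rule inj_onI)
    fix p p' assume "p \<in> R \<times> S" "p' \<in> R \<times> S" "?f p = ?f p'"
    then show "p = p'" using eq[of "fst p" "fst p'" "snd p" "snd p'"] pk abv_unif(1)
      by (auto simp: case_prod_unfold prod_eq_iff)
  qed
  have "reps (Suc k) (?f ` (R \<times> S))" unfolding reps_def
  proof (intro conjI allI impI ballI)
    show "finite (?f ` (R \<times> S))" using R S by (simp add: reps_def)
    show "card (?f ` (R \<times> S)) = residue_card abv ^ Suc k"
      using R S by (simp add: card_image[OF inj] reps_def card_cartesian_product)
    have "abv (r + \<pi> ^ k * s) \<le> 1" if "r \<in> R" "s \<in> S" for r s
      using that R S by (intro abv_add_le abv_mult_le_1) (auto simp: reps_def ring_of_integers_def)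
    then show "?f ` (R \<times> S) \<subseteq> ring_of_integers abv" by (auto simp: ring_of_integers_def)
  next
    fix x assume "abv x \<le> 1"
    then obtain r where r: "r \<in> R" "abv (x - r) \<le> abv \<pi> ^ k" using R by (auto simp: reps_def)
    define y where "y = (x - r) / \<pi> ^ k"
    have "abv y \<le> 1" using r pk by (simp add: y_def abv_divide abv_power)
    then obtain s where s: "s \<in> S" "abv (y - s) \<le> abv \<pi>" using S by (auto simp: reps_def)
    have "\<pi> ^ k * y = x - r" using uniformizer_nonzero by (simp add: y_def)
    then have "x - (r + \<pi> ^ k * s) = \<pi> ^ k * (y - s)" by (simp add: right_diff_distrib)
    then have "abv (x - (r + \<pi> ^ k * s)) \<le> abv \<pi> ^ Suc k"
      using s pk by (simp add: abv_mult abv_power)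
    then show "\<exists>t\<in>?f ` (R \<times> S). abv (x - t) \<le> abv \<pi> ^ Suc k" using r s by force
  next
    fix t u assume "t \<in> ?f ` (R \<times> S)" "u \<in> ?f ` (R \<times> S)" "abv (t - u) \<le> abv \<pi> ^ Suc k"
    then show "t = u" using eq by (auto simp del: power_Suc)
  qed
  then show ?case ..
qed

definition Rep :: "nat \<Rightarrow> 'a set" where "Rep k = (SOME R. reps k R)"

lemma reps_Rep: "reps k (Rep k)"
  unfolding Rep_def by (rule someI_ex[OF ex_reps])

lemma Rep_finite: "finite (Rep k)" and Rep_card: "card (Rep k) = residue_card abv ^ k"
  and Rep_int: "r \<in> Rep k \<Longrightarrow> abv r \<le> 1"
  and Rep_ex: "abv x \<le> 1 \<Longrightarrow> \<exists>r\<in>Rep k. abv (x - r) \<le> abv \<pi> ^ k"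
  and Rep_unique: "r \<in> Rep k \<Longrightarrow> s \<in> Rep k \<Longrightarrow> abv (r - s) \<le> abv \<pi> ^ k \<Longrightarrow> r = s"
  using reps_Rep[of k] by (auto simp: reps_def ring_of_integers_def)

end

section \<open>Matrices over the ring of integers\<close>

definition mk9 :: "'a::zero \<Rightarrow> 'a \<Rightarrow> 'a \<Rightarrow> 'a \<Rightarrow> 'a \<Rightarrow> 'a \<Rightarrow> 'a \<Rightarrow> 'a \<Rightarrow> 'a \<Rightarrow> 'a ^ 3 ^ 3" where
  "mk9 a b c d e f g h i = vector [vector [a, b, c], vector [d, e, f], vector [g, h, i]]"

lemma mk9_nth [simp]:
  "mk9 a b c d e f g h i $ 1 $ 1 = a" "mk9 a b c d e f g h i $ 1 $ 2 = b" "mk9 a b c d e f g h i $ 1 $ 3 = c"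
  "mk9 a b c d e f g h i $ 2 $ 1 = d" "mk9 a b c d e f g h i $ 2 $ 2 = e" "mk9 a b c d e f g h i $ 2 $ 3 = f"
  "mk9 a b c d e f g h i $ 3 $ 1 = g" "mk9 a b c d e f g h i $ 3 $ 2 = h" "mk9 a b c d e f g h i $ 3 $ 3 = i"
  by (simp_all add: mk9_def)

lemma mk9_eta: "A = mk9 (A$1$1) (A$1$2) (A$1$3) (A$2$1) (A$2$2) (A$2$3) (A$3$1) (A$3$2) (A$3$3)"
  by (simp add: vec_eq_iff forall_3)

lemma mk9_cases:
  obtains a b c d e f g h i where "A = mk9 a b c d e f g h i"
  using mk9_eta by blast

lemma mk9_eq_iff [simp]: "mk9 a b c d e f g h i = mk9 a' b' c' d' e' f' g' h' i' \<longleftrightarrow>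
    a = a' \<and> b = b' \<and> c = c' \<and> d = d' \<and> e = e' \<and> f = f' \<and> g = g' \<and> h = h' \<and> i = i'"
  by (auto simp: vec_eq_iff forall_3)

lemma mk9_mult: "mk9 a b c d e f g h i ** mk9 a' b' c' d' e' f' g' h' i' =
    (mk9 (a*a' + b*d' + c*g') (a*b' + b*e' + c*h') (a*c' + b*f' + c*i')
        (d*a' + e*d' + f*g') (d*b' + e*e' + f*h') (d*c' + e*f' + f*i')
        (g*a' + h*d' + i*g') (g*b' + h*e' + i*h') (g*c' + h*f' + i*i') :: 'a::field ^ 3 ^ 3)"
  by (simp add: vec_eq_iff forall_3 matrix_matrix_mult_def sum_3)

lemma mat_mk9: "(mat c :: 'a::field ^ 3 ^ 3) = mk9 c 0 0 0 c 0 0 0 c"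
  by (simp add: vec_eq_iff forall_3 mat_def)

lemma det_mk9: "det (mk9 a b c d e f g h i :: 'a::field ^ 3 ^ 3) =
    a*e*i + b*f*g + c*d*h - a*f*h - b*d*i - c*e*g"
  by (simp add: det_3)

lemma invertible_mat3: "invertible (mat c :: 'a::field ^ 3 ^ 3) \<longleftrightarrow> c \<noteq> 0"
  by (simp add: invertible_det_nz mat_mk9 det_mk9)

context nonarch_local_field begin

section \<open>The maximal compact subgroup and integral row and column operations\<close>

lemma abv_le_iff_val: "x \<noteq> 0 \<Longrightarrow> y \<noteq> 0 \<Longrightarrow> abv x \<le> abv y \<longleftrightarrow> val y \<le> val x"
  by (subst (1 2) abv_eq_val) (simp_all add: powi_unif_le)

declare uniformizer_nonzero [simp]

lemma abv_le_0_iff [simp]: "abv x \<le> 0 \<longleftrightarrow> x = 0"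
  using abv_pos[of x] by (auto simp: not_le[symmetric])

definition intg :: "'a ^ 3 ^ 3 \<Rightarrow> bool" where
  "intg A \<longleftrightarrow> (\<forall>i j. abv (A $ i $ j) \<le> 1)"

text \<open>The group GL_3(O). A unit determinant makes the inverse integral through the adjugate
  (\<open>KK_inverse\<close>).\<close>

definition KK :: "('a ^ 3 ^ 3) set" where
  "KK = {A. intg A \<and> abv (det A) = 1}"

lemma intg_mk9: "intg (mk9 a b c d e f g h i) \<longleftrightarrow> abv a \<le> 1 \<and> abv b \<le> 1 \<and> abv c \<le> 1 \<and>
    abv d \<le> 1 \<and> abv e \<le> 1 \<and> abv f \<le> 1 \<and> abv g \<le> 1 \<and> abv h \<le> 1 \<and> abv i \<le> 1"
  by (simp add: intg_def forall_3)

lemma intg_mult: "intg A \<Longrightarrow> intg B \<Longrightarrow> intg (A ** B)"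
  by (cases A rule: mk9_cases; cases B rule: mk9_cases)
    (simp add: mk9_mult intg_mk9 abv_add_le abv_mult_le_1)

lemma intg_scale: "abv c \<le> 1 \<Longrightarrow> intg A \<Longrightarrow> intg (mat c ** A)"
  by (rule intg_mult) (simp_all add: mat_mk9 intg_mk9)

lemma KK_mult: "A \<in> KK \<Longrightarrow> B \<in> KK \<Longrightarrow> A ** B \<in> KK"
  by (simp add: KK_def intg_mult det_mul abv_mult)

lemma KK_1 [simp]: "mat 1 \<in> KK"
  by (simp add: KK_def mat_mk9 intg_mk9 det_mk9)

text \<open>The adjugate, i.e. the transposed cofactor matrix.\<close>

definition adj :: "'a ^ 3 ^ 3 \<Rightarrow> 'a ^ 3 ^ 3" where
  "adj A = mk9 (A$2$2*A$3$3 - A$2$3*A$3$2) (A$1$3*A$3$2 - A$1$2*A$3$3) (A$1$2*A$2$3 - A$1$3*A$2$2)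
     (A$2$3*A$3$1 - A$2$1*A$3$3) (A$1$1*A$3$3 - A$1$3*A$3$1) (A$1$3*A$2$1 - A$1$1*A$2$3)
     (A$2$1*A$3$2 - A$2$2*A$3$1) (A$1$2*A$3$1 - A$1$1*A$3$2) (A$1$1*A$2$2 - A$1$2*A$2$1)"

lemma adj_mult: "A ** adj A = mat (det A)" "adj A ** A = mat (det A)"
  by (cases A rule: mk9_cases; simp add: adj_def mk9_mult mat_mk9 det_mk9 algebra_simps)+

lemma intg_adj: "intg A \<Longrightarrow> intg (adj A)"
  by (cases A rule: mk9_cases) (simp add: adj_def intg_mk9 abv_diff_le abv_mult_le_1)

lemma det_adj: "det A \<noteq> 0 \<Longrightarrow> det (adj A) = (det A)\<^sup>2"
proof -
  assume "det A \<noteq> 0"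
  moreover have "det A * det (adj A) = det A ^ 3"
    unfolding det_mul[symmetric] adj_mult by (simp add: mat_mk9 det_mk9 power3_eq_cube)
  ultimately show ?thesis by (simp add: power2_eq_square power3_eq_cube)
qed

lemma KK_inverse:
  assumes "A \<in> KK"
  shows "\<exists>B\<in>KK. A ** B = mat 1 \<and> B ** A = mat 1"
proof -
  have d: "abv (det A) = 1" "det A \<noteq> 0" using assms by (auto simp: KK_def)
  let ?B = "mat (inverse (det A)) ** adj A"
  have "?B \<in> KK"
    using assms d by (simp add: KK_def det_mul det_adj abv_mult abv_inverse abv_power intg_scale intg_adj)
      (simp add: mat_mk9 det_mk9 abv_mult abv_inverse)
  moreover have "A ** ?B = mat 1"
    using d by (metis adj_mult(1) mat_mult_commute mat_mult_mat matrix_mul_assoc right_inverse)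
  moreover have "?B ** A = mat 1"
    using d by (metis adj_mult(2) left_inverse mat_mult_mat matrix_mul_assoc)
  ultimately show ?thesis by blast
qed

text \<open>Permutation matrix of the transposition (p q); it exchanges rows from the left and
  columns from the right.\<close>

definition swapM :: "3 \<Rightarrow> 3 \<Rightarrow> 'a ^ 3 ^ 3" where
  "swapM p q = (\<chi> i. mat 1 $ Transposition.transpose p q i)"

lemma swapM_KK: "swapM p q \<in> KK"
proof -
  have "Transposition.transpose p q permutes (UNIV :: 3 set)" by (rule permutes_swap_id) auto
  from det_permute_rows[OF this, of "mat 1 :: 'a ^ 3 ^ 3"] have "abv (det (swapM p q)) = 1"
    by (cases "evenperm (Transposition.transpose p q)") (simp_all add: swapM_def sign_def)
  then show ?thesis by (auto simp: KK_def intg_def swapM_def mat_def)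
qed

lemma swapM_left: "swapM p q ** A = (\<chi> i. A $ Transposition.transpose p q i)"
  by (simp add: swapM_def vec_eq_iff matrix_matrix_mult_def mat_def if_distrib[of "\<lambda>u. u * _"] cong: if_cong)

lemma swapM_right: "A ** swapM p q = (\<chi> i j. A $ i $ Transposition.transpose p q j)"
proof -
  have "(Transposition.transpose p q k = j) = (k = Transposition.transpose p q j)" for k j
    by (metis transpose_involutory)
  then show ?thesis
    by (simp add: swapM_def vec_eq_iff matrix_matrix_mult_def mat_def if_distrib[of "\<lambda>u. _ * u"] cong: if_cong)
qed

text \<open>The inverse of the unit factor of x: multiplying by it normalizes a diagonal entry to a
  power of pi.\<close>

definition unit_part :: "'a \<Rightarrow> 'a" where "unit_part x = \<pi> powi val x / x"

lemma unit_part: "x \<noteq> 0 \<Longrightarrow> abv (unit_part x) = 1" "x \<noteq> 0 \<Longrightarrow> x * unit_part x = \<pi> powi val x"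
  "x \<noteq> 0 \<Longrightarrow> unit_part x \<noteq> 0"
  by (simp_all add: unit_part_def abv_divide abv_powi abv_eq_val[symmetric] abv_eq_0_iff uniformizer_nonzero)

lemma abv_div_le_1: "abv x \<le> abv y \<Longrightarrow> y \<noteq> 0 \<Longrightarrow> abv (x / y) \<le> 1"
  using abv_pos[of y] by (simp add: abv_divide)

lemma upper_KK: "abv p \<le> 1 \<Longrightarrow> abv q \<le> 1 \<Longrightarrow> abv r \<le> 1 \<Longrightarrow> mk9 1 p q 0 1 r 0 0 1 \<in> KK"
  by (simp add: KK_def intg_mk9 det_mk9)

lemma lower_KK: "abv p \<le> 1 \<Longrightarrow> abv q \<le> 1 \<Longrightarrow> abv r \<le> 1 \<Longrightarrow> mk9 1 0 0 p 1 0 q r 1 \<in> KK"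
  by (simp add: KK_def intg_mk9 det_mk9)

lemma diag_KK: "abv p = 1 \<Longrightarrow> abv q = 1 \<Longrightarrow> abv r = 1 \<Longrightarrow> mk9 p 0 0 0 q 0 0 0 r \<in> KK"
  by (simp add: KK_def intg_mk9 det_mk9 abv_mult)

section \<open>Iwasawa, Hermite and Smith normal forms\<close>

definition ut :: "int \<Rightarrow> int \<Rightarrow> int \<Rightarrow> 'a \<Rightarrow> 'a \<Rightarrow> 'a \<Rightarrow> 'a ^ 3 ^ 3" where
  "ut k l m x y z = mk9 (\<pi> powi k) x y 0 (\<pi> powi l) z 0 0 (\<pi> powi m)"

lemma ex_max_abv:
  fixes f :: "'b::finite \<Rightarrow> 'a"
  shows "\<exists>i. \<forall>j. abv (f j) \<le> abv (f i)"
proof -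
  have "Max (range (\<lambda>j. abv (f j))) \<in> range (\<lambda>j. abv (f j))" by (rule Max_in) auto
  then obtain i where "Max (range (\<lambda>j. abv (f j))) = abv (f i)" by blast
  then have "abv (f j) \<le> abv (f i)" for j by (metis Max_ge finite finite_imageI rangeI)
  then show ?thesis by blast
qed

text \<open>The entry of largest absolute value in the last row is the pivot, so that the
  multipliers of the column operations are integral.\<close>

lemma column_pivot:
  assumes "invertible A"
  shows "\<exists>k\<in>KK. \<exists>a b c d e f i. A ** k = mk9 a b c d e f 0 0 i"
proof -
  obtain j where j: "\<forall>j'. abv (A $ 3 $ j') \<le> abv (A $ 3 $ j)" using ex_max_abv by blast
  let ?B = "A ** swapM j 3"
  have B3: "abv (?B $ 3 $ j') \<le> abv (?B $ 3 $ 3)" for j' using j by (simp add: swapM_right)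
  obtain a b c d e f g h i where B: "?B = mk9 a b c d e f g h i" by (rule mk9_cases)
  have le: "abv g \<le> abv i" "abv h \<le> abv i" using B3[of 1] B3[of 2] by (simp_all add: B)
  have "det ?B \<noteq> 0"
    using assms swapM_KK[of j 3] by (auto simp: invertible_det_nz det_mul KK_def)
  then have i: "i \<noteq> 0" using le by (auto simp: B det_mk9)
  let ?L = "mk9 1 0 0 0 1 0 (-g/i) (-h/i) 1"
  have L: "?L \<in> KK" using le i by (intro lower_KK) (simp_all add: abv_div_le_1)
  have "A ** (swapM j 3 ** ?L) = mk9 (a - c*g/i) (b - c*h/i) c (d - f*g/i) (e - f*h/i) f 0 0 i"
    using i by (simp add: matrix_mul_assoc B mk9_mult)
  then show ?thesis using KK_mult[OF swapM_KK L] by blast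
qed

text \<open>Integral column operations clear the entries below the diagonal, beginning with the last
  row; a diagonal matrix of units then normalizes the diagonal.\<close>

lemma iwasawa:
  assumes A: "invertible A"
  shows "\<exists>h\<in>KK. \<exists>k l m x y z. A ** h = ut k l m x y z"
proof -
  obtain h1 a b c d e f i where h1: "h1 \<in> KK" "A ** h1 = mk9 a b c d e f 0 0 i"
    using column_pivot[OF A] by blast
  obtain h2 a b c e f where h2: "h2 \<in> KK" "A ** h1 ** h2 = mk9 a b c 0 e f 0 0 i"
  proof (cases "abv d \<le> abv e")
    case True
    show thesis
    proof (cases "e = 0")
      case True
      then have "d = 0" using \<open>abv d \<le> abv e\<close> abv_nonneg[of d] by (simp add: abv_eq_0_iff)
      then show thesis using that[of "mat 1"] h1 by simp
    next
      case False
      have "mk9 1 0 0 (-d/e) 1 0 0 0 1 \<in> KK" using True False by (intro lower_KK) (simp_all add: abv_div_le_1)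
      moreover have "A ** h1 ** mk9 1 0 0 (-d/e) 1 0 0 0 1 = mk9 (a - b*d/e) b c 0 e f 0 0 i"
        using False by (simp add: h1 mk9_mult)
      ultimately show thesis using that by blast
    qed
  next
    case False
    then have d: "d \<noteq> 0" using abv_nonneg[of e] by auto
    let ?h = "mk9 0 1 0 1 (-e/d) 0 0 0 1"
    have "abv (e/d) \<le> 1" using False d by (simp add: abv_div_le_1)
    then have "mk9 0 1 0 1 0 0 0 0 1 ** mk9 1 (-e/d) 0 0 1 0 0 0 1 \<in> KK"
      by (intro KK_mult upper_KK) (simp_all add: KK_def intg_mk9 det_mk9)
    then have "mk9 (-e/d) 1 0 1 0 0 0 0 1 \<in> KK"
      using \<open>abv (e/d) \<le> 1\<close> by (simp add: KK_def intg_mk9 det_mk9)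
    moreover have "A ** h1 ** mk9 (-e/d) 1 0 1 0 0 0 0 1 = mk9 (b - a*e/d) a c 0 d f 0 0 i"
      using d by (simp add: h1 mk9_mult)
    ultimately show thesis using that by blast
  qed
  have "det (A ** h1 ** h2) \<noteq> 0"
    unfolding det_mul using A h1(1) h2(1) by (auto simp: invertible_det_nz KK_def)
  then have nz: "a \<noteq> 0" "e \<noteq> 0" "i \<noteq> 0" by (auto simp: h2 det_mk9)
  let ?u = "mk9 (unit_part a) 0 0 0 (unit_part e) 0 0 0 (unit_part i)"
  have u: "?u \<in> KK" using nz by (intro diag_KK unit_part)
  have "A ** (h1 ** h2 ** ?u) = ut (val a) (val e) (val i) (b * unit_part e) (c * unit_part i) (f * unit_part i)"
    using nz by (simp add: matrix_mul_assoc h2 mk9_mult ut_def unit_part)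
  then show ?thesis using KK_mult[OF KK_mult[OF h1(1) h2(1)] u] by blast
qed

text \<open>Right multiplication by integral unipotent matrices changes an entry above the diagonal
  by multiples of the diagonal entry of its row, so x and y are reduced modulo pi^k and z modulo
  pi^l.\<close>

lemma hermite:
  assumes A: "invertible A" "intg A"
  shows "\<exists>h\<in>KK. \<exists>k l m :: nat. \<exists>x\<in>Rep k. \<exists>y\<in>Rep k. \<exists>z\<in>Rep l. A ** h = ut k l m x y z"
proof -
  obtain h k l m x y z where h: "h \<in> KK" "A ** h = ut k l m x y z" using iwasawa[OF A(1)] by blast
  have "intg (A ** h)" using A(2) h(1) by (simp add: KK_def intg_mult)
  then have "intg (ut k l m x y z)" unfolding h(2) .
  then have i: "0 \<le> k" "0 \<le> l" "0 \<le> m" "abv x \<le> 1" "abv y \<le> 1" "abv z \<le> 1"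
    by (simp_all add: ut_def intg_mk9)
  have red: "\<exists>r\<in>Rep (nat k). \<exists>s. abv s \<le> 1 \<and> x = r + \<pi> powi k * s" if xk: "abv x \<le> 1" "0 \<le> k" for x k
  proof -
    obtain r where r: "r \<in> Rep (nat k)" "abv (x - r) \<le> abv \<pi> ^ nat k" using Rep_ex[OF xk(1)] by blast
    have "abv ((x - r) / \<pi> powi k) \<le> 1"
      using r xk abv_unif by (simp add: abv_divide abv_powi power_int_def abv_power)
    then show ?thesis using r by (intro bexI[of _ r] exI[of _ "(x - r) / \<pi> powi k"]) auto
  qed
  obtain z' s where z: "z' \<in> Rep (nat l)" "abv s \<le> 1" "z = z' + \<pi> powi l * s" using red[OF i(6) i(2)] by blast
  obtain x' p where x: "x' \<in> Rep (nat k)" "abv p \<le> 1" "x = x' + \<pi> powi k * p" using red[OF i(4) i(1)] by blast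
  \<comment> \<open>The column operation that reduces z turns y into y - x s, so the reduction of y
    starts from this value.\<close>
  have ys: "abv (y - x * s) \<le> 1" using i z by (intro abv_diff_le abv_mult_le_1)
  obtain y' t where y: "y' \<in> Rep (nat k)" "abv t \<le> 1" "y - x * s = y' + \<pi> powi k * t" using red[OF ys i(1)] by blast
  let ?u = "mk9 1 (-p) (-t) 0 1 (-s) 0 0 1"
  have "?u \<in> KK" using x y z by (intro upper_KK) simp_all
  moreover have "A ** (h ** ?u) = ut (int (nat k)) (int (nat l)) (int (nat m)) x' y' z'"
    using x y z i by (simp add: matrix_mul_assoc h ut_def mk9_mult algebra_simps)
  ultimately show ?thesis using KK_mult[OF h(1)] x y z by blast
qed

definition dg :: "int \<Rightarrow> int \<Rightarrow> int \<Rightarrow> 'a ^ 3 ^ 3" where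
  "dg k l m = mk9 (\<pi> powi k) 0 0 0 (\<pi> powi l) 0 0 0 (\<pi> powi m)"

text \<open>Full pivoting: the entry of largest absolute value is moved to the corner and clears its
  row and column with integral multipliers. The remaining block stays dominated by the pivot, which
  orders the exponents.\<close>

lemma smith:
  assumes A: "invertible A"
  shows "\<exists>g\<in>KK. \<exists>h\<in>KK. \<exists>k l m. m \<le> l \<and> l \<le> k \<and> g ** A ** h = dg k l m"
proof -
  obtain p where "\<forall>p'. abv (A $ fst p' $ snd p') \<le> abv (A $ fst p $ snd p)"
    using ex_max_abv[of "\<lambda>p. A $ fst p $ snd p"] by blast
  then have p: "abv (A $ i' $ j') \<le> abv (A $ fst p $ snd p)" for i' j' by (metis fst_conv snd_conv)
  let ?P = "swapM (fst p) 3" and ?Q = "swapM (snd p) 3"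
  have P: "?P \<in> KK" "?Q \<in> KK" by (rule swapM_KK)+
  let ?B = "?P ** A ** ?Q"
  have Bm: "abv (?B $ i' $ j') \<le> abv (?B $ 3 $ 3)" for i' j' using p by (simp add: swapM_left swapM_right)
  obtain a b c d e f g h i where B: "?B = mk9 a b c d e f g h i" by (rule mk9_cases)
  have detB: "det ?B \<noteq> 0" using A P by (auto simp: invertible_det_nz det_mul KK_def)
  have le: "abv a \<le> abv i" "abv b \<le> abv i" "abv c \<le> abv i" "abv d \<le> abv i" "abv e \<le> abv i"
    "abv f \<le> abv i" "abv g \<le> abv i" "abv h \<le> abv i"
    using Bm[of 1 1] Bm[of 1 2] Bm[of 1 3] Bm[of 2 1] Bm[of 2 2] Bm[of 2 3] Bm[of 3 1] Bm[of 3 2]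
    by (simp_all add: B)
  have i: "i \<noteq> 0" using le detB by (auto simp: B det_mk9)
  let ?U = "mk9 1 0 (-c/i) 0 1 (-f/i) 0 0 1" and ?L = "mk9 1 0 0 0 1 0 (-g/i) (-h/i) 1"
  have UL: "?U \<in> KK" "?L \<in> KK"
    using le i by (auto intro!: upper_KK lower_KK simp: abv_div_le_1)
  define a1 where "a1 = a - c*g/i" define b1 where "b1 = b - c*h/i"
  define d1 where "d1 = d - f*g/i" define e1 where "e1 = e - f*h/i"
  have C: "?U ** ?B ** ?L = mk9 a1 b1 0 d1 e1 0 0 0 i"
    using i by (simp add: B mk9_mult a1_def b1_def d1_def e1_def)
  \<comment> \<open>Clearing row and column does not make the block larger than the pivot.\<close>
  have sm: "abv (x - y * z / i) \<le> abv i" if "abv x \<le> abv i" "abv y \<le> abv i" "abv z \<le> abv i" for x y z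
  proof -
    have "abv y * abv z \<le> abv i * abv i" using that by (intro mult_mono) (simp_all add: abv_nonneg)
    then show ?thesis
      using that abv_pos[OF i] by (intro abv_diff_le) (simp_all add: abv_divide abv_mult pos_divide_le_eq)
  qed
  have le1: "abv a1 \<le> abv i" "abv b1 \<le> abv i" "abv d1 \<le> abv i" "abv e1 \<le> abv i"
    using le by (simp_all add: a1_def b1_def d1_def e1_def sm)
  have S: "mk9 0 1 0 1 0 0 0 0 1 \<in> KK" by (simp add: KK_def intg_mk9 det_mk9)
  let ?S = "mk9 0 1 0 1 0 0 0 0 1"
  \<comment> \<open>A row swap, a column swap, both or neither brings the largest entry of the block
    to its lower right corner.\<close>
  obtain g2 h2 a2 b2 d2 e2 where g2: "g2 \<in> KK" "h2 \<in> KK" "g2 ** mk9 a1 b1 0 d1 e1 0 0 0 i ** h2 = mk9 a2 b2 0 d2 e2 0 0 0 i"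
    and le2: "abv a2 \<le> abv e2" "abv b2 \<le> abv e2" "abv d2 \<le> abv e2" "abv e2 \<le> abv i"
  proof -
    let ?m = "max (max (abv a1) (abv b1)) (max (abv d1) (abv e1))"
    consider "abv a1 = ?m" | "abv b1 = ?m" | "abv d1 = ?m" | "abv e1 = ?m" by (smt (verit) max_def)
    then show thesis
    proof cases
      case 1 show thesis
        by (rule that[OF S S, of e1 d1 b1 a1]) (use 1 le1 in \<open>simp_all add: mk9_mult\<close>)
    next
      case 2 show thesis
        by (rule that[OF S KK_1, of d1 e1 a1 b1]) (use 2 le1 in \<open>simp_all add: mk9_mult\<close>)
    next
      case 3 show thesis
        by (rule that[OF KK_1 S, of b1 a1 e1 d1]) (use 3 le1 in \<open>simp_all add: mk9_mult\<close>)
    next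
      case 4 show thesis
        by (rule that[OF KK_1 KK_1, of a1 b1 d1 e1]) (use 4 le1 in \<open>simp_all\<close>)
    qed
  qed
  let ?D2 = "g2 ** (?U ** ?B ** ?L) ** h2"
  have D2: "?D2 = mk9 a2 b2 0 d2 e2 0 0 0 i" by (simp only: C g2)
  have "det ?D2 \<noteq> 0" using detB UL g2 by (auto simp: det_mul KK_def)
  then have "det (mk9 a2 b2 0 d2 e2 0 0 0 i) \<noteq> 0" unfolding D2 .
  then have d2: "a2 * e2 - b2 * d2 \<noteq> 0" by (auto simp: det_mk9 algebra_simps)
  then have e2: "e2 \<noteq> 0" using le2 by auto
  define a3 where "a3 = a2 - b2*d2/e2"
  have a3: "a3 \<noteq> 0" using d2 e2 by (simp add: a3_def field_simps)
  have "abv b2 * abv d2 \<le> abv e2 * abv e2" using le2 by (intro mult_mono) (simp_all add: abv_nonneg)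
  then have le3: "abv a3 \<le> abv e2" unfolding a3_def
    using le2 abv_pos[OF e2] by (intro abv_diff_le) (simp_all add: abv_divide abv_mult pos_divide_le_eq)
  let ?U2 = "mk9 1 (-b2/e2) 0 0 1 0 0 0 1" and ?L2 = "mk9 1 0 0 (-d2/e2) 1 0 0 0 1"
  have UL2: "?U2 \<in> KK" "?L2 \<in> KK"
    using le2 e2 by (auto intro!: upper_KK lower_KK simp: abv_div_le_1)
  have D3: "?U2 ** ?D2 ** ?L2 = mk9 a3 0 0 0 e2 0 0 0 i"
    unfolding D2 using e2 by (simp add: mk9_mult a3_def)
  let ?u = "mk9 (unit_part a3) 0 0 0 (unit_part e2) 0 0 0 (unit_part i)"
  have u: "?u \<in> KK" using a3 e2 i by (intro diag_KK unit_part)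
  have "?U2 ** ?D2 ** ?L2 ** ?u = dg (val a3) (val e2) (val i)"
    unfolding D3 using a3 e2 i by (simp add: mk9_mult dg_def unit_part)
  then have E: "(?U2 ** g2 ** ?U ** ?P) ** A ** (?Q ** ?L ** h2 ** ?L2 ** ?u) = dg (val a3) (val e2) (val i)"
    by (simp add: matrix_mul_assoc)
  have v: "val i \<le> val e2" "val e2 \<le> val a3"
    using le2(4) le3 by (simp_all only: abv_le_iff_val a3 e2 i not_False_eq_True)
  have k: "?U2 ** g2 ** ?U ** ?P \<in> KK" "?Q ** ?L ** h2 ** ?L2 ** ?u \<in> KK"
    by (intro KK_mult UL UL2 g2(1,2) P u)+
  show ?thesis by (rule bexI[OF _ k(1)], rule bexI[OF _ k(2)]) (use v E in blast)
qed

end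

section \<open>Vertices of the building\<close>

context nonarch_local_field begin

section \<open>Lattices and vertices as classes of matrices\<close>

lemma invertibleE:
  assumes "invertible (A :: 'a ^ 3 ^ 3)"
  obtains A' where "invertible A'" "A ** A' = mat 1" "A' ** A = mat 1"
  using assms by (auto simp: invertible_def)

lemma mult_mat_left: "A ** (mat c ** B) = mat c ** (A ** B)" for A B :: "'a ^ 3 ^ 3"
  by (simp only: matrix_mul_assoc mat_mult_commute[of c A])

definition lat :: "'a ^ 3 ^ 3 \<Rightarrow> ('a ^ 3) set" where
  "lat A = (\<lambda>x. A *v x) ` standard_lattice abv"

lemma lat_mult: "lat (A ** B) = (\<lambda>x. A *v x) ` lat B"
  by (simp add: lat_def image_image matrix_vector_mul_assoc)

lemma mat_mult_vec: "mat c *v x = c *s (x :: 'a ^ 3)"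
  by (simp add: mat_def vec_eq_iff matrix_vector_mult_def if_distrib[of "\<lambda>u. u * _"] cong: if_cong)

lemma scale_set_lat: "scale_set c (lat A) = lat (mat c ** A)"
  by (simp add: lat_mult scale_set_def mat_mult_vec)

lemma intg_lat: "intg A \<Longrightarrow> lat A \<subseteq> standard_lattice abv"
  by (auto simp: lat_def standard_lattice_def ring_of_integers_def intg_def matrix_vector_mult_def sum_3
      intro!: abv_add_le abv_mult_le_1)

lemma lat_intg:
  assumes "lat A \<subseteq> standard_lattice abv"
  shows "intg A"
  unfolding intg_def
proof (intro allI)
  fix i j :: 3
  have "A *v axis j 1 \<in> lat A"
    by (auto simp: lat_def standard_lattice_def ring_of_integers_def axis_def)
  then have "abv ((A *v axis j 1) $ i) \<le> 1"
    using assms by (auto simp: standard_lattice_def ring_of_integers_def)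
  then show "abv (A $ i $ j) \<le> 1"
    by (simp add: matrix_vector_mult_def axis_def if_distrib[of "\<lambda>u. _ * u"] cong: if_cong)
qed

lemma lat_1: "lat (mat 1) = standard_lattice abv"
  by (simp add: lat_def)

lemma KK_invertible: "h \<in> KK \<Longrightarrow> invertible h"
  by (auto simp: KK_def invertible_det_nz)

lemma lat_KK:
  assumes "h \<in> KK" shows "lat (A ** h) = lat A"
proof -
  obtain h' where h': "h' \<in> KK" "h ** h' = mat 1" using KK_inverse[OF assms] by blast
  have "lat h \<subseteq> standard_lattice abv" using assms by (intro intg_lat) (simp add: KK_def)
  moreover have "lat (mat 1) \<subseteq> lat h"
    unfolding h'(2)[symmetric] lat_mult using intg_lat[of h'] h'(1) by (auto simp: KK_def lat_def[of h])
  ultimately have "lat h = standard_lattice abv" by (simp add: lat_1)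
  then show ?thesis unfolding lat_mult by (simp add: lat_def[of A])
qed

lemma lat_subset_iff:
  assumes "invertible A"
  shows "lat B \<subseteq> lat A \<longleftrightarrow> (\<exists>M. intg M \<and> B = A ** M)"
proof
  assume L: "lat B \<subseteq> lat A"
  obtain A' where A': "A ** A' = mat 1" "A' ** A = mat 1" using assms by (auto simp: invertible_def)
  have "lat (A' ** B) \<subseteq> lat (A' ** A)" unfolding lat_mult using L by (rule image_mono)
  then have "intg (A' ** B)" by (intro lat_intg) (simp add: A' lat_1)
  moreover have "B = A ** (A' ** B)" by (simp add: matrix_mul_assoc A')
  ultimately show "\<exists>M. intg M \<and> B = A ** M" by blast
next
  assume "\<exists>M. intg M \<and> B = A ** M"
  then obtain M where M: "intg M" "B = A ** M" by blast
  show "lat B \<subseteq> lat A" unfolding M(2) lat_mult lat_def[of A] by (rule image_mono[OF intg_lat[OF M(1)]])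
qed

text \<open>Each matrix is an integral right multiple of the other. The two multipliers have
  determinants of absolute value at most 1 and product 1, so these are units.\<close>

lemma lat_eqD:
  assumes A: "invertible A" "invertible B" and eq: "lat A = lat B"
  shows "\<exists>h\<in>KK. B = A ** h"
proof -
  obtain M where M: "intg M" "B = A ** M" using lat_subset_iff[OF A(1), of B] eq by auto
  obtain N where N: "intg N" "A = B ** N" using lat_subset_iff[OF A(2), of A] eq by auto
  have d: "det A \<noteq> 0" "det B \<noteq> 0" using A by (auto simp: invertible_det_nz)
  have e: "det B = det A * det M" "det A = det B * det N"
    using arg_cong[OF M(2), of det] arg_cong[OF N(2), of det] by (simp_all only: det_mul)
  then have "det A * (det M * det N) = det A" by (simp only: mult.assoc[symmetric])
  then have "det M * det N = 1" using d by simp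
  then have "abv (det M) * abv (det N) = 1" by (simp flip: abv_mult)
  moreover have "abv (det X) \<le> 1" if "intg X" for X :: "'a ^ 3 ^ 3"
    using that by (cases X rule: mk9_cases) (simp add: intg_mk9 det_mk9 abv_add_le abv_diff_le abv_mult_le_1)
  ultimately have "abv (det M) = 1"
    using M N abv_nonneg by (smt (verit) mult_le_cancel_left1 mult_less_cancel_left1)
  then show ?thesis using M by (auto simp: KK_def)
qed

definition vtx :: "'a ^ 3 ^ 3 \<Rightarrow> ('a ^ 3) set set" where
  "vtx A = homothety_class (lat A)"

lemma vtx_eq: "vtx A = {lat (mat c ** A) | c. c \<noteq> 0}"
  by (simp add: vtx_def homothety_class_def scale_set_lat)

lemma vtx_scale_KK:
  assumes "c \<noteq> 0" "h \<in> KK" shows "vtx (mat c ** A ** h) = vtx A"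
proof -
  have "{lat (mat d ** (mat c ** A ** h)) | d. d \<noteq> 0} = {lat (mat d ** A) | d. d \<noteq> 0}"
  proof (intro equalityI subsetI)
    fix L assume "L \<in> {lat (mat d ** (mat c ** A ** h)) | d. d \<noteq> 0}"
    then obtain d where d: "d \<noteq> 0" "L = lat (mat d ** (mat c ** A ** h))" by blast
    have "L = lat (mat (d * c) ** A ** h)" by (simp add: d matrix_mul_assoc mat_mult_mat)
    then have "L = lat (mat (d * c) ** A)" by (simp add: lat_KK assms)
    then show "L \<in> {lat (mat d ** A) | d. d \<noteq> 0}" using d assms by auto
  next
    fix L assume "L \<in> {lat (mat d ** A) | d. d \<noteq> 0}"
    then obtain d where d: "d \<noteq> 0" "L = lat (mat d ** A)" by blast
    have "mat (d / c) ** (mat c ** A ** h) = mat d ** A ** h"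
      using assms by (simp add: matrix_mul_assoc mat_mult_mat)
    then have "L = lat (mat (d / c) ** (mat c ** A ** h))" by (simp add: d lat_KK assms)
    then show "L \<in> {lat (mat d ** (mat c ** A ** h)) | d. d \<noteq> 0}" using d assms by auto
  qed
  then show ?thesis by (simp add: vtx_eq)
qed

lemma vtx_KK: "h \<in> KK \<Longrightarrow> vtx (A ** h) = vtx A"
  using vtx_scale_KK[of 1 h A] by simp

lemma vtx_scale: "c \<noteq> 0 \<Longrightarrow> vtx (mat c ** A) = vtx A"
  using vtx_scale_KK[of c "mat 1" A] by simp

lemma vtx_eqD:
  assumes A: "invertible A" "invertible B" and eq: "vtx A = vtx B"
  shows "\<exists>c. c \<noteq> 0 \<and> (\<exists>h\<in>KK. B = mat c ** A ** h)"
proof -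
  have "lat B \<in> vtx A" unfolding eq by (auto simp: vtx_eq intro!: exI[of _ 1])
  then obtain c where c: "c \<noteq> 0" "lat B = lat (mat c ** A)" by (auto simp: vtx_eq)
  have "invertible (mat c ** A)" using A c by (simp add: invertible_det_nz det_mul) (simp add: mat_mk9 det_mk9)
  from lat_eqD[OF this A(2)] c show ?thesis by auto
qed

lemma O_lattice_iff: "O_lattice abv L \<longleftrightarrow> (\<exists>A. invertible A \<and> L = lat A)"
  by (simp add: O_lattice_def lat_def)

lemma vertices_iff: "V \<in> vertices abv \<longleftrightarrow> (\<exists>A. invertible A \<and> V = vtx A)"
  by (auto simp: vertices_def O_lattice_iff vtx_def)

lemma verticesE:
  assumes "V \<in> vertices abv" obtains A where "invertible A" "V = vtx A"
  using assms vertices_iff by blast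

lemma vtx_in: "invertible A \<Longrightarrow> vtx A \<in> vertices abv"
  using vertices_iff by blast

lemma vtx_left: "invertible A \<Longrightarrow> invertible B \<Longrightarrow> invertible C \<Longrightarrow> vtx (C ** A) = vtx (C ** B) \<longleftrightarrow> vtx A = vtx B"
proof -
  have 1: "vtx (C ** A) = vtx (C ** B)" if v: "invertible A" "invertible B" "invertible C" "vtx A = vtx B" for A B C
  proof -
    obtain c h where c: "c \<noteq> 0" "h \<in> KK" "B = mat c ** A ** h" using vtx_eqD[OF v(1,2,4)] by blast
    have "C ** B = mat c ** (C ** A) ** h" unfolding c(3)
      by (simp only: mult_mat_left matrix_mul_assoc[symmetric])
    then show ?thesis using c vtx_scale_KK by simp
  qed
  assume inv: "invertible A" "invertible B" "invertible C"
  then obtain C' where C'i: "invertible C'" and C': "C ** C' = mat 1" "C' ** C = mat 1" by (rule_tac invertibleE)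
  have "vtx A = vtx B" if "vtx (C ** A) = vtx (C ** B)"
    using 1[OF invertible_mult[OF inv(3,1)] invertible_mult[OF inv(3,2)] C'i that] by (simp add: matrix_mul_assoc C')
  then show ?thesis using 1[OF inv] by blast
qed

section \<open>The action of PGL_3 in terms of matrices\<close>

definition proj :: "'a ^ 3 ^ 3 \<Rightarrow> ('a ^ 3 ^ 3) set" where
  "proj A = scalars3 #>\<^bsub>GL3\<^esub> A"

lemma proj_eq: "proj A = {mat c ** A | c. c \<noteq> 0}"
  by (auto simp: proj_def r_coset_def GL3_def scalars3_def)

lemma carrier_PGL3: "carrier PGL3 = proj ` {A. invertible A}"
  by (auto simp: PGL3_def FactGroup_def RCOSETS_def proj_def GL3_def)

lemma proj_in: "invertible A \<Longrightarrow> proj A \<in> carrier PGL3"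
  by (simp add: carrier_PGL3)

lemma proj_mult: "invertible A \<Longrightarrow> invertible B \<Longrightarrow> proj A \<otimes>\<^bsub>PGL3\<^esub> proj B = proj (A ** B)"
proof -
  interpret normal scalars3 "GL3 :: ('a ^ 3 ^ 3) monoid" by (rule scalars3_normal)
  assume "invertible A" "invertible B"
  then show ?thesis using rcos_sum[of A B] by (simp add: PGL3_def FactGroup_def proj_def GL3_def)
qed

lemma one_PGL3: "\<one>\<^bsub>PGL3\<^esub> = proj (mat 1)"
  by (auto simp: PGL3_def FactGroup_def proj_eq scalars3_def)

lemma PSL3_eq: "PSL3 = proj ` {A. det A = 1}"
  by (auto simp: PSL3_def proj_def)

lemma vertex_act_proj: "vertex_act (proj A) (vtx B) = vtx (A ** B)"
proof -
  have e: "(\<lambda>x. (mat c ** A) *v x) ` lat (mat d ** B) = lat (mat (c * d) ** (A ** B))" for c d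
  proof -
    have "mat c ** A ** (mat d ** B) = mat d ** (mat c ** A ** B)" by (rule mult_mat_left)
    also have "\<dots> = mat (c * d) ** (A ** B)"
      by (simp only: matrix_mul_assoc mat_mult_mat mult.commute[of d c])
    finally show ?thesis unfolding lat_mult[symmetric] by (rule arg_cong)
  qed
  show ?thesis
  proof (intro equalityI subsetI)
    fix L assume "L \<in> vertex_act (proj A) (vtx B)"
    then obtain c d where "c \<noteq> 0" "d \<noteq> 0" "L = (\<lambda>x. (mat c ** A) *v x) ` lat (mat d ** B)"
      by (auto simp: vertex_act_def proj_eq vtx_eq)
    then show "L \<in> vtx (A ** B)" unfolding e by (auto simp: vtx_eq)
  next
    fix L assume "L \<in> vtx (A ** B)"
    then obtain c where c: "c \<noteq> 0" "L = lat (mat c ** (A ** B))" by (auto simp: vtx_eq)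
    then have "L = (\<lambda>x. (mat c ** A) *v x) ` lat (mat 1 ** B)" unfolding e by simp
    moreover have "mat c ** A \<in> proj A" using c by (auto simp: proj_eq)
    moreover have "lat (mat 1 ** B) \<in> vtx B" unfolding vtx_eq by (auto intro!: exI[of _ 1])
    ultimately show "L \<in> vertex_act (proj A) (vtx B)" unfolding vertex_act_def by blast
  qed
qed

section \<open>Relative positions and spheres\<close>

definition Dm :: "nat \<Rightarrow> nat \<Rightarrow> 'a ^ 3 ^ 3" where
  "Dm a b = dg (int (a + b)) (int b) 0"

text \<open>The sphere of the vertices in relative position \<open>(a, b)\<close> to \<open>V\<close>; its radius in the 1-skeleton is \<open>a + b\<close>.\<close>

definition Sp :: "nat \<Rightarrow> nat \<Rightarrow> ('a ^ 3) set set \<Rightarrow> ('a ^ 3) set set set" where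
  "Sp a b V = {vtx (A ** Dm a b) | A. invertible A \<and> V = vtx A}"

lemma det_dg: "det (dg k l m) = \<pi> powi (k + l + m)"
  using uniformizer_nonzero by (simp add: dg_def det_mk9 power_int_add)

lemma det_ut: "det (ut k l m x y z) = \<pi> powi (k + l + m)"
  using uniformizer_nonzero by (simp add: ut_def det_mk9 power_int_add)

lemma invertible_dg [simp]: "invertible (dg k l m)"
  by (simp add: invertible_det_nz det_dg)

lemma invertible_Dm [simp]: "invertible (Dm a b)"
  by (simp add: Dm_def)

lemma invertible_ut [simp]: "invertible (ut k l m x y z)"
  by (simp add: invertible_det_nz det_ut)

lemma dg_mult: "dg k l m ** dg k' l' m' = dg (k + k') (l + l') (m + m')"
  using uniformizer_nonzero by (simp add: dg_def mk9_mult power_int_add)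

lemma dg_mat: "dg k k k = mat (\<pi> powi k)"
  by (simp add: dg_def mat_mk9)

lemma Sp_in: "W \<in> Sp a b V \<Longrightarrow> W \<in> vertices abv"
  by (auto simp: Sp_def intro!: vtx_in invertible_mult)

lemma SpI: "invertible A \<Longrightarrow> vtx (A ** Dm a b) \<in> Sp a b (vtx A)"
  by (auto simp: Sp_def)

lemma SpE:
  assumes "invertible A" "W \<in> Sp a b (vtx A)"
  obtains h where "h \<in> KK" "W = vtx (A ** h ** Dm a b)"
proof -
  obtain B where B: "invertible B" "vtx A = vtx B" "W = vtx (B ** Dm a b)" using assms by (auto simp: Sp_def)
  obtain c h where h: "c \<noteq> 0" "h \<in> KK" "B = mat c ** A ** h" using vtx_eqD[OF assms(1) B(1,2)] by blast
  have "W = vtx (A ** h ** Dm a b)"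
    using vtx_scale[OF h(1), of "A ** h ** Dm a b"] by (simp add: B(3) h(3) matrix_mul_assoc)
  then show thesis using that h by blast
qed

lemma Sp_act: "invertible g \<Longrightarrow> W \<in> Sp a b V \<Longrightarrow> vertex_act (proj g) W \<in> Sp a b (vertex_act (proj g) V)"
  using SpI invertible_mult by (fastforce simp: Sp_def vertex_act_proj matrix_mul_assoc)

definition antiw :: "'a ^ 3 ^ 3" where "antiw = mk9 0 0 1 0 1 0 1 0 0"

lemma antiw_KK: "antiw \<in> KK" by (simp add: antiw_def KK_def intg_mk9 det_mk9)

text \<open>With w the antidiagonal matrix, D_ab w D_ba is w times a scalar. Thus the way back from
  W to V has the exponents a and b exchanged.\<close>

lemma Sp_sym_imp:
  assumes "V \<in> vertices abv" "W \<in> Sp a b V" shows "V \<in> Sp b a W"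
proof -
  obtain A where A: "invertible A" "V = vtx A" "W = vtx (A ** Dm a b)" using assms by (auto simp: Sp_def)
  have "Dm a b ** antiw ** Dm b a = mat (\<pi> powi int (a + b)) ** antiw"
    using uniformizer_nonzero by (simp add: Dm_def dg_def antiw_def mk9_mult mat_mk9 power_int_add)
  then have "A ** Dm a b ** antiw ** Dm b a = A ** (mat (\<pi> powi int (a + b)) ** antiw)"
    by (simp flip: matrix_mul_assoc)
  also have "\<dots> = mat (\<pi> powi int (a + b)) ** A ** antiw"
    by (simp only: mult_mat_left matrix_mul_assoc[symmetric])
  finally have "vtx (A ** Dm a b ** antiw ** Dm b a) = V"
    using A vtx_scale_KK[OF _ antiw_KK] by simp
  moreover have "vtx (A ** Dm a b ** antiw) = W" using A by (simp add: vtx_KK antiw_KK)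
  moreover have "invertible (A ** Dm a b ** antiw)"
    by (intro invertible_mult A(1) invertible_Dm KK_invertible[OF antiw_KK])
  ultimately show ?thesis unfolding Sp_def by blast
qed

lemma Sp_sym: "V \<in> vertices abv \<Longrightarrow> W \<in> vertices abv \<Longrightarrow> W \<in> Sp a b V \<longleftrightarrow> V \<in> Sp b a W"
  using Sp_sym_imp by blast

text \<open>For V and W represented by A and B, the Smith form of A^(-1) B, freed of the scalar
  pi^m, is D_ab with a = k - l and b = l - m.\<close>

lemma cartan:
  assumes "V \<in> vertices abv" "W \<in> vertices abv"
  shows "\<exists>a b. W \<in> Sp a b V"
proof -
  obtain A B where A: "invertible A" "V = vtx A" and B: "invertible B" "W = vtx B"
    using assms by (auto elim!: verticesE)
  obtain A' where A'i: "invertible A'" and A': "A ** A' = mat 1" "A' ** A = mat 1" by (rule invertibleE[OF A(1)])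
  have "invertible (A' ** B)" using A'i B by (intro invertible_mult)
  from smith[OF this] obtain g h k l m where
    gh: "g \<in> KK" "h \<in> KK" "m \<le> l" "l \<le> k" "g ** (A' ** B) ** h = dg k l m" by blast
  obtain g' where g': "g' \<in> KK" "g' ** g = mat 1" using KK_inverse[OF gh(1)] by blast
  have "B ** h = A ** (g' ** g) ** (A' ** B) ** h" by (simp add: g' A' matrix_mul_assoc)
  also have "\<dots> = A ** g' ** (g ** (A' ** B) ** h)" by (simp add: matrix_mul_assoc)
  also have "\<dots> = A ** g' ** dg k l m" by (simp only: gh)
  also have "dg k l m = mat (\<pi> powi m) ** Dm (nat (k - l)) (nat (l - m))"
    using gh by (simp add: Dm_def dg_mat[symmetric] dg_mult)
  also have "A ** g' ** \<dots> = mat (\<pi> powi m) ** (A ** g' ** Dm (nat (k - l)) (nat (l - m)))"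
    by (simp only: mult_mat_left)
  finally have "vtx (B ** h) = vtx (A ** g' ** Dm (nat (k - l)) (nat (l - m)))" by (simp add: vtx_scale)
  then have "W = vtx (A ** g' ** Dm (nat (k - l)) (nat (l - m)))" using gh B by (simp add: vtx_KK)
  then have "W \<in> Sp (nat (k - l)) (nat (l - m)) (vtx (A ** g'))"
    using SpI[OF invertible_mult[OF A(1) KK_invertible[OF g'(1)]]] by simp
  then show ?thesis using A g' by (auto simp: vtx_KK)
qed

text \<open>From D_ab = D_a0 D_0b. It reduces estimates to the spheres (a, 0) and (0, b), which
  correspond to sublattices and superlattices and so to Hermite forms.\<close>

lemma Sp_compose:
  assumes "W \<in> Sp a b V" shows "\<exists>U\<in>Sp a 0 V. W \<in> Sp 0 b U"
proof -
  obtain A where A: "invertible A" "V = vtx A" "W = vtx (A ** Dm a b)" using assms by (auto simp: Sp_def)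
  have "Dm a b = Dm a 0 ** Dm 0 b" by (simp add: Dm_def dg_mult)
  then have "W = vtx (A ** Dm a 0 ** Dm 0 b)" by (simp add: A(3) matrix_mul_assoc)
  then have "W \<in> Sp 0 b (vtx (A ** Dm a 0))" using A by (auto intro!: SpI invertible_mult)
  moreover have "vtx (A ** Dm a 0) \<in> Sp a 0 V" using A by (auto intro!: SpI)
  ultimately show ?thesis by blast
qed

text \<open>If A and B represent V and V' so that A D_ab and B D_ab represent W and W', then B
  A^(-1) moves both vertices at once.\<close>

lemma Sp_transitive:
  assumes "W \<in> Sp a b V" "W' \<in> Sp a b V'"
  shows "\<exists>g. invertible g \<and> vertex_act (proj g) V = V' \<and> vertex_act (proj g) W = W'"
proof -
  obtain A where A: "invertible A" "V = vtx A" "W = vtx (A ** Dm a b)" using assms by (auto simp: Sp_def)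
  obtain B where B: "invertible B" "V' = vtx B" "W' = vtx (B ** Dm a b)" using assms by (auto simp: Sp_def)
  obtain A' where A'i: "invertible A'" and A': "A ** A' = mat 1" "A' ** A = mat 1" by (rule invertibleE[OF A(1)])
  have "B ** A' ** A = B" by (simp add: A' matrix_mul_assoc[symmetric])
  moreover have "invertible (B ** A')" using A'i B by (intro invertible_mult)
  ultimately show ?thesis using A B
    by (intro exI[of _ "B ** A'"]) (simp add: vertex_act_proj matrix_mul_assoc)
qed

end

section \<open>The Busemann function\<close>

context nonarch_local_field begin

section \<open>Triangular matrices and the height of a vertex\<close>

lemma ut_mult:
  "ut k l m x y z ** ut k' l' m' x' y' z' = ut (k + k') (l + l') (m + m')
     (\<pi> powi k * x' + x * \<pi> powi l') (\<pi> powi k * y' + x * z' + y * \<pi> powi m') (\<pi> powi l * z' + z * \<pi> powi m')"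
  by (simp add: ut_def mk9_mult power_int_add)

lemma ut_inverse:
  "\<exists>x' y' z'. ut k l m x y z ** ut (-k) (-l) (-m) x' y' z' = mat 1 \<and>
     ut (-k) (-l) (-m) x' y' z' ** ut k l m x y z = mat 1"
proof -
  define a b c where abc: "a = \<pi> powi k" "b = \<pi> powi l" "c = \<pi> powi m"
  have nz: "a \<noteq> 0" "b \<noteq> 0" "c \<noteq> 0" by (simp_all add: abc)
  have inv: "\<pi> powi (-k) = 1 / a" "\<pi> powi (-l) = 1 / b" "\<pi> powi (-m) = 1 / c"
    by (simp_all add: abc power_int_minus divide_inverse)
  show ?thesis
    by (rule exI[of _ "- x / (a * b)"], rule exI[of _ "(x * z - y * b) / (a * b * c)"], rule exI[of _ "- z / (b * c)"])
      (unfold ut_def inv abc[symmetric], use nz in \<open>simp add: mk9_mult mat_mk9 field_simps\<close>)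
qed

text \<open>
  The inverse of the anti-transpose of \<open>ut k l m x y z\<close>; a choice of an upper triangular inverse spares its entries.
\<close>

definition uti :: "int \<Rightarrow> int \<Rightarrow> int \<Rightarrow> 'a \<Rightarrow> 'a \<Rightarrow> 'a \<Rightarrow> 'a ^ 3 ^ 3" where
  "uti k l m x y z = (SOME N. ut m l k z y x ** N = mat 1 \<and> N ** ut m l k z y x = mat 1 \<and>
     (\<exists>x' y' z'. N = ut (-m) (-l) (-k) x' y' z'))"

lemma uti: "ut m l k z y x ** uti k l m x y z = mat 1" "uti k l m x y z ** ut m l k z y x = mat 1"
  "\<exists>x' y' z'. uti k l m x y z = ut (-m) (-l) (-k) x' y' z'"
proof -
  have "\<exists>N. ut m l k z y x ** N = mat 1 \<and> N ** ut m l k z y x = mat 1 \<and>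
     (\<exists>x' y' z'. N = ut (-m) (-l) (-k) x' y' z')"
    using ut_inverse[of m l k z y x] by blast
  from someI_ex[OF this]
  show "ut m l k z y x ** uti k l m x y z = mat 1" "uti k l m x y z ** ut m l k z y x = mat 1"
    "\<exists>x' y' z'. uti k l m x y z = ut (-m) (-l) (-k) x' y' z'"
    unfolding uti_def by blast+
qed

lemma invertible_uti [simp]: "invertible (uti k l m x y z)"
  using uti(3)[of k l m x y z] by auto

text \<open>Uniqueness in the Iwasawa decomposition: two triangular representatives of a vertex
  differ by a scalar and a triangular element of \<open>KK\<close>, whose diagonal entries are
  units. The first two conclusions make the height well defined, the others make Hermite forms
  unique.\<close>

lemma ut_vtx_eqD:
  assumes eq: "vtx (ut k l m x y z) = vtx (ut k' l' m' x' y' z')"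
  shows "k' - k = l' - l" "k' - k = m' - m"
    and "k = k' \<Longrightarrow> abv (z' - z) \<le> abv (\<pi> powi l)"
    and "k = k' \<Longrightarrow> z = z' \<Longrightarrow> abv (x' - x) \<le> abv (\<pi> powi k) \<and> abv (y' - y) \<le> abv (\<pi> powi k)"
proof -
  obtain c h where c: "c \<noteq> 0" "h \<in> KK" "ut k' l' m' x' y' z' = mat c ** ut k l m x y z ** h"
    using vtx_eqD[OF _ _ eq] by auto
  obtain h11 h12 h13 h21 h22 h23 h31 h32 h33 where h: "h = mk9 h11 h12 h13 h21 h22 h23 h31 h32 h33"
    by (rule mk9_cases)
  note e = c(3)[unfolded h ut_def mat_mk9 mk9_mult mk9_eq_iff]
  have h3: "h31 = 0" "h32 = 0" using e c(1) by simp_all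
  then have h2: "h21 = 0" using e c(1) by simp
  have E: "\<pi> powi k' = c * \<pi> powi k * h11" "\<pi> powi l' = c * \<pi> powi l * h22" "\<pi> powi m' = c * \<pi> powi m * h33"
    "z' = c * (\<pi> powi l * h23 + z * h33)" "x' = c * (\<pi> powi k * h12 + x * h22)"
    "y' = c * (\<pi> powi k * h13 + x * h23 + y * h33)"
    using e h3 h2 by (simp_all add: algebra_simps)
  have i: "abv h11 \<le> 1" "abv h22 \<le> 1" "abv h33 \<le> 1" "abv h12 \<le> 1" "abv h13 \<le> 1" "abv h23 \<le> 1"
    and d: "abv h11 * (abv h22 * abv h33) = 1"
    using c(2) h3 h2 by (simp_all add: h KK_def intg_mk9 det_mk9 abv_mult)
  have one: "abv h11 = 1" "abv h22 = 1" "abv h33 = 1"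
  proof -
    have "abv h11 * (abv h22 * abv h33) \<le> abv h11 * 1" "abv h22 * (abv h11 * abv h33) \<le> abv h22 * 1"
       "abv h33 * (abv h11 * abv h22) \<le> abv h33 * 1"
      by (intro mult_left_mono mult_le_one i abv_nonneg)+
    then show "abv h11 = 1" "abv h22 = 1" "abv h33 = 1" using d i by (simp_all add: mult_ac)
  qed
  then have nz: "h11 \<noteq> 0" "h22 \<noteq> 0" "h33 \<noteq> 0" by auto
  have v: "k' = val c + k" "l' = val c + l" "m' = val c + m"
    using arg_cong[OF E(1), of val] arg_cong[OF E(2), of val] arg_cong[OF E(3), of val] c(1) nz one
    by (simp_all add: val_mult)
  then show "k' - k = l' - l" "k' - k = m' - m" by simp_all
  \<comment> \<open>For k = k' the scalar c cancels diagonal entries of h, so the entries above the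
    diagonal can be compared directly.\<close>
  have ch: "c * h22 = 1" "c * h33 = 1" if "k = k'"
  proof -
    have "l' = l" "m' = m" using v that by simp_all
    with E(2,3) have "\<pi> powi l * (c * h22) = \<pi> powi l * 1" "\<pi> powi m * (c * h33) = \<pi> powi m * 1" by simp_all
    then show "c * h22 = 1" "c * h33 = 1" by (simp_all only: mult_cancel_left powi_unif_nonzero simp_thms)
  qed
  have cu: "abv c = 1" if "k = k'"
    using arg_cong[OF ch(1)[OF that], of abv] one by (simp add: abv_mult)
  show "abv (z' - z) \<le> abv (\<pi> powi l)" if "k = k'"
  proof -
    have "z' = \<pi> powi l * (c * h23) + z * (c * h33)" by (simp add: E(4) algebra_simps)
    then have "z' - z = \<pi> powi l * (c * h23)" by (simp add: ch(2)[OF that])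
    then show ?thesis using i cu[OF that] by (simp add: abv_mult mult_left_le abv_nonneg)
  qed
  show "abv (x' - x) \<le> abv (\<pi> powi k) \<and> abv (y' - y) \<le> abv (\<pi> powi k)" if "k = k'" "z = z'"
  proof -
    have "z' = \<pi> powi l * (c * h23) + z * (c * h33)" by (simp add: E(4) algebra_simps)
    then have "h23 = 0" using that c(1) by (simp add: ch(2)[OF that(1)])
    have "x' = \<pi> powi k * (c * h12) + x * (c * h22)" by (simp add: E(5) algebra_simps)
    then have 1: "x' - x = \<pi> powi k * (c * h12)" by (simp add: ch(1)[OF that(1)])
    have "y' = \<pi> powi k * (c * h13) + y * (c * h33)" by (simp add: E(6) \<open>h23 = 0\<close> algebra_simps)
    then have 2: "y' - y = \<pi> powi k * (c * h13)" by (simp add: ch(2)[OF that(1)])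
    show ?thesis unfolding 1 2 using i cu[OF that(1)] by (simp add: abv_mult mult_left_le abv_nonneg)
  qed
qed

lemma vertices_utE:
  assumes "V \<in> vertices abv"
  obtains k l m x y z where "V = vtx (ut k l m x y z)"
proof -
  obtain A where A: "invertible A" "V = vtx A" using assms by (rule verticesE)
  obtain h k l m x y z where "h \<in> KK" "A ** h = ut k l m x y z" using iwasawa[OF A(1)] by blast
  then have "V = vtx (ut k l m x y z)" using A(2) vtx_KK[of h A] by simp
  then show thesis by (rule that)
qed

text \<open>A scalar shifts all diagonal exponents equally, so by \<open>ut_vtx_eqD\<close> the
  choice of the triangular representative is immaterial.\<close>

definition hgt :: "('a ^ 3) set set \<Rightarrow> int" where
  "hgt V = (SOME j. \<exists>k l m x y z. V = vtx (ut k l m x y z) \<and> j = k - m)"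

lemma hgt_ut: "hgt (vtx (ut k l m x y z)) = k - m"
proof -
  let ?P = "\<lambda>j. \<exists>k' l' m' x' y' z'. vtx (ut k l m x y z) = vtx (ut k' l' m' x' y' z') \<and> j = k' - m'"
  have "?P (hgt (vtx (ut k l m x y z)))" unfolding hgt_def by (rule someI[of ?P "k - m"]) blast
  then obtain k' l' m' x' y' z' where "vtx (ut k l m x y z) = vtx (ut k' l' m' x' y' z')"
    "hgt (vtx (ut k l m x y z)) = k' - m'" by blast
  with ut_vtx_eqD[OF this(1)] show ?thesis by simp
qed

text \<open>Triangular matrices multiply their diagonals. Hence the increment of the height depends
  only on the right factor, which makes the increments of the walk independent of its
  position.\<close>

lemma hgt_mult_ut:
  "hgt (vtx (ut k l m x y z ** ut k' l' m' x' y' z')) = hgt (vtx (ut k l m x y z)) + (k' - m')"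
  by (simp add: ut_mult hgt_ut)

text \<open>
  Anti-transposition turns column operations into row operations and still preserves upper triangularity, so
  the normal form of superlattices follows from the one of sublattices.
\<close>

definition atr :: "'a ^ 3 ^ 3 \<Rightarrow> 'a ^ 3 ^ 3" where
  "atr A = mk9 (A$3$3) (A$2$3) (A$1$3) (A$3$2) (A$2$2) (A$1$2) (A$3$1) (A$2$1) (A$1$1)"

lemma atr_mult: "atr (A ** B) = atr B ** atr A"
  by (cases A rule: mk9_cases; cases B rule: mk9_cases) (simp add: atr_def mk9_mult algebra_simps)

lemma atr_atr [simp]: "atr (atr A) = A"
  by (cases A rule: mk9_cases) (simp add: atr_def)

lemma det_atr [simp]: "det (atr A) = det A"
  by (cases A rule: mk9_cases) (simp add: atr_def det_mk9 algebra_simps)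

lemma intg_atr [simp]: "intg (atr A) \<longleftrightarrow> intg A"
  by (cases A rule: mk9_cases) (auto simp: atr_def intg_mk9)

lemma atr_KK [simp]: "atr A \<in> KK \<longleftrightarrow> A \<in> KK"
  by (simp add: KK_def)

lemma atr_ut: "atr (ut k l m x y z) = ut m l k z y x"
  by (simp add: atr_def ut_def)

lemma atr_mat [simp]: "atr (mat c) = mat c"
  by (simp add: atr_def mat_mk9)

text \<open>
  The Hermite normal forms of determinant \<open>\<pi>\<^sup>a\<close>, i.e. the sublattices of index \<open>q\<^sup>a\<close> of \<open>\<O>\<^sup>3\<close> (\<open>hermF\<close>), and dually
  the superlattices of index \<open>q\<^sup>a\<close> (\<open>hermG\<close>).
\<close>

definition idx :: "nat \<Rightarrow> ((nat \<times> nat \<times> nat) \<times> 'a \<times> 'a \<times> 'a) set" where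
  "idx a = Sigma {(k, l, m). k + l + m = a} (\<lambda>(k, l, m). Rep k \<times> Rep k \<times> Rep l)"

definition hermF :: "(nat \<times> nat \<times> nat) \<times> 'a \<times> 'a \<times> 'a \<Rightarrow> 'a ^ 3 ^ 3" where
  "hermF = (\<lambda>((k, l, m), x, y, z). ut k l m x y z)"

definition hermG :: "(nat \<times> nat \<times> nat) \<times> 'a \<times> 'a \<times> 'a \<Rightarrow> 'a ^ 3 ^ 3" where
  "hermG = (\<lambda>((k, l, m), x, y, z). uti k l m x y z)"

lemma hermite_idx:
  assumes A: "intg A" "det A \<noteq> 0" "val (det A) = int a"
  shows "\<exists>i\<in>idx a. \<exists>h\<in>KK. A ** h = hermF i"
proof -
  have "invertible A" using A by (simp add: invertible_det_nz)
  from hermite[OF this A(1)] obtain h and k l m :: nat and x y z where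
    h: "h \<in> KK" "x \<in> Rep k" "y \<in> Rep k" "z \<in> Rep l" "A ** h = ut k l m x y z" by blast
  have "det A * det h = \<pi> powi (int k + int l + int m)"
    using arg_cong[OF h(5), of det] by (simp add: det_mul det_ut)
  then have "val (det A * det h) = int k + int l + int m" by simp
  moreover have "val (det A * det h) = int a"
    using A h(1) by (subst val_mult) (auto simp: KK_def)
  ultimately have "k + l + m = a" by linarith
  then have "((k, l, m), x, y, z) \<in> idx a" using h by (simp add: idx_def)
  moreover have "A ** h = hermF ((k, l, m), x, y, z)" using h by (simp add: hermF_def)
  ultimately show ?thesis using h(1) by blast
qed

lemma intg_Dm: "intg (Dm a b)"
  by (simp add: Dm_def dg_def intg_mk9)

lemma det_KK: "h \<in> KK \<Longrightarrow> det h \<noteq> 0 \<and> val (det h) = 0"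
  by (auto simp: KK_def)

lemma val_det_KK_Dm: "h \<in> KK \<Longrightarrow> det (h ** Dm a b) \<noteq> 0 \<and> val (det (h ** Dm a b)) = int (a + 2 * b)"
  using det_KK[of h] by (simp add: det_mul Dm_def det_dg val_mult)

text \<open>The matrix h D_a0 is integral with determinant of valuation a, so its Hermite form lies
  in the finite family \<open>idx a\<close>. The cover may contain further vertices; it is the
  source of upper bounds.\<close>

lemma Sp_a0_cover:
  assumes U: "invertible U" shows "Sp a 0 (vtx U) \<subseteq> (\<lambda>i. vtx (U ** hermF i)) ` idx a"
proof
  fix W assume "W \<in> Sp a 0 (vtx U)"
  then obtain h where h: "h \<in> KK" "W = vtx (U ** h ** Dm a 0)" by (rule SpE[OF U])
  have "intg (h ** Dm a 0)" using h by (intro intg_mult intg_Dm) (simp add: KK_def)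
  with hermite_idx[of "h ** Dm a 0" a] val_det_KK_Dm[OF h(1), of a 0]
  obtain i h' where i: "i \<in> idx a" "h' \<in> KK" "h ** Dm a 0 ** h' = hermF i" by auto
  have "vtx (U ** h ** Dm a 0) = vtx (U ** h ** Dm a 0 ** h')" using i by (simp add: vtx_KK)
  also have "U ** h ** Dm a 0 ** h' = U ** hermF i" unfolding i(3)[symmetric] by (simp only: matrix_mul_assoc)
  finally show "W \<in> (\<lambda>i. vtx (U ** hermF i)) ` idx a" using i h by auto
qed

text \<open>By symmetry U is at position (a, 0) from W. The Hermite form of the anti-transpose of
  the connecting integral matrix makes that matrix triangular by a row operation, and inverting it
  leads from U back to W.\<close>

lemma Sp_0a_cover:
  assumes U: "invertible U" shows "Sp 0 a (vtx U) \<subseteq> (\<lambda>i. vtx (U ** hermG i)) ` idx a"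
proof
  fix W assume W: "W \<in> Sp 0 a (vtx U)"
  then obtain A where A: "invertible A" "W = vtx A" using Sp_in verticesE by blast
  have "vtx U \<in> Sp a 0 (vtx A)" using Sp_sym_imp[OF vtx_in[OF U] W] A by simp
  then obtain h where h: "h \<in> KK" "vtx U = vtx (A ** h ** Dm a 0)" by (rule SpE[OF A(1)])
  have inv: "invertible (A ** h ** Dm a 0)"
    by (intro invertible_mult A(1) KK_invertible[OF h(1)] invertible_Dm)
  obtain c h2 where c: "c \<noteq> 0" "h2 \<in> KK" "U = mat c ** (A ** h ** Dm a 0) ** h2"
    using vtx_eqD[OF inv U h(2)[symmetric]] by blast
  let ?M = "h ** Dm a 0 ** h2"
  have UM: "U = mat c ** (A ** ?M)" by (simp add: c(3) matrix_mul_assoc)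
  have d: "det ?M \<noteq> 0" "val (det ?M) = int a"
    using val_det_KK_Dm[OF h(1), of a 0] det_KK[OF c(2)]
    unfolding det_mul[of _ h2] by (simp_all add: val_mult)
  have "intg (atr ?M)"
    unfolding intg_atr using h c by (intro intg_mult intg_Dm) (auto simp: KK_def)
  with hermite_idx[of "atr ?M" a] d
  obtain i h' where i: "i \<in> idx a" "h' \<in> KK" "atr ?M ** h' = hermF i" by auto
  obtain k l m x y z where ie: "i = ((k, l, m), x, y, z)" by (cases i) auto
  have "atr (atr ?M ** h') = ut m l k z y x" unfolding i(3) by (simp add: ie hermF_def atr_ut)
  then have M: "atr h' ** ?M = ut m l k z y x" by (simp only: atr_mult atr_atr)
  let ?N = "hermG i"
  have N: "?N ** ut m l k z y x = mat 1" using uti by (simp add: hermG_def ie)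
  have "?N ** atr h' ** ?M = mat 1" unfolding N[symmetric] M[symmetric] by (simp only: matrix_mul_assoc)
  then have "?M ** (?N ** atr h') = mat 1" by (rule iffD1[OF matrix_left_right_inverse])
  moreover have "U ** ?N ** atr h' = mat c ** (A ** (?M ** (?N ** atr h')))"
    by (simp only: UM matrix_mul_assoc)
  ultimately have e: "U ** ?N ** atr h' = mat c ** A" by simp
  have "vtx (U ** ?N) = vtx (U ** ?N ** atr h')" using i by (simp add: vtx_KK)
  also have "\<dots> = W" unfolding e using c A by (simp add: vtx_scale)
  finally show "W \<in> (\<lambda>i. vtx (U ** hermG i)) ` idx a" using i by auto
qed

end

section \<open>Sphere counts\<close>

context nonarch_local_field begin

section \<open>Sums over Hermite normal forms\<close>

abbreviation "qq \<equiv> residue_card abv"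

definition tri :: "nat \<Rightarrow> (nat \<times> nat \<times> nat) set" where
  "tri a = {(k, l, m). k + l + m = a}"

lemma finite_tri [simp]: "finite (tri a)"
  by (rule finite_subset[of _ "{..a} \<times> {..a} \<times> {..a}"]) (auto simp: tri_def)

lemma card_tri_le: "card (tri a) \<le> (a + 1)\<^sup>2"
proof -
  have "inj_on (\<lambda>(k, l, m). (k, l)) (tri a)" by (auto simp: inj_on_def tri_def)
  then have "card (tri a) = card ((\<lambda>(k, l, m). (k, l)) ` tri a)" by (simp add: card_image)
  also have "\<dots> \<le> card ({..a} \<times> {..a})" by (rule card_mono) (auto simp: tri_def)
  finally show ?thesis by (simp add: card_cartesian_product power2_eq_square)
qed

definition hdiff :: "(nat \<times> nat \<times> nat) \<times> 'a \<times> 'a \<times> 'a \<Rightarrow> int" where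
  "hdiff i = (case i of ((k, l, m), _) \<Rightarrow> int k - int m)"

lemma idx_eq: "idx a = Sigma (tri a) (\<lambda>(k, l, m). Rep k \<times> Rep k \<times> Rep l)"
  by (simp add: idx_def tri_def)

lemma finite_idx [simp]: "finite (idx a)"
  unfolding idx_eq by (rule finite_SigmaI) (auto simp: Rep_finite)

text \<open>With diagonal exponents k, l, m there are q^k choices for each of x and y and q^l for
  z.\<close>

lemma sum_idx: "(\<Sum>i\<in>idx a. w (hdiff i)) = (\<Sum>(k, l, m)\<in>tri a. real (qq ^ (2 * k + l)) * w (int k - int m))"
proof -
  have "(\<Sum>i\<in>idx a. w (hdiff i)) = (\<Sum>t\<in>tri a. \<Sum>p\<in>(case t of (k, l, m) \<Rightarrow> Rep k \<times> Rep k \<times> Rep l). w (hdiff (t, p)))"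
    unfolding idx_eq by (subst sum.Sigma) (auto simp: Rep_finite)
  also have "\<dots> = (\<Sum>(k, l, m)\<in>tri a. real (qq ^ (2 * k + l)) * w (int k - int m))"
    by (rule sum.cong)
      (auto simp: hdiff_def card_cartesian_product Rep_card power_add power2_eq_square power_mult mult.assoc
        power_mult_distrib power_even_eq)
  finally show ?thesis .
qed

lemma hgt_hermF: "V = vtx (ut k l m x y z) \<Longrightarrow> hgt (vtx (ut k l m x y z ** hermF i)) = hgt V + hdiff i"
  by (cases i) (auto simp: hermF_def hgt_mult_ut hdiff_def)

lemma hgt_hermG: "V = vtx (ut k l m x y z) \<Longrightarrow> hgt (vtx (ut k l m x y z ** hermG i)) = hgt V + hdiff i"
proof -
  obtain k' l' m' x' y' z' where i: "i = ((k', l', m'), x', y', z')" by (cases i) auto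
  obtain x'' y'' z'' where "uti k' l' m' x' y' z' = ut (-m') (-l') (-k') x'' y'' z''" using uti(3) by blast
  then show "V = vtx (ut k l m x y z) \<Longrightarrow> hgt (vtx (ut k l m x y z ** hermG i)) = hgt V + hdiff i"
    by (simp add: i hermG_def hgt_mult_ut hdiff_def)
qed

lemma Sp_a0_coverE:
  assumes V: "V \<in> vertices abv"
  obtains F where "Sp a 0 V \<subseteq> F ` idx a" "\<forall>i. hgt (F i) = hgt V + hdiff i"
proof -
  obtain k l m x y z where V: "V = vtx (ut k l m x y z)" using V by (rule vertices_utE)
  show thesis
  proof (rule that)
    show "Sp a 0 V \<subseteq> (\<lambda>i. vtx (ut k l m x y z ** hermF i)) ` idx a"
      unfolding V by (rule Sp_a0_cover) simp
  qed (intro allI hgt_hermF[OF V])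
qed

lemma Sp_0a_coverE:
  assumes V: "V \<in> vertices abv"
  obtains F where "Sp 0 a V \<subseteq> F ` idx a" "\<forall>i. hgt (F i) = hgt V + hdiff i"
proof -
  obtain k l m x y z where V: "V = vtx (ut k l m x y z)" using V by (rule vertices_utE)
  show thesis
  proof (rule that)
    show "Sp 0 a V \<subseteq> (\<lambda>i. vtx (ut k l m x y z ** hermG i)) ` idx a"
      unfolding V by (rule Sp_0a_cover) simp
  qed (intro allI hgt_hermG[OF V])
qed

lemma sum_cover_le:
  assumes "S \<subseteq> F ` idx a" "\<forall>i. hgt (F i) = hgt V + hdiff i" "\<And>j. 0 \<le> w j"
  shows "finite S" "(\<Sum>W\<in>S. w (hgt W - hgt V)) \<le> (\<Sum>i\<in>idx a. w (hdiff i) :: real)"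
proof -
  show "finite S" by (rule finite_subset[OF assms(1)]) simp
  have "(\<Sum>W\<in>S. w (hgt W - hgt V)) \<le> (\<Sum>W\<in>F ` idx a. w (hgt W - hgt V))"
    by (rule sum_mono2) (use assms in auto)
  also have "\<dots> \<le> (\<Sum>i\<in>idx a. w (hgt (F i) - hgt V))"
    using sum_image_le[of "idx a" "\<lambda>W. w (hgt W - hgt V)" F] assms(3) by (simp add: o_def)
  finally show "(\<Sum>W\<in>S. w (hgt W - hgt V)) \<le> (\<Sum>i\<in>idx a. w (hdiff i))" by (simp add: assms(2))
qed

text \<open>Applied with a power of q for the Schur test and with constants for finiteness and
  cardinalities.\<close>

lemma sum_Sp_le:
  assumes V: "V \<in> vertices abv" and w: "\<And>j. 0 \<le> w j"
  shows "finite (Sp a 0 V)" "finite (Sp 0 a V)"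
    and "(\<Sum>W\<in>Sp a 0 V. w (hgt W - hgt V)) \<le> (\<Sum>i\<in>idx a. w (hdiff i) :: real)"
    and "(\<Sum>W\<in>Sp 0 a V. w (hgt W - hgt V)) \<le> (\<Sum>i\<in>idx a. w (hdiff i) :: real)"
proof -
  obtain F where F: "Sp a 0 V \<subseteq> F ` idx a" "\<forall>i. hgt (F i) = hgt V + hdiff i"
    by (rule Sp_a0_coverE[OF V, of a])
  show "finite (Sp a 0 V)" "(\<Sum>W\<in>Sp a 0 V. w (hgt W - hgt V)) \<le> (\<Sum>i\<in>idx a. w (hdiff i))"
    by (rule sum_cover_le[OF F w])+
  obtain G where G: "Sp 0 a V \<subseteq> G ` idx a" "\<forall>i. hgt (G i) = hgt V + hdiff i"
    by (rule Sp_0a_coverE[OF V, of a])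
  show "finite (Sp 0 a V)" "(\<Sum>W\<in>Sp 0 a V. w (hgt W - hgt V)) \<le> (\<Sum>i\<in>idx a. w (hdiff i))"
    by (rule sum_cover_le[OF G w])+
qed

lemma hdiff_le: "i \<in> idx a \<Longrightarrow> hdiff i \<le> int a"
  by (auto simp: idx_eq hdiff_def tri_def)

lemma Sp_subset_compose: "Sp a b V \<subseteq> (\<Union>U\<in>Sp a 0 V. Sp 0 b U)"
  using Sp_compose by blast

lemma finite_Sp: assumes V: "V \<in> vertices abv" shows "finite (Sp a b V)"
  by (rule finite_subset[OF Sp_subset_compose])
    (intro finite_UN_I sum_Sp_le(1,2)[where w = "\<lambda>_. 0"] V, auto intro: Sp_in)

lemma hgt_le:
  assumes V: "V \<in> vertices abv" and W: "W \<in> Sp a b V"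
  shows "hgt W - hgt V \<le> int (a + b)"
proof -
  obtain U where U: "U \<in> Sp a 0 V" "W \<in> Sp 0 b U" using Sp_compose[OF W] by blast
  obtain F where F: "Sp a 0 V \<subseteq> F ` idx a" "\<forall>i. hgt (F i) = hgt V + hdiff i"
    by (rule Sp_a0_coverE[OF V, of a])
  obtain G where G: "Sp 0 b U \<subseteq> G ` idx b" "\<forall>i. hgt (G i) = hgt U + hdiff i"
    by (rule Sp_0a_coverE[OF Sp_in[OF U(1)], of b])
  obtain i where i: "i \<in> idx a" "U = F i" using F(1) U(1) by blast
  obtain j where j: "j \<in> idx b" "W = G j" using G(1) U(2) by blast
  have "hgt U \<le> hgt V + int a" using spec[OF F(2), of i] hdiff_le[OF i(1)] unfolding i(2) by linarith
  moreover have "hgt W \<le> hgt U + int b" using spec[OF G(2), of j] hdiff_le[OF j(1)] unfolding j(2) by linarith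
  ultimately show ?thesis by simp
qed

text \<open>Bounds for the spheres (a, 0) and (0, b) multiply. Vertices reached through several
  intermediate vertices are overcounted, which is harmless as \<open>w\<close> is
  nonnegative.\<close>

lemma sum_Sp_compose_le:
  assumes V: "V \<in> vertices abv" and w: "\<And>W. 0 \<le> w W"
    and 1: "\<And>U. U \<in> vertices abv \<Longrightarrow> (\<Sum>W\<in>Sp 0 b U. w W) \<le> B * u U"
    and 2: "(\<Sum>U\<in>Sp a 0 V. u U) \<le> A * v" and B: "0 \<le> B"
  shows "(\<Sum>W\<in>Sp a b V. w W) \<le> A * B * (v :: real)"
proof -
  note fin = sum_Sp_le(1,2)[where w = "\<lambda>_. 0"]
  have "(\<Sum>W\<in>Sp a b V. w W) \<le> (\<Sum>W\<in>(\<Union>U\<in>Sp a 0 V. Sp 0 b U). w W)"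
    by (rule sum_mono2[OF _ Sp_subset_compose]) (use fin V Sp_in w in auto)
  also have "\<dots> \<le> (\<Sum>U\<in>Sp a 0 V. \<Sum>W\<in>Sp 0 b U. w W)"
  proof -
    let ?S = "Sigma (Sp a 0 V) (Sp 0 b)"
    have fS: "finite ?S" using fin V Sp_in by (intro finite_SigmaI) auto
    have "(\<Union>U\<in>Sp a 0 V. Sp 0 b U) = snd ` ?S" by force
    also have "(\<Sum>W\<in>snd ` ?S. w W) \<le> (\<Sum>p\<in>?S. w (snd p))"
      using sum_image_le[OF fS, of w snd] w by (simp add: o_def)
    also have "\<dots> = (\<Sum>U\<in>Sp a 0 V. \<Sum>W\<in>Sp 0 b U. w W)"
      by (subst sum.Sigma) (use fin V Sp_in in \<open>auto simp: case_prod_unfold\<close>)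
    finally show ?thesis .
  qed
  also have "\<dots> \<le> (\<Sum>U\<in>Sp a 0 V. B * u U)" using 1 Sp_in by (intro sum_mono) auto
  also have "\<dots> = B * (\<Sum>U\<in>Sp a 0 V. u U)" by (simp add: sum_distrib_left)
  also have "\<dots> \<le> B * (A * v)" by (rule mult_left_mono[OF 2 B])
  finally show ?thesis by (simp add: mult_ac)
qed

section \<open>The Schur weight and the size of spheres\<close>

definition rq :: real where "rq = real qq"

lemma rq_ge_2: "2 \<le> rq" using residue_card_ge_2 by (simp add: rq_def)

definition wt :: "('a ^ 3) set set \<Rightarrow> real" where "wt V = rq powi (- hgt V)"

lemma wt_pos: "0 < wt V" using rq_ge_2 by (simp add: wt_def)

text \<open>Every diagonal type contributes exactly q^(2k+l) q^(m-k) = q^(k+l+m) = q^a, and there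
  are at most (a+1)^2 types.\<close>

lemma sum_idx_wt: "(\<Sum>i\<in>idx a. rq powi (- hdiff i)) \<le> (real a + 1)\<^sup>2 * rq ^ a"
proof -
  have rq: "0 < rq" using rq_ge_2 by simp
  have "(\<Sum>i\<in>idx a. rq powi (- hdiff i)) = (\<Sum>(k, l, m)\<in>tri a. real (qq ^ (2 * k + l)) * rq powi (- (int k - int m)))"
    by (rule sum_idx)
  also have "\<dots> = (\<Sum>t\<in>tri a. rq ^ a)"
  proof (rule sum.cong)
    fix t assume "t \<in> tri a"
    then obtain k l m where t: "t = (k, l, m)" "k + l + m = a" by (auto simp: tri_def)
    have "real (qq ^ (2 * k + l)) * rq powi (- (int k - int m)) = rq powi int (2 * k + l) * rq powi (- (int k - int m))"
      unfolding power_int_of_nat by (simp add: rq_def)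
    also have "\<dots> = rq powi (int (2 * k + l) + - (int k - int m))" using rq by (subst power_int_add) auto
    also have "int (2 * k + l) + - (int k - int m) = int a" using t by simp
    finally show "(case t of (k, l, m) \<Rightarrow> real (qq ^ (2 * k + l)) * rq powi (- (int k - int m))) = rq ^ a"
      by (simp add: t)
  qed simp
  also have "\<dots> = real (card (tri a)) * rq ^ a" by simp
  also have "\<dots> \<le> real ((a + 1)\<^sup>2) * rq ^ a"
    using card_tri_le rq by (intro mult_right_mono of_nat_mono) auto
  finally show ?thesis by (simp add: add.commute)
qed

lemma sum_wt_Sp1:
  assumes V: "V \<in> vertices abv"
  shows "(\<Sum>W\<in>Sp a 0 V. wt W) \<le> ((real a + 1)\<^sup>2 * rq ^ a) * wt V"
    and "(\<Sum>W\<in>Sp 0 a V. wt W) \<le> ((real a + 1)\<^sup>2 * rq ^ a) * wt V"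
proof -
  have e: "wt W = rq powi (- (hgt W - hgt V)) * wt V" for W
    using rq_ge_2 by (simp add: wt_def power_int_diff power_int_minus divide_inverse)
  have p: "0 \<le> rq powi (- j)" for j using rq_ge_2 by simp
  note s = sum_Sp_le[OF V, where w = "\<lambda>j. rq powi (- j)", OF p]
  show "(\<Sum>W\<in>Sp a 0 V. wt W) \<le> ((real a + 1)\<^sup>2 * rq ^ a) * wt V"
    by (subst e, subst sum_distrib_right[symmetric])
      (intro mult_right_mono order_trans[OF s(3) sum_idx_wt] less_imp_le[OF wt_pos])
  show "(\<Sum>W\<in>Sp 0 a V. wt W) \<le> ((real a + 1)\<^sup>2 * rq ^ a) * wt V"
    by (subst e, subst sum_distrib_right[symmetric])
      (intro mult_right_mono order_trans[OF s(4) sum_idx_wt] less_imp_le[OF wt_pos])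
qed

lemma sum_wt_Sp:
  assumes V: "V \<in> vertices abv"
  shows "(\<Sum>W\<in>Sp a b V. wt W) \<le> (real a + 1)\<^sup>2 * (real b + 1)\<^sup>2 * rq ^ (a + b) * wt V"
proof -
  have "(\<Sum>W\<in>Sp a b V. wt W) \<le> ((real a + 1)\<^sup>2 * rq ^ a) * ((real b + 1)\<^sup>2 * rq ^ b) * wt V"
    by (rule sum_Sp_compose_le[OF V _ _ sum_wt_Sp1(1)[OF V]])
      (use sum_wt_Sp1(2) wt_pos rq_ge_2 in \<open>auto intro: less_imp_le\<close>)
  then show ?thesis by (simp add: power_add mult_ac)
qed

text \<open>For k + l + m = a one has q^(2k+l) = q^(2a) q^(-l) q^(-2m). Dropping the constraint
  leaves two geometric series with ratio at most 1/2, each bounded by 2.\<close>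

lemma card_idx_le: "real (card (idx a)) \<le> 4 * rq ^ (2 * a)"
proof -
  have rq: "0 < rq" "1 < rq" using rq_ge_2 by simp_all
  have "real (card (idx a)) = (\<Sum>(k, l, m)\<in>tri a. rq ^ (2 * k + l))"
    using sum_idx[of "\<lambda>_. 1" a] by (simp add: rq_def)
  also have "\<dots> = (\<Sum>(k, l, m)\<in>tri a. rq ^ (2 * a) * ((1 / rq) ^ l * (1 / rq) ^ (2 * m)))"
  proof (rule sum.cong)
    fix t assume "t \<in> tri a"
    then obtain k l m where t: "t = (k, l, m)" "a = k + l + m" by (auto simp: tri_def)
    show "(case t of (k, l, m) \<Rightarrow> rq ^ (2 * k + l)) = (case t of (k, l, m) \<Rightarrow> rq ^ (2 * a) * ((1 / rq) ^ l * (1 / rq) ^ (2 * m)))"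
      using rq by (simp add: t power_add power_divide distrib_left power2_eq_square mult_2)
  qed simp
  also have "\<dots> = rq ^ (2 * a) * (\<Sum>(k, l, m)\<in>tri a. (1 / rq) ^ l * (1 / rq) ^ (2 * m))"
    by (simp add: sum_distrib_left case_prod_unfold)
  also have "(\<Sum>(k, l, m)\<in>tri a. (1 / rq) ^ l * (1 / rq) ^ (2 * m)) = (\<Sum>(l, m)\<in>(\<lambda>(k, l, m). (l, m)) ` tri a. (1 / rq) ^ l * (1 / rq) ^ (2 * m))"
    by (subst sum.reindex) (auto simp: inj_on_def tri_def case_prod_unfold o_def)
  also have "\<dots> \<le> (\<Sum>(l, m)\<in>{..a} \<times> {..a}. (1 / rq) ^ l * (1 / rq) ^ (2 * m))"
    by (rule sum_mono2) (use rq in \<open>auto simp: tri_def\<close>)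
  also have "\<dots> = (\<Sum>l\<le>a. (1 / rq) ^ l) * (\<Sum>m\<le>a. (1 / rq) ^ (2 * m))"
    by (simp add: sum_product sum.cartesian_product)
  also have "\<dots> \<le> 2 * 2"
  proof (rule mult_mono)
    have g: "(\<Sum>l\<le>a. (1 / rq) ^ l) \<le> 2"
    proof -
      have "(\<Sum>l\<le>a. (1 / rq) ^ l) \<le> (\<Sum>l\<le>a. (1 / 2) ^ l)"
        using rq_ge_2 by (intro sum_mono power_mono) (auto simp: field_simps)
      also have "(\<Sum>l\<le>a. (1 / 2) ^ l) = 2 - (1 / 2 :: real) ^ a" by (induction a) auto
      also have "\<dots> \<le> 2" by simp
      finally show ?thesis .
    qed
    show "(\<Sum>l\<le>a. (1 / rq) ^ l) \<le> 2" by (rule g)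
    have "(\<Sum>m\<le>a. (1 / rq) ^ (2 * m)) \<le> (\<Sum>l\<le>a. (1 / rq) ^ l)"
      using rq by (intro sum_mono power_decreasing) auto
    then show "(\<Sum>m\<le>a. (1 / rq) ^ (2 * m)) \<le> 2" using g by simp
    show "0 \<le> (\<Sum>m\<le>a. (1 / rq) ^ (2 * m))" using rq by (intro sum_nonneg) auto
  qed simp
  finally show ?thesis using rq by (simp add: mult.commute)
qed

lemma card_Sp_le:
  assumes V: "V \<in> vertices abv"
  shows "real (card (Sp a b V)) \<le> 16 * rq ^ (2 * (a + b))"
proof -
  have 1: "real (card (Sp a 0 V)) \<le> 4 * rq ^ (2 * a)" "real (card (Sp 0 a V)) \<le> 4 * rq ^ (2 * a)"
    if "V \<in> vertices abv" for V a
    using sum_Sp_le(3,4)[OF that, where w = "\<lambda>_. 1" and a = a] card_idx_le[of a] by simp_all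
  have "(\<Sum>W\<in>Sp a b V. 1) \<le> (4 * rq ^ (2 * a)) * (4 * rq ^ (2 * b)) * (1::real)"
    by (rule sum_Sp_compose_le[OF V, where u = "\<lambda>_. 1"]) (use 1 V rq_ge_2 in auto)
  then show ?thesis by (simp add: power_add distrib_left)
qed

lemma Rep_unique': "x \<in> Rep k \<Longrightarrow> x' \<in> Rep k \<Longrightarrow> abv (x' - x) \<le> abv (\<pi> powi int k) \<Longrightarrow> x = x'"
  using Rep_unique[of x' k x] by (simp add: abv_power)

text \<open>The \<open>q\<^sup>2\<^sup>(\<^sup>a\<^sup>+\<^sup>b\<^sup>)\<close> translates of \<open>D\<^sub>a\<^sub>b\<O>\<^sup>3\<close> by integral unipotent matrices all have maximal height.\<close>

lemma card_Sp_top_ge: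
  assumes V: "V \<in> vertices abv"
  shows "rq ^ (2 * (a + b)) \<le> real (card {W \<in> Sp a b V. hgt W = hgt V + int (a + b)})"
proof -
  obtain k l m x y z where V': "V = vtx (ut k l m x y z)" using V by (rule vertices_utE)
  let ?U = "ut k l m x y z"
  \<comment> \<open>The product of the unipotent matrix with entries r, s, t and D_ab. Only r modulo
    pi^a, s modulo pi^(a+b) and t modulo pi^b matter, which makes q^(2(a+b)) choices.\<close>
  let ?X = "\<lambda>(r, s, t). ut (int (a + b)) (int b) 0 (\<pi> powi int b * r) s t"
  let ?I = "Rep a \<times> Rep (a + b) \<times> Rep b"
  have inj: "inj_on (\<lambda>i. vtx (?U ** ?X i)) ?I"
  proof (rule inj_onI)
    fix i j assume ij: "i \<in> ?I" "j \<in> ?I" and eq: "vtx (?U ** ?X i) = vtx (?U ** ?X j)"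
    obtain r s t r' s' t' where i: "i = (r, s, t)" "j = (r', s', t')" by (cases i; cases j) auto
    have e: "vtx (?X i) = vtx (?X j)" using eq by (subst (asm) vtx_left) (auto simp: i)
    note D = ut_vtx_eqD[OF e[unfolded i prod.case]]
    have t: "t = t'" using D(3) ij by (intro Rep_unique'[of t b t']) (auto simp: i)
    note D4 = D(4)[OF refl t]
    have s: "s = s'" using D4 ij by (intro Rep_unique'[of s "a + b" s']) (auto simp: i)
    have "abv (\<pi> powi int b * (r' - r)) \<le> abv (\<pi> powi int b * \<pi> powi int a)"
      using D4 by (simp add: power_int_add algebra_simps)
    then have "abv (r' - r) \<le> abv (\<pi> powi int a)"
      using abv_pos[of "\<pi> powi int b"] by (simp add: abv_mult del: power_int_of_nat)
    then have "r = r'" using ij by (intro Rep_unique'[of r a r']) (auto simp: i)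
    then show "i = j" by (simp add: i s t)
  qed
  have sub: "(\<lambda>i. vtx (?U ** ?X i)) ` ?I \<subseteq> {W \<in> Sp a b V. hgt W = hgt V + int (a + b)}"
  proof (intro image_subsetI CollectI)
    fix i assume i: "i \<in> ?I"
    obtain r s t where ie: "i = (r, s, t)" by (cases i) auto
    have rst: "r \<in> Rep a" "s \<in> Rep (a + b)" "t \<in> Rep b" using i by (auto simp: ie)
    let ?u = "mk9 1 r s 0 1 t 0 0 1"
    have u: "?u \<in> KK" using rst Rep_int by (intro upper_KK) auto
    have X: "?X (r, s, t) = ?u ** Dm a b" by (simp add: Dm_def dg_def mk9_mult ut_def mult.commute)
    have "vtx (?U ** ?u ** Dm a b) \<in> Sp a b (vtx (?U ** ?u))"
      by (intro SpI invertible_mult invertible_ut KK_invertible[OF u])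
    then have "vtx (?U ** ?X (r, s, t)) \<in> Sp a b V" unfolding X V' by (simp add: vtx_KK[OF u] matrix_mul_assoc)
    moreover have "hgt (vtx (?U ** ?X (r, s, t))) = hgt V + int (a + b)" by (simp add: V' hgt_mult_ut)
    ultimately show "vtx (?U ** ?X i) \<in> Sp a b V \<and> hgt (vtx (?U ** ?X i)) = hgt V + int (a + b)"
      unfolding ie ..
  qed
  have "rq ^ (2 * (a + b)) = real (card ?I)"
    by (simp add: card_cartesian_product Rep_card rq_def power_add power_mult power2_eq_square mult_ac)
  also have "\<dots> = real (card ((\<lambda>i. vtx (?U ** ?X i)) ` ?I))" using card_image[OF inj] by simp
  also have "\<dots> \<le> real (card {W \<in> Sp a b V. hgt W = hgt V + int (a + b)})"
    using finite_Sp[OF V] by (intro of_nat_mono card_mono[OF _ sub]) simp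
  finally show ?thesis .
qed

end

section \<open>Neighbours and colours\<close>

context nonarch_local_field begin

section \<open>Colours and the orbits of PSL_3\<close>

lemma val_det_scale:
  fixes A :: "'a ^ 3 ^ 3"
  shows "c \<noteq> 0 \<Longrightarrow> det A \<noteq> 0 \<Longrightarrow> val (det (mat c ** A)) = 3 * val c + val (det A)"
  by (simp add: det_mul) (simp add: mat_mk9 det_mk9 val_mult)

text \<open>Homothety by c adds 3 val c to the valuation of the determinant, and elements of
  \<open>KK\<close> add nothing; so the residue modulo 3 belongs to the vertex.\<close>

definition col :: "('a ^ 3) set set \<Rightarrow> int" where
  "col V = (SOME j. \<exists>A. invertible A \<and> V = vtx A \<and> j = val (det A) mod 3)"

lemma col_vtx:
  assumes A: "invertible A" shows "col (vtx A) = val (det A) mod 3"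
proof -
  let ?P = "\<lambda>j. \<exists>B. invertible B \<and> vtx A = vtx B \<and> j = val (det B) mod 3"
  have "?P (col (vtx A))" unfolding col_def by (rule someI[of ?P "val (det A) mod 3"]) (use A in blast)
  then obtain B where B: "invertible B" "vtx A = vtx B" "col (vtx A) = val (det B) mod 3" by blast
  obtain c h where c: "c \<noteq> 0" "h \<in> KK" "B = mat c ** A ** h" using vtx_eqD[OF A B(1,2)] by blast
  have dA: "det A \<noteq> 0" using A by (simp add: invertible_det_nz)
  have "det B = det (mat c ** A) * det h" by (simp add: c(3) det_mul)
  moreover have "det (mat c ** A) \<noteq> 0" using dA c(1) by (simp add: det_mul) (simp add: mat_mk9 det_mk9)
  ultimately have "val (det B) = 3 * val c + val (det A)"
    using det_KK[OF c(2)] by (simp add: val_mult val_det_scale[OF c(1) dA])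
  then show ?thesis using B(3) by simp
qed

lemma col_range: "V \<in> vertices abv \<Longrightarrow> col V \<in> {0, 1, 2}"
  by (erule verticesE) (auto simp: col_vtx)

lemma col_Sp: "V \<in> vertices abv \<Longrightarrow> W \<in> Sp a b V \<Longrightarrow> col W = (col V + int a + 2 * int b) mod 3"
proof -
  assume W: "W \<in> Sp a b V"
  then obtain A where A: "invertible A" "V = vtx A" "W = vtx (A ** Dm a b)" by (auto simp: Sp_def)
  have "val (det (A ** Dm a b)) = val (det A) + int a + 2 * int b"
    using A(1) by (simp add: det_mul Dm_def det_dg val_mult invertible_det_nz)
  then show ?thesis using A by (simp add: col_vtx invertible_mult mod_simps add.assoc)
qed

lemma col_act: "invertible g \<Longrightarrow> V \<in> vertices abv \<Longrightarrow> col (vertex_act (proj g) V) = (col V + val (det g)) mod 3"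
proof -
  assume g: "invertible g" and "V \<in> vertices abv"
  then obtain A where A: "invertible A" "V = vtx A" by (rule_tac verticesE)
  have "val (det (g ** A)) = val (det g) + val (det A)"
    using A g by (simp add: det_mul val_mult invertible_det_nz)
  then show ?thesis using A g by (simp add: vertex_act_proj col_vtx invertible_mult mod_simps add.commute)
qed

text \<open>Equal colours permit rescaling the representative of W until its determinant has the
  valuation of that of A. The remaining unit is absorbed by a diagonal element of \<open>KK\<close>,
  and the quotient by A then has determinant 1.\<close>

lemma PSL3_transitive:
  assumes V: "V \<in> vertices abv" and W: "W \<in> vertices abv" and c: "col V = col W"
  shows "\<exists>s\<in>PSL3. vertex_act s V = W"
proof -
  obtain A where A: "invertible A" "V = vtx A" using V by (rule verticesE)
  obtain B where B: "invertible B" "W = vtx B" using W by (rule verticesE)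
  have "val (det A) mod 3 = val (det B) mod 3" using c A B by (simp add: col_vtx)
  then have "3 dvd val (det B) - val (det A)" using mod_eq_dvd_iff[of "val (det B)" 3 "val (det A)"] by simp
  then obtain j where j: "val (det B) - val (det A) = 3 * j" by (rule dvdE)
  let ?B = "mat (\<pi> powi (- j)) ** B"
  have dA: "det A \<noteq> 0" and dB: "det B \<noteq> 0" using A B by (simp_all add: invertible_det_nz)
  have vB: "val (det ?B) = val (det A)" using j dB by (simp add: val_det_scale)
  have dB': "det ?B \<noteq> 0" using dB by (simp add: det_mul) (simp add: mat_mk9 det_mk9)
  define u where "u = det A / det ?B"
  have "abv (det A) = abv (det ?B)"
    using vB abv_le_iff_val[OF dA dB'] abv_le_iff_val[OF dB' dA] by simp
  then have u: "abv u = 1" using abv_pos[OF dB'] by (simp add: u_def abv_divide)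
  let ?h = "mk9 u 0 0 0 1 0 0 0 1"
  have h: "?h \<in> KK" using u by (intro diag_KK) auto
  let ?C = "?B ** ?h"
  have dC: "det ?C = det A" using dB' by (simp add: det_mul[of ?B]) (simp add: det_mk9 u_def)
  obtain A' where A': "invertible A'" "A ** A' = mat 1" "A' ** A = mat 1" by (rule invertibleE[OF A(1)])
  have "det A * det A' = 1" using arg_cong[OF A'(2), of det] by (simp add: det_mul)
  then have "det (?C ** A') = 1" by (simp only: det_mul[of ?C] dC)
  moreover have "vertex_act (proj (?C ** A')) V = W"
  proof -
    have "?C ** A' ** A = ?C" by (simp only: A' matrix_mul_rid flip: matrix_mul_assoc)
    then have "vertex_act (proj (?C ** A')) V = vtx ?C" unfolding A(2) vertex_act_proj by simp
    then show ?thesis by (simp add: vtx_KK[OF h] vtx_scale B)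
  qed
  ultimately show ?thesis unfolding PSL3_eq by blast
qed

section \<open>Exact description of the spheres of radius one\<close>

lemma hermF_inj:
  assumes i: "i \<in> idx a" and j: "j \<in> idx a" and eq: "vtx (hermF i) = vtx (hermF j)"
  shows "i = j"
proof -
  obtain k l m x y z where ie: "i = ((k, l, m), x, y, z)" by (cases i) auto
  obtain k' l' m' x' y' z' where je: "j = ((k', l', m'), x', y', z')" by (cases j) auto
  have i': "k + l + m = a" "x \<in> Rep k" "y \<in> Rep k" "z \<in> Rep l" using i by (auto simp: idx_eq tri_def ie)
  have j': "k' + l' + m' = a" "x' \<in> Rep k'" "y' \<in> Rep k'" "z' \<in> Rep l'" using j by (auto simp: idx_eq tri_def je)
  have "vtx (ut k l m x y z) = vtx (ut k' l' m' x' y' z')" using eq by (simp add: hermF_def ie je)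
  note D = ut_vtx_eqD[OF this]
  \<comment> \<open>The differences of the exponents agree and both triples have sum a.\<close>
  have k: "k = k'" "l = l'" "m = m'" using D(1,2) i'(1) j'(1) by linarith+
  have z: "z = z'" using D(3) i' j' k by (intro Rep_unique'[of z l z']) auto
  have "x = x'" "y = y'" using D(4) i' j' k z by (auto intro: Rep_unique'[of x k x'] Rep_unique'[of y k y'])
  then show ?thesis by (simp add: ie je k z)
qed

lemma hermG_atr: "atr (hermF i) ** hermG i = mat 1" "hermG i ** atr (hermF i) = mat 1"
  by (cases i; auto simp: hermF_def hermG_def atr_ut uti)+

lemma invertible_hermF [simp]: "invertible (hermF i)"
  by (cases i) (auto simp: hermF_def)

lemma invertible_hermG [simp]: "invertible (hermG i)"
  by (cases i) (auto simp: hermG_def)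

text \<open>\<open>hermG\<close> consists of the inverses of the anti-transposed forms, so an
  equality of its vertices is carried over to one for \<open>hermF\<close>.\<close>

lemma hermG_inj:
  assumes i: "i \<in> idx a" and j: "j \<in> idx a" and eq: "vtx (hermG i) = vtx (hermG j)"
  shows "i = j"
proof -
  obtain c h where c: "c \<noteq> 0" "h \<in> KK" "hermG j = mat c ** hermG i ** h"
    using vtx_eqD[OF _ _ eq] by auto
  have "atr (hermF i) = atr (hermF i) ** (hermG j ** atr (hermF j))" by (simp add: hermG_atr)
  also have "\<dots> = (atr (hermF i) ** (mat c ** hermG i)) ** h ** atr (hermF j)"
    unfolding c(3) by (simp only: matrix_mul_assoc)
  also have "atr (hermF i) ** (mat c ** hermG i) = mat c"
    unfolding mult_mat_left hermG_atr by simp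
  finally have "atr (atr (hermF i)) = atr (mat c ** h ** atr (hermF j))" by (rule arg_cong)
  then have "hermF i = hermF j ** (atr h ** mat c)" by (simp only: atr_mult atr_atr atr_mat)
  also have "atr h ** mat c = mat c ** atr h" by (rule mat_mult_commute[symmetric])
  also have "hermF j ** (mat c ** atr h) = mat c ** hermF j ** atr h"
    unfolding mult_mat_left by (rule matrix_mul_assoc)
  finally have "vtx (hermF i) = vtx (mat c ** hermF j ** atr h)" by (rule arg_cong)
  also have "\<dots> = vtx (hermF j)" using c by (intro vtx_scale_KK) auto
  finally show ?thesis using hermF_inj[OF i j] by blast
qed

text \<open>The Smith exponents are nonnegative with sum 1, which leaves (1, 0, 0).\<close>

lemma smith_1:
  assumes A: "intg A" "det A \<noteq> 0" "val (det A) = 1"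
  shows "\<exists>g\<in>KK. \<exists>h\<in>KK. A ** h = g ** Dm 1 0"
proof -
  have "invertible A" using A by (simp add: invertible_det_nz)
  from smith[OF this] obtain g h k l m where
    gh: "g \<in> KK" "h \<in> KK" "m \<le> l" "l \<le> k" "g ** A ** h = dg k l m" by blast
  have "intg (g ** A ** h)" using gh A by (intro intg_mult) (auto simp: KK_def)
  then have m: "0 \<le> m" unfolding gh(5) by (simp add: dg_def intg_mk9)
  have "val (det (g ** A ** h)) = 1"
    using A det_KK[OF gh(1)] det_KK[OF gh(2)] by (simp add: det_mul val_mult)
  then have "k + l + m = 1" unfolding gh(5) by (simp add: det_dg)
  then have "k = 1" "l = 0" "m = 0" using m gh by linarith+
  then have e: "g ** A ** h = Dm 1 0" using gh by (simp add: Dm_def)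
  obtain g' where g': "g' \<in> KK" "g' ** g = mat 1" using KK_inverse[OF gh(1)] by blast
  have "A ** h = (g' ** g) ** A ** h" by (simp add: g')
  also have "\<dots> = g' ** (g ** A ** h)" by (simp only: matrix_mul_assoc)
  finally have "A ** h = g' ** Dm 1 0" by (simp only: e)
  then show ?thesis using g' gh by blast
qed

lemma Sp_10_intg:
  assumes U: "invertible U" and A: "intg A" "det A \<noteq> 0" "val (det A) = 1"
  shows "vtx (U ** A) \<in> Sp 1 0 (vtx U)"
proof -
  obtain g h where gh: "g \<in> KK" "h \<in> KK" "A ** h = g ** Dm 1 0" using smith_1[OF A] by blast
  have "vtx (U ** A) = vtx (U ** (A ** h))" by (simp only: matrix_mul_assoc vtx_KK[OF gh(2)])
  also have "\<dots> = vtx (U ** g ** Dm 1 0)" unfolding gh(3) by (simp only: matrix_mul_assoc)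
  also have "\<dots> \<in> Sp 1 0 (vtx (U ** g))"
    by (intro SpI invertible_mult U KK_invertible gh)
  finally show ?thesis by (simp add: vtx_KK gh)
qed

lemma intg_hermF: "i \<in> idx a \<Longrightarrow> intg (hermF i)"
  by (auto simp: idx_eq tri_def hermF_def ut_def intg_mk9 Rep_int)

lemma det_hermF: "i \<in> idx a \<Longrightarrow> det (hermF i) = \<pi> powi int a"
  by (auto simp: idx_eq tri_def hermF_def det_ut simp del: power_int_of_nat)

text \<open>At radius one the covers by Hermite forms are equalities; with injectivity they yield
  the exact law of a height increment, where larger radii have only bounds.\<close>

lemma Sp_1_eq:
  assumes U: "invertible U"
  shows "Sp 1 0 (vtx U) = (\<lambda>i. vtx (U ** hermF i)) ` idx 1"
    and "Sp 0 1 (vtx U) = (\<lambda>i. vtx (U ** hermG i)) ` idx 1"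
proof -
  show "Sp 1 0 (vtx U) = (\<lambda>i. vtx (U ** hermF i)) ` idx 1"
  proof (intro equalityI Sp_a0_cover[OF U] image_subsetI)
    fix i assume i: "i \<in> idx 1"
    show "vtx (U ** hermF i) \<in> Sp 1 0 (vtx U)"
      using intg_hermF[OF i] det_hermF[OF i] val_unif_powi[of 1] by (intro Sp_10_intg[OF U]) simp_all
  qed
  show "Sp 0 1 (vtx U) = (\<lambda>i. vtx (U ** hermG i)) ` idx 1"
  proof (intro equalityI Sp_0a_cover[OF U] image_subsetI)
    fix i assume i: "i \<in> idx 1"
    let ?W = "U ** hermG i"
    have W: "invertible ?W" using U by (intro invertible_mult) simp_all
    have "vtx (?W ** atr (hermF i)) \<in> Sp 1 0 (vtx ?W)"
      using intg_hermF[OF i] det_hermF[OF i] val_unif_powi[of 1] by (intro Sp_10_intg[OF W]) simp_all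
    moreover have "?W ** atr (hermF i) = U" by (simp add: hermG_atr flip: matrix_mul_assoc)
    ultimately have "vtx U \<in> Sp 1 0 (vtx ?W)" by simp
    then show "vtx ?W \<in> Sp 0 1 (vtx U)" using Sp_sym_imp[OF vtx_in[OF W]] by simp
  qed
qed

lemma tri_1: "tri 1 = {(1, 0, 0), (0, 1, 0), (0, 0, 1)}"
  by (auto simp: tri_def add_is_1)

lemma sum_Sp_1:
  fixes w :: "int \<Rightarrow> real"
  assumes V: "V \<in> vertices abv"
  shows "(\<Sum>W\<in>Sp 1 0 V. w (hgt W - hgt V)) = rq\<^sup>2 * w 1 + rq * w 0 + w (-1)"
    and "(\<Sum>W\<in>Sp 0 1 V. w (hgt W - hgt V)) = rq\<^sup>2 * w 1 + rq * w 0 + w (-1)"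
proof -
  obtain k l m x y z where V': "V = vtx (ut k l m x y z)" using V by (rule vertices_utE)
  let ?U = "ut k l m x y z"
  have s: "(\<Sum>i\<in>idx 1. w (hdiff i)) = rq\<^sup>2 * w 1 + rq * w 0 + w (-1)"
    unfolding sum_idx tri_1 by (simp add: rq_def power2_eq_square)
  have "inj_on (\<lambda>i. vtx (?U ** hermF i)) (idx 1)"
    by (rule inj_onI, rule hermF_inj[of _ 1]) (simp_all add: vtx_left)
  then show "(\<Sum>W\<in>Sp 1 0 V. w (hgt W - hgt V)) = rq\<^sup>2 * w 1 + rq * w 0 + w (-1)"
    unfolding s[symmetric] V' Sp_1_eq[OF invertible_ut] by (simp add: sum.reindex hgt_hermF[OF refl])
  have "inj_on (\<lambda>i. vtx (?U ** hermG i)) (idx 1)"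
    by (rule inj_onI, rule hermG_inj[of _ 1]) (simp_all add: vtx_left)
  then show "(\<Sum>W\<in>Sp 0 1 V. w (hgt W - hgt V)) = rq\<^sup>2 * w 1 + rq * w 0 + w (-1)"
    unfolding s[symmetric] V' Sp_1_eq[OF invertible_ut] by (simp add: sum.reindex hgt_hermG[OF refl])
qed

section \<open>Adjacency in the 1-skeleton\<close>

lemma lat_strict:
  assumes A: "invertible A" and M: "intg M" "det M \<noteq> 0" "abv (det M) \<noteq> 1"
  shows "lat (A ** M) \<subset> lat A"
proof -
  have "lat (A ** M) \<subseteq> lat A" using lat_subset_iff[OF A] M by blast
  moreover have "lat A \<noteq> lat (A ** M)"
  proof
    assume e: "lat A = lat (A ** M)"
    have AM: "invertible (A ** M)" using A M by (intro invertible_mult) (simp_all add: invertible_det_nz)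
    obtain h where h: "h \<in> KK" "A ** M = A ** h" using lat_eqD[OF A AM e] by blast
    have "det A * det M = det A * det h" using arg_cong[OF h(2), of det] by (simp add: det_mul)
    then have "det M = det h" using A by (simp add: invertible_det_nz)
    then show False using M h by (simp add: KK_def)
  qed
  ultimately show ?thesis by auto
qed

lemma abv_det_dg_neq_1: "k + l + m \<noteq> 0 \<Longrightarrow> abv (det (dg k l m)) \<noteq> 1"
  using powi_unif_inj[of "k + l + m" 0] by (simp add: det_dg abv_powi)

text \<open>Normalized so that V carries the larger lattice; a chain that begins with W can be
  rotated into this form by multiplying its lattice with pi.\<close>

definition adjacent_lats :: "('a ^ 3) set set \<Rightarrow> ('a ^ 3) set set \<Rightarrow> bool" where
  "adjacent_lats V W \<longleftrightarrow> (\<exists>A B. invertible A \<and> invertible B \<and> V = vtx A \<and> W = vtx B \<and>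
     lat (mat \<pi> ** A) \<subset> lat B \<and> lat B \<subset> lat A)"

text \<open>Both inclusions are divisibilities by integral matrices, so the Smith exponents of the
  connecting matrix lie between 0 and 1. Strictness excludes (0, 0, 0) and (1, 1, 1).\<close>

lemma adjacent_lats_imp_Sp:
  assumes "adjacent_lats V W" shows "W \<in> Sp 1 0 V \<union> Sp 0 1 V"
proof -
  obtain A B where A: "invertible A" "V = vtx A" and B: "invertible B" "W = vtx B"
    and L: "lat (mat \<pi> ** A) \<subset> lat B" "lat B \<subset> lat A"
    using assms by (auto simp: adjacent_lats_def)
  obtain M where M: "intg M" "B = A ** M" using lat_subset_iff[OF A(1), of B] L by blast
  obtain N where N: "intg N" "mat \<pi> ** A = B ** N" using lat_subset_iff[OF B(1), of "mat \<pi> ** A"] L by blast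
  have iM: "invertible M" using A B by (simp add: M(2) invertible_det_nz det_mul)
  obtain g h k l m where gh: "g \<in> KK" "h \<in> KK" "m \<le> l" "l \<le> k" "g ** M ** h = dg k l m"
    using smith[OF iM] by blast
  obtain g' where g': "g' \<in> KK" "g' ** g = mat 1" using KK_inverse[OF gh(1)] by blast
  obtain h' where h': "h' \<in> KK" "h ** h' = mat 1" using KK_inverse[OF gh(2)] by blast
  have "B ** h = A ** (g' ** g) ** M ** h" by (simp add: g' M(2))
  also have "\<dots> = A ** g' ** (g ** M ** h)" by (simp only: matrix_mul_assoc)
  finally have Bh: "B ** h = A ** g' ** dg k l m" by (simp only: gh(5))
  have "intg (g ** M ** h)" using gh M by (intro intg_mult) (auto simp: KK_def)
  then have m: "0 \<le> m" unfolding gh(5) by (simp add: dg_def intg_mk9)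
  have Ag: "invertible (A ** g')" by (intro invertible_mult A KK_invertible g')
  obtain C where C: "C ** (A ** g') = mat 1" by (rule invertibleE[OF Ag])
  have "A ** g' ** mat \<pi> = mat \<pi> ** A ** g'"
    by (simp only: mat_mult_commute[of \<pi> "A ** g'", symmetric] matrix_mul_assoc)
  also have "\<dots> = B ** (h ** h') ** N ** g'" by (simp add: N(2) h')
  also have "\<dots> = B ** h ** (h' ** N ** g')" by (simp only: matrix_mul_assoc)
  also have "\<dots> = A ** g' ** (dg k l m ** (h' ** N ** g'))" unfolding Bh by (simp only: matrix_mul_assoc)
  finally have "C ** (A ** g') ** mat \<pi> = C ** (A ** g') ** (dg k l m ** (h' ** N ** g'))"
    by (simp only: flip: matrix_mul_assoc)
  then have P: "dg k l m ** (h' ** N ** g') = mat \<pi>" by (simp add: C)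
  have "dg (-k) (-l) (-m) ** mat \<pi> = dg (-k) (-l) (-m) ** dg k l m ** (h' ** N ** g')"
    unfolding P[symmetric] by (simp only: matrix_mul_assoc)
  then have "h' ** N ** g' = dg (-k) (-l) (-m) ** mat \<pi>" by (simp add: dg_mult dg_mat)
  moreover have "intg (h' ** N ** g')" using h' g' N by (intro intg_mult) (auto simp: KK_def)
  moreover have "dg (-k) (-l) (-m) ** mat \<pi> = dg (1-k) (1-l) (1-m)"
    using dg_mult[of "-k" "-l" "-m" 1 1 1] by (simp add: dg_mat)
  ultimately have "intg (dg (1-k) (1-l) (1-m))" by simp
  then have k: "k \<le> 1" by (simp add: dg_def intg_mk9)
  have latB: "lat B = lat (A ** g' ** dg k l m)" unfolding Bh[symmetric] by (simp add: lat_KK gh)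
  have "\<not> (k = 0 \<and> l = 0 \<and> m = 0)"
  proof
    assume "k = 0 \<and> l = 0 \<and> m = 0"
    then have "lat B = lat A" unfolding latB by (simp add: dg_mat lat_KK g')
    then show False using L by simp
  qed
  moreover have "\<not> (k = 1 \<and> l = 1 \<and> m = 1)"
  proof
    assume "k = 1 \<and> l = 1 \<and> m = 1"
    then have "dg k l m = mat \<pi>" by (simp add: dg_mat)
    then have "lat B = lat (mat \<pi> ** A ** g')"
      unfolding latB by (simp only: mat_mult_commute[of \<pi> "A ** g'", symmetric] matrix_mul_assoc)
    then have "lat B = lat (mat \<pi> ** A)" by (simp add: lat_KK g')
    then show False using L by simp
  qed
  ultimately have "k = 1 \<and> l = 0 \<and> m = 0 \<or> k = 1 \<and> l = 1 \<and> m = 0" using k m gh by linarith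
  then have "dg k l m = Dm 1 0 \<or> dg k l m = Dm 0 1" by (auto simp: Dm_def)
  moreover have "W = vtx (A ** g' ** dg k l m)" unfolding Bh[symmetric] by (simp add: vtx_KK gh B)
  moreover have "V = vtx (A ** g')" by (simp add: vtx_KK g' A)
  ultimately show ?thesis using SpI[OF Ag, of 1 0] SpI[OF Ag, of 0 1] by auto
qed

lemma Sp_imp_adjacent_lats:
  assumes "W \<in> Sp 1 0 V \<union> Sp 0 1 V" shows "adjacent_lats V W"
proof -
  obtain A a b where A: "invertible A" "V = vtx A" "W = vtx (A ** Dm a b)" and ab: "a = 1 \<and> b = 0 \<or> a = 0 \<and> b = 1"
    using assms by (auto simp: Sp_def)
  let ?B = "A ** Dm a b"
  have B: "invertible ?B" using A by (intro invertible_mult) simp_all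
  have "lat ?B \<subset> lat A"
  proof (rule lat_strict[OF A(1) intg_Dm])
    show "det (Dm a b) \<noteq> 0" by (simp add: Dm_def det_dg)
    show "abv (det (Dm a b)) \<noteq> 1" unfolding Dm_def by (rule abv_det_dg_neq_1) (use ab in auto)
  qed
  moreover have "lat (mat \<pi> ** A) \<subset> lat ?B"
  proof -
    let ?E = "dg (1 - int a - int b) (1 - int b) 1"
    have "Dm a b ** ?E = mat \<pi>" using dg_mat[of 1] by (simp add: Dm_def dg_mult)
    then have e: "?B ** ?E = mat \<pi> ** A" by (simp add: mat_mult_commute flip: matrix_mul_assoc)
    have "intg ?E" using ab abv_unif by (auto simp: dg_def intg_mk9)
    moreover have "det ?E \<noteq> 0" by (simp add: det_dg)
    moreover have "abv (det ?E) \<noteq> 1" by (rule abv_det_dg_neq_1) (use ab in auto)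
    ultimately show ?thesis using lat_strict[OF B, of ?E] unfolding e by blast
  qed
  ultimately show ?thesis using A B unfolding adjacent_lats_def by blast
qed

lemma neighbours_eq:
  assumes V: "V \<in> vertices abv"
  shows "neighbours abv \<pi> V = Sp 1 0 V \<union> Sp 0 1 V"
proof (intro equalityI subsetI)
  fix W assume "W \<in> Sp 1 0 V \<union> Sp 0 1 V"
  then have adj: "adjacent_lats V W" and "col W = (col V + 1) mod 3 \<or> col W = (col V + 2) mod 3"
    using Sp_imp_adjacent_lats col_Sp[OF V, of W 1 0] col_Sp[OF V, of W 0 1] by auto
  then have "col W \<noteq> col V" using col_range[OF V] by auto
  then have c: "W \<noteq> V" by blast
  obtain A B where A: "invertible A" "V = vtx A" and B: "invertible B" "W = vtx B"
    and L: "lat (mat \<pi> ** A) \<subset> lat B" "lat B \<subset> lat A"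
    using adj by (auto simp: adjacent_lats_def)
  have "{V, W} = homothety_class ` set [lat A, lat B]" using A B by (auto simp: vtx_def)
  then have "{V, W} \<in> cells abv \<pi>" unfolding cells_def
    using L A B by (auto simp: O_lattice_iff scale_set_lat intro!: exI[of _ "[lat A, lat B]"])
  then show "W \<in> neighbours abv \<pi> V" using c by (simp add: neighbours_def)
next
  fix W assume "W \<in> neighbours abv \<pi> V"
  then obtain Ls where WV: "W \<noteq> V" and Ls: "{V, W} = homothety_class ` set Ls" "Ls \<noteq> []"
    "\<forall>L\<in>set Ls. O_lattice abv L" "sorted_wrt (\<lambda>L M. M \<subset> L) Ls" "scale_set \<pi> (hd Ls) \<subset> last Ls"
    unfolding neighbours_def cells_def by auto
  obtain L M where LM: "L \<in> set Ls" "M \<in> set Ls" "V = homothety_class L" "W = homothety_class M"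
  proof -
    have "V \<in> homothety_class ` set Ls" "W \<in> homothety_class ` set Ls" unfolding Ls(1)[symmetric] by simp_all
    then show thesis using that by (elim imageE)
  qed
  obtain i where i: "i < length Ls" "L = Ls ! i" using LM(1) unfolding in_set_conv_nth by blast
  obtain j where j: "j < length Ls" "M = Ls ! j" using LM(2) unfolding in_set_conv_nth by blast
  note ij = i(1) j(1) i(2) j(2)
  have ord: "Ls ! j' \<subset> Ls ! i'" if "i' < j'" "j' < length Ls" for i' j'
    using Ls(4) that by (simp add: sorted_wrt_iff_nth_less)
  have hd: "X \<subseteq> hd Ls" "last Ls \<subseteq> X" if X: "X \<in> set Ls" for X
  proof -
    obtain p where p: "p < length Ls" "X = Ls ! p" using X unfolding in_set_conv_nth by blast
    show "X \<subseteq> hd Ls" using ord[of 0 p] p Ls(2) by (cases "p = 0") (auto simp: hd_conv_nth)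
    show "last Ls \<subseteq> X"
    proof (cases "p = length Ls - 1")
      case False
      then have "p < length Ls - 1" using p(1) by linarith
      then show ?thesis using ord[of p "length Ls - 1"] p Ls(2) by (simp add: last_conv_nth psubset_imp_subset)
    qed (use p Ls(2) in \<open>simp add: last_conv_nth\<close>)
  qed
  have sc: "scale_set \<pi> X \<subset> Y" if "X \<in> set Ls" "Y \<in> set Ls" for X Y
  proof -
    have "scale_set \<pi> X \<subseteq> scale_set \<pi> (hd Ls)" unfolding scale_set_def using hd(1)[OF that(1)] by (rule image_mono)
    then show ?thesis using Ls(5) hd(2)[OF that(2)] by blast
  qed
  obtain A where A: "invertible A" "L = lat A" using LM(1) Ls(3) O_lattice_iff by blast
  obtain B where B: "invertible B" "M = lat B" using LM(2) Ls(3) O_lattice_iff by blast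
  have VW: "V = vtx A" "W = vtx B" using LM A B by (simp_all add: vtx_def)
  have "i \<noteq> j" using WV LM ij by auto
  then consider "i < j" | "j < i" by linarith
  then have "adjacent_lats V W"
  proof cases
    case 1
    then have "lat B \<subset> lat A" using ord[of i j] ij A B by simp
    moreover have "lat (mat \<pi> ** A) \<subset> lat B" using sc[OF LM(1,2)] by (simp add: A B scale_set_lat)
    ultimately show ?thesis unfolding adjacent_lats_def using A B VW by blast
  next
    case 2
    \<comment> \<open>The rotation of the chain: pi M lies strictly between pi L and L.\<close>
    let ?B = "mat \<pi> ** B"
    have p: "lat A \<subset> lat B" using 2 ord[of j i] ij A B by simp
    have 1: "lat ?B \<subset> lat A" using sc[OF LM(2,1)] by (simp add: A B scale_set_lat)
    have "lat (mat \<pi> ** A) \<subset> lat ?B"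
    proof -
      have "inj ((*v) (mat \<pi>) :: 'a ^ 3 \<Rightarrow> 'a ^ 3)"
        by (rule injI) (simp add: mat_mult_vec vec_eq_iff)
      then show ?thesis using p unfolding lat_mult[of "mat \<pi>"] by (simp add: inj_image_subset_iff psubset_eq inj_image_eq_iff)
    qed
    moreover have "invertible ?B" using B by (intro invertible_mult) (simp_all add: invertible_mat3)
    moreover have "W = vtx ?B" by (simp add: VW vtx_scale)
    ultimately show ?thesis unfolding adjacent_lats_def using A 1 VW by blast
  qed
  then show "W \<in> Sp 1 0 V \<union> Sp 0 1 V" by (rule adjacent_lats_imp_Sp)
qed

lemma Sp_1_disjoint: "V \<in> vertices abv \<Longrightarrow> Sp 1 0 V \<inter> Sp 0 1 V = {}"
proof (rule equals0I)
  fix W assume V: "V \<in> vertices abv" and "W \<in> Sp 1 0 V \<inter> Sp 0 1 V"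
  then have "col W = (col V + 1) mod 3" "col W = (col V + 2) mod 3"
    using col_Sp[OF V, of W 1 0] col_Sp[OF V, of W 0 1] by simp_all
  then show False using col_range[OF V] by auto
qed

lemma sum_neighbours:
  fixes w :: "int \<Rightarrow> real"
  assumes V: "V \<in> vertices abv"
  shows "(\<Sum>W\<in>neighbours abv \<pi> V. w (hgt W - hgt V)) = 2 * (rq\<^sup>2 * w 1 + rq * w 0 + w (-1))"
  unfolding neighbours_eq[OF V]
  by (subst sum.union_disjoint) (simp_all only: finite_Sp[OF V] Sp_1_disjoint[OF V] sum_Sp_1[OF V] mult_2)

end

section \<open>Lattices act freely\<close>

context nonarch_local_field begin

section \<open>Vertex stabilizers, discreteness and torsion\<close>

definition mpow :: "'a ^ 3 ^ 3 \<Rightarrow> nat \<Rightarrow> 'a ^ 3 ^ 3" where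
  "mpow A k = ((\<lambda>X. X ** A) ^^ k) (mat 1)"

lemma mpow_0 [simp]: "mpow A 0 = mat 1" and mpow_Suc: "mpow A (Suc k) = mpow A k ** A"
  by (simp_all add: mpow_def)

lemma mpow_add: "mpow A (j + k) = mpow A j ** mpow A k"
  by (induction k) (simp_all add: mpow_Suc matrix_mul_assoc)

lemma mpow_KK: "h \<in> KK \<Longrightarrow> mpow h k \<in> KK"
  by (induction k) (simp_all add: mpow_Suc KK_mult)

lemma invertible_mpow: "invertible A \<Longrightarrow> invertible (mpow A k)"
  by (induction k) (simp_all add: mpow_Suc invertible_mult invertible_mat3)

lemma proj_pow: "invertible A \<Longrightarrow> proj A [^]\<^bsub>PGL3\<^esub> (k::nat) = proj (mpow A k)"
proof (induction k)
  case 0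
  then show ?case by (simp add: one_PGL3)
next
  case (Suc k)
  interpret group "PGL3 :: ('a ^ 3 ^ 3) set monoid" by (rule group_PGL3)
  show ?case using Suc by (simp add: mpow_Suc proj_mult invertible_mpow)
qed

lemma proj_scale: "c \<noteq> 0 \<Longrightarrow> proj (mat c ** A) = proj A"
proof -
  assume c: "c \<noteq> 0"
  have "\<exists>d. mat a ** (mat c ** A) = mat d ** A \<and> d \<noteq> 0" if "a \<noteq> 0" for a
    using that c by (intro exI[of _ "a * c"]) (simp add: matrix_mul_assoc mat_mult_mat)
  moreover have "\<exists>d. mat a ** A = mat d ** (mat c ** A) \<and> d \<noteq> 0" if "a \<noteq> 0" for a
    using that c by (intro exI[of _ "a / c"]) (simp add: matrix_mul_assoc mat_mult_mat)
  ultimately show ?thesis unfolding proj_eq by blast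
qed

lemma Metric_space_abv: "Metric_space UNIV (\<lambda>x y. abv (x - y))"
proof
  fix x y z :: 'a
  show "0 \<le> abv (x - y)" by (rule abv_nonneg)
  show "abv (x - y) = abv (y - x)" by (rule abv_minus_commute)
  show "abv (x - y) = 0 \<longleftrightarrow> x = y" by (simp add: abv_eq_0_iff)
  have "abv (x - z) \<le> max (abv (x - y)) (abv (y - z))" using abv_add[of "x - y" "y - z"] by simp
  also have "\<dots> \<le> abv (x - y) + abv (y - z)" using abv_nonneg by (simp add: max_def)
  finally show "abv (x - z) \<le> abv (x - y) + abv (y - z)" .
qed

lemma openin_field_topologyD:
  assumes "openin (field_topology abv) U" "x \<in> U"
  shows "\<exists>r>0. \<forall>y. abv (x - y) < r \<longrightarrow> y \<in> U"
proof -
  interpret Metric_space UNIV "\<lambda>x y. abv (x - y)" by (rule Metric_space_abv)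
  obtain r where "0 < r" "mball x r \<subseteq> U"
    using assms unfolding field_topology_def openin_mtopology by blast
  then show ?thesis by (auto simp: mball_def subset_eq)
qed

lemma openin_GL3_topologyD:
  assumes "openin (GL3_topology abv) U" "B \<in> U"
  shows "\<exists>r>0. \<forall>A. invertible A \<and> (\<forall>i j. abv (B $ i $ j - A $ i $ j) < r) \<longrightarrow> A \<in> U"
proof -
  let ?f = "\<lambda>A (i, j). A $ i $ j"
  obtain S where S: "openin (product_topology (\<lambda>_ :: 3 \<times> 3. field_topology abv) UNIV) S"
    "U = (?f -` S \<inter> UNIV) \<inter> carrier GL3"
    using assms(1) unfolding GL3_topology_def openin_subtopology openin_pullback_topology by auto
  have "?f B \<in> S" using assms(2) S(2) by auto
  then obtain X where X: "\<forall>i\<in>UNIV. openin (field_topology abv) (X i)" "?f B \<in> Pi\<^sub>E UNIV X" "Pi\<^sub>E UNIV X \<subseteq> S"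
    using S(1) unfolding openin_product_topology_alt by blast
  have "\<exists>r>0. \<forall>y. abv (?f B p - y) < r \<longrightarrow> y \<in> X p" for p
    using X(1) PiE_mem[OF X(2)] by (intro openin_field_topologyD) blast+
  then obtain r where r: "\<And>p. 0 < r p" "\<And>p y. abv (?f B p - y) < r p \<Longrightarrow> y \<in> X p" by metis
  have m: "0 < Min (range r)" using r(1) by (subst Min_gr_iff) auto
  have "A \<in> U" if A: "invertible A" "\<forall>i j. abv (B $ i $ j - A $ i $ j) < Min (range r)" for A
  proof -
    have "?f A p \<in> X p" for p
    proof (rule r(2))
      have "abv (?f B p - ?f A p) < Min (range r)" using A(2) by (cases p) simp
      also have "\<dots> \<le> r p" by (rule Min_le) auto
      finally show "abv (?f B p - ?f A p) < r p" .
    qed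
    then have "?f A \<in> S" using X(3) by (auto simp: PiE_UNIV_domain)
    then show ?thesis unfolding S(2) using A(1) by (auto simp: GL3_def)
  qed
  then show ?thesis using m by blast
qed

text \<open>Pulls discreteness in the quotient topology back to an entrywise neighbourhood of the
  identity matrix, where it can be met by estimates.\<close>

lemma discrete_neighbourhood:
  assumes G: "subgroup \<Gamma> PGL3" and disc: "subtopology (PGL3_topology abv) \<Gamma> = discrete_topology \<Gamma>"
  shows "\<exists>r>0. \<forall>A. invertible A \<and> (\<forall>i j. abv (mat 1 $ i $ j - A $ i $ j) < r) \<and> proj A \<in> \<Gamma>
    \<longrightarrow> proj A = \<one>\<^bsub>PGL3\<^esub>"
proof -
  have one: "\<one>\<^bsub>PGL3\<^esub> \<in> \<Gamma>" using G by (rule subgroup.one_closed)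
  then have "openin (subtopology (PGL3_topology abv) \<Gamma>) {\<one>\<^bsub>PGL3\<^esub>}" unfolding disc by simp
  then obtain U where U: "openin (PGL3_topology abv) U" "{\<one>\<^bsub>PGL3\<^esub>} = U \<inter> \<Gamma>"
    unfolding openin_subtopology by blast
  have U': "U \<subseteq> carrier PGL3" "openin (GL3_topology abv) (\<Union>U)"
    using U(1) unfolding PGL3_topology_def topology_inverse'[OF istopology_PGL3] by auto
  have "mat 1 \<in> \<Union>U"
    using U(2) one_PGL3 by (auto simp: proj_eq intro!: bexI[of _ "proj (mat 1)"] exI[of _ 1])
  from openin_GL3_topologyD[OF U'(2) this] obtain r where r: "0 < r"
    "\<And>A. invertible A \<Longrightarrow> \<forall>i j. abv (mat 1 $ i $ j - A $ i $ j) < r \<Longrightarrow> A \<in> \<Union>U" by blast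
  have "proj A = \<one>\<^bsub>PGL3\<^esub>"
    if A: "invertible A" "\<forall>i j. abv (mat 1 $ i $ j - A $ i $ j) < r" "proj A \<in> \<Gamma>" for A
  proof -
    obtain c where c: "c \<in> U" "A \<in> c" using r(2)[OF A(1,2)] by blast
    have "A \<in> proj A" by (auto simp: proj_eq intro!: exI[of _ 1])
    then have "c = proj A" using PGL3_coset_eq[of c "proj A" A] c U'(1) proj_in[OF A(1)] by blast
    then show ?thesis using U(2) A(3) c(1) by blast
  qed
  then show ?thesis using r(1) by blast
qed

lemma abv_matrix_mult_le:
  fixes A B :: "'a ^ 3 ^ 3"
  assumes "\<And>i j. abv (A $ i $ j) \<le> a" "\<And>i j. abv (B $ i $ j) \<le> b"
  shows "abv ((A ** B) $ i $ j) \<le> a * b"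
proof -
  have "0 \<le> a" using assms(1) abv_nonneg order_trans by blast
  then have "abv (A $ i $ k * B $ k $ j) \<le> a * b" for k
    unfolding abv_mult by (intro mult_mono assms abv_nonneg)
  then show ?thesis by (simp add: matrix_matrix_mult_def sum_3 abv_add_le)
qed

lemma matrix_mult_add_left: "(A + B) ** C = A ** C + B ** C" for A B C :: "'a ^ 3 ^ 3"
  by (simp add: matrix_matrix_mult_def vec_eq_iff sum.distrib distrib_right)

text \<open>Pigeonhole in \<open>GL\<^sub>3(\<O>/\<pi>\<^sup>m)\<close>.\<close>

lemma KK_power_near_1:
  assumes h: "h \<in> KK"
  shows "\<exists>k>0. \<exists>Z. intg Z \<and> mpow h k = mat 1 + mat (\<pi> ^ m) ** Z"
proof -
  have "\<exists>r\<in>Rep m. abv (mpow h k $ fst p $ snd p - r) \<le> abv \<pi> ^ m" for k p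
    using mpow_KK[OF h, of k] by (intro Rep_ex) (simp add: KK_def intg_def)
  then obtain r where r: "\<And>k p. r k p \<in> Rep m" "\<And>k p. abv (mpow h k $ fst p $ snd p - r k p) \<le> abv \<pi> ^ m" by metis
  have "range r \<subseteq> Pi\<^sub>E UNIV (\<lambda>_ :: 3 \<times> 3. Rep m)" using r(1) by (auto simp: PiE_UNIV_domain)
  then have "finite (range r)" by (rule finite_subset) (simp add: finite_PiE Rep_finite)
  then have "\<not> inj r" using finite_imageD infinite_UNIV_nat by blast
  then obtain i j where ij: "i < j" "r i = r j" unfolding inj_def by (metis linorder_neqE_nat)
  define k where "k = j - i"
  have k: "0 < k" "mpow h j = mpow h i ** mpow h k" using ij by (simp_all add: k_def flip: mpow_add)
  obtain g where g: "g \<in> KK" "g ** mpow h i = mat 1" using KK_inverse[OF mpow_KK[OF h]] by blast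
  define Z where "Z = (\<chi> a b. (mpow h j $ a $ b - mpow h i $ a $ b) / \<pi> ^ m)"
  have pm: "0 < abv (\<pi> ^ m)" by (rule abv_pos) simp
  have "abv (Z $ a $ b) \<le> 1" for a b
  proof -
    have 1: "abv (mpow h j $ a $ b - r j (a, b)) \<le> abv \<pi> ^ m" using r(2)[of j "(a, b)"] by simp
    have 2: "abv (mpow h i $ a $ b - r j (a, b)) \<le> abv \<pi> ^ m" using r(2)[of i "(a, b)"] ij(2) by simp
    from abv_diff_le[OF 1 2] show ?thesis using pm by (simp add: Z_def abv_divide abv_power)
  qed
  then have Z: "intg Z" by (simp add: intg_def)
  have "mpow h j = mpow h i + mat (\<pi> ^ m) ** Z"
    by (simp add: mat_mult_eq vec_eq_iff Z_def)
  then have "g ** (mpow h i ** mpow h k) = g ** mpow h i + g ** (mat (\<pi> ^ m) ** Z)"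
    unfolding k(2) by (simp add: matrix_add_ldistrib)
  moreover have "g ** (mpow h i ** mpow h k) = mpow h k"
    by (simp only: matrix_mul_assoc g(2) matrix_mul_lid)
  ultimately have "mpow h k = mat 1 + mat (\<pi> ^ m) ** (g ** Z)" by (simp only: mult_mat_left g(2))
  moreover have "intg (g ** Z)" using g Z by (intro intg_mult) (auto simp: KK_def)
  ultimately show ?thesis using k(1) by blast
qed

text \<open>Up to conjugation and scalars the stabilizer of a vertex is the compact group
  \<open>KK\<close>, so some power of \<open>\<gamma>\<close> is close to the identity. Discreteness
  makes this power trivial, and then torsion-freeness makes \<open>\<gamma>\<close> trivial.\<close>

lemma free_action:
  assumes G: "subgroup \<Gamma> PGL3" and disc: "subtopology (PGL3_topology abv) \<Gamma> = discrete_topology \<Gamma>"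
    and tf: "torsion_free \<Gamma>" and \<gamma>: "\<gamma> \<in> \<Gamma>" and V: "V \<in> vertices abv" and fx: "vertex_act \<gamma> V = V"
  shows "\<gamma> = \<one>\<^bsub>PGL3\<^esub>"
proof -
  obtain A where A: "invertible A" "\<gamma> = proj A"
    using subgroup.mem_carrier[OF G \<gamma>] by (auto simp: carrier_PGL3)
  obtain g where g: "invertible g" "V = vtx g" using V by (rule verticesE)
  obtain g' where g': "invertible g'" "g ** g' = mat 1" "g' ** g = mat 1" by (rule invertibleE[OF g(1)])
  have "vtx g = vtx (A ** g)" using fx by (simp add: A g vertex_act_proj)
  from vtx_eqD[OF g(1) invertible_mult[OF A(1) g(1)] this]
  obtain c h where c: "c \<noteq> 0" "h \<in> KK" "A ** g = mat c ** g ** h" by blast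
  \<comment> \<open>Up to a scalar \<open>\<gamma>\<close> is a conjugate of h, so its powers are
    conjugates of the powers of h.\<close>
  let ?B = "g ** h ** g'"
  have "A = A ** g ** g'" by (simp add: g' flip: matrix_mul_assoc)
  also have "\<dots> = mat c ** ?B" unfolding c(3) by (simp only: matrix_mul_assoc)
  finally have \<gamma>B: "\<gamma> = proj ?B" using A(2) proj_scale[OF c(1)] by simp
  have Bi: "invertible ?B" by (intro invertible_mult g g' KK_invertible c)
  have Bk: "mpow ?B k = g ** mpow h k ** g'" for k
  proof (induction k)
    case 0
    show ?case by (simp add: g')
  next
    case (Suc k)
    have "mpow ?B (Suc k) = g ** mpow h k ** (g' ** g) ** h ** g'" unfolding mpow_Suc Suc by (simp only: matrix_mul_assoc)
    then show ?case by (simp only: g' mpow_Suc matrix_mul_rid matrix_mul_assoc)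
  qed
  obtain r where r: "0 < r" "\<And>A. invertible A \<Longrightarrow> \<forall>i j. abv (mat 1 $ i $ j - A $ i $ j) < r \<Longrightarrow> proj A \<in> \<Gamma>
    \<Longrightarrow> proj A = \<one>\<^bsub>PGL3\<^esub>" using discrete_neighbourhood[OF G disc] by blast
  obtain p where p: "\<And>i j. abv (g $ i $ j) \<le> abv (g $ fst p $ snd p)"
    using ex_max_abv[of "\<lambda>p. g $ fst p $ snd p"] by (metis fst_conv snd_conv)
  obtain p' where p': "\<And>i j. abv (g' $ i $ j) \<le> abv (g' $ fst p' $ snd p')"
    using ex_max_abv[of "\<lambda>p. g' $ fst p $ snd p"] by (metis fst_conv snd_conv)
  define C where "C = abv (g $ fst p $ snd p) * abv (g' $ fst p' $ snd p')"
  have C: "0 \<le> C" by (simp add: C_def abv_nonneg)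
  \<comment> \<open>Conjugation by g enlarges entries by a factor of at most C; m is so large that
    h^k, congruent to 1 modulo pi^m, still ends up within r of the identity.\<close>
  obtain m where m: "abv \<pi> ^ m < r / (C + 1)"
    using real_arch_pow_inv[of "r / (C + 1)" "abv \<pi>"] abv_unif r(1) C by auto
  have mC: "abv \<pi> ^ m * C < r"
  proof -
    have "abv \<pi> ^ m * C \<le> abv \<pi> ^ m * (C + 1)" using abv_unif by (intro mult_left_mono) auto
    also have "\<dots> < r" using m C by (simp add: pos_less_divide_eq)
    finally show ?thesis .
  qed
  obtain k Z where k: "0 < k" "intg Z" "mpow h k = mat 1 + mat (\<pi> ^ m) ** Z"
    using KK_power_near_1[OF c(2)] by blast
  have "mpow ?B k = mat 1 + g ** (mat (\<pi> ^ m) ** Z) ** g'"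
    unfolding Bk k(3) by (simp add: matrix_add_ldistrib matrix_mult_add_left g')
  moreover have "abv ((g ** (mat (\<pi> ^ m) ** Z) ** g') $ i $ j) \<le>
      abv (g $ fst p $ snd p) * abv \<pi> ^ m * abv (g' $ fst p' $ snd p')" for i j
  proof (intro abv_matrix_mult_le p p')
    fix i j
    show "abv ((mat (\<pi> ^ m) ** Z) $ i $ j) \<le> abv \<pi> ^ m"
      using k(2) abv_unif by (simp add: mat_mult_eq abv_mult abv_power intg_def mult_left_le)
  qed
  moreover have "abv (g $ fst p $ snd p) * abv \<pi> ^ m * abv (g' $ fst p' $ snd p') < r"
    using mC by (simp add: C_def mult_ac)
  ultimately have near: "\<forall>i j. abv (mat 1 $ i $ j - mpow ?B k $ i $ j) < r"
    by (auto intro: le_less_trans)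
  have "\<gamma> [^]\<^bsub>PGL3\<^esub> k \<in> \<Gamma>"
  proof -
    interpret group "PGL3 :: ('a ^ 3 ^ 3) set monoid" by (rule group_PGL3)
    show ?thesis by (induction k) (simp_all add: subgroup.one_closed[OF G] subgroup.m_closed[OF G] \<gamma>)
  qed
  then have "proj (mpow ?B k) = \<one>\<^bsub>PGL3\<^esub>"
    using r(2)[OF invertible_mpow[OF Bi] near] by (simp add: \<gamma>B proj_pow[OF Bi])
  then have "\<gamma> [^]\<^bsub>PGL3\<^esub> k = \<one>\<^bsub>PGL3\<^esub>" by (simp add: \<gamma>B proj_pow[OF Bi])
  then show ?thesis using tf \<gamma> k(1) unfolding torsion_free_def by blast
qed

end

section \<open>Geometric operators on quotients\<close>

locale free_quotient = group G for G :: "('g, 'm) monoid_scheme" (structure) +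
  fixes act :: "'g \<Rightarrow> 'c \<Rightarrow> 'c" and \<Gamma> S :: "'g set" and C :: "'c set"
  assumes subgroup: "subgroup \<Gamma> G" and S: "S \<subseteq> carrier G"
    and act_closed: "g \<in> carrier G \<Longrightarrow> x \<in> C \<Longrightarrow> act g x \<in> C"
    and act_mult: "g \<in> carrier G \<Longrightarrow> h \<in> carrier G \<Longrightarrow> x \<in> C \<Longrightarrow> act (g \<otimes> h) x = act g (act h x)"
    and act_one: "x \<in> C \<Longrightarrow> act \<one> x = x"
    and free: "\<gamma> \<in> \<Gamma> \<Longrightarrow> x \<in> C \<Longrightarrow> act \<gamma> x = x \<Longrightarrow> \<gamma> = \<one>"
    and finite_quotient: "finite (quotient_set act \<Gamma> C)"
begin

abbreviation "Q \<equiv> quotient_set act \<Gamma> C"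
abbreviation "orb \<equiv> orbit act \<Gamma>"

lemma Gamma_carrier: "\<gamma> \<in> \<Gamma> \<Longrightarrow> \<gamma> \<in> carrier G"
  by (rule subgroup.mem_carrier[OF subgroup])

lemma act_inv: "g \<in> carrier G \<Longrightarrow> x \<in> C \<Longrightarrow> act (inv g) (act g x) = x"
  and act_inv': "g \<in> carrier G \<Longrightarrow> x \<in> C \<Longrightarrow> act g (act (inv g) x) = x"
  by (simp_all add: act_mult[symmetric] act_one)

lemma orb_in: "x \<in> C \<Longrightarrow> orb x \<in> Q"
  by (simp add: quotient_set_def)

lemma orb_self: "x \<in> C \<Longrightarrow> x \<in> orb x"
  unfolding orbit_def using act_one subgroup.one_closed[OF subgroup] by force

lemma orb_act: "\<gamma> \<in> \<Gamma> \<Longrightarrow> x \<in> C \<Longrightarrow> orb (act \<gamma> x) = orb x"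
proof (intro equalityI subsetI)
  assume g: "\<gamma> \<in> \<Gamma>" and x: "x \<in> C"
  fix y assume "y \<in> orb (act \<gamma> x)"
  then obtain \<delta> where "\<delta> \<in> \<Gamma>" "y = act \<delta> (act \<gamma> x)" by (auto simp: orbit_def)
  then have "y = act (\<delta> \<otimes> \<gamma>) x" "\<delta> \<otimes> \<gamma> \<in> \<Gamma>"
    using g x subgroup by (simp_all add: act_mult Gamma_carrier subgroup.m_closed)
  then show "y \<in> orb x" by (auto simp: orbit_def)
next
  assume g: "\<gamma> \<in> \<Gamma>" and x: "x \<in> C"
  fix y assume "y \<in> orb x"
  then obtain \<delta> where d: "\<delta> \<in> \<Gamma>" "y = act \<delta> x" by (auto simp: orbit_def)
  have "y = act (\<delta> \<otimes> inv \<gamma>) (act \<gamma> x)"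
    using d g x by (simp add: act_mult act_closed Gamma_carrier act_inv)
  moreover have "\<delta> \<otimes> inv \<gamma> \<in> \<Gamma>" using d g subgroup by (simp add: subgroup.m_closed subgroup.m_inv_closed)
  ultimately show "y \<in> orb (act \<gamma> x)" by (auto simp: orbit_def)
qed

lemma orb_eq_iff: "x \<in> C \<Longrightarrow> y \<in> C \<Longrightarrow> orb y = orb x \<longleftrightarrow> (\<exists>\<gamma>\<in>\<Gamma>. y = act \<gamma> x)"
proof
  assume "y \<in> C" "orb y = orb x"
  then have "y \<in> orb x" using orb_self by blast
  then show "\<exists>\<gamma>\<in>\<Gamma>. y = act \<gamma> x" by (auto simp: orbit_def)
qed (use orb_act in blast)

lemma Q_lift:
  assumes "x \<in> Q" shows "some_lift x \<in> C" "orb (some_lift x) = x"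
proof -
  obtain \<sigma> where \<sigma>: "\<sigma> \<in> C" "x = orb \<sigma>" using assms by (auto simp: quotient_set_def)
  have "some_lift x \<in> x" unfolding some_lift_def by (rule someI[of _ \<sigma>]) (simp add: \<sigma> orb_self)
  then obtain \<gamma> where g: "\<gamma> \<in> \<Gamma>" "some_lift x = act \<gamma> \<sigma>" by (auto simp: \<sigma> orbit_def)
  then show "some_lift x \<in> C" using \<sigma> by (simp add: act_closed Gamma_carrier)
  have "orb (some_lift x) = orb \<sigma>" unfolding g(2) by (rule orb_act[OF g(1) \<sigma>(1)])
  then show "orb (some_lift x) = x" by (simp only: \<sigma>(2))
qed

end

section \<open>Symmetric operators on the quotient\<close>

locale symmetric_geometric_operator = free_quotient +
  fixes T :: "'c \<Rightarrow> 'c set"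
  assumes geom: "geometric_operator act (carrier G) C T"
    and sym: "x \<in> C \<Longrightarrow> y \<in> C \<Longrightarrow> y \<in> T x \<longleftrightarrow> x \<in> T y"
begin

abbreviation "A \<equiv> quotient_adjacency act \<Gamma> C T"

lemma T_fin: "x \<in> C \<Longrightarrow> finite (T x)" and T_sub: "x \<in> C \<Longrightarrow> T x \<subseteq> C"
  and T_act: "g \<in> carrier G \<Longrightarrow> x \<in> C \<Longrightarrow> T (act g x) = act g ` T x"
  using geom by (auto simp: geometric_operator_def)

lemma act_inj_on: "g \<in> carrier G \<Longrightarrow> x \<in> C \<Longrightarrow> inj_on (act g) (T x)"
  by (rule inj_on_inverseI[where g = "act (inv g)"]) (use T_sub act_inv in auto)

lemma sum_T_act: "g \<in> carrier G \<Longrightarrow> x \<in> C \<Longrightarrow> (\<Sum>\<sigma>\<in>T (act g x). f \<sigma>) = (\<Sum>\<sigma>\<in>T x. f (act g \<sigma>))"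
  by (simp add: T_act sum.reindex[OF act_inj_on])

lemma A_orb:
  assumes x: "x \<in> C" shows "A f (orb x) = (\<Sum>\<sigma>\<in>T x. f (orb \<sigma>))"
proof -
  have l: "some_lift (orb x) \<in> C" "orb (some_lift (orb x)) = orb x" using Q_lift[OF orb_in[OF x]] .
  then obtain \<gamma> where g: "\<gamma> \<in> \<Gamma>" "some_lift (orb x) = act \<gamma> x" using orb_eq_iff[OF x l(1)] by blast
  have "A f (orb x) = (\<Sum>\<sigma>\<in>T (act \<gamma> x). f (orb \<sigma>))" using x by (simp add: quotient_adjacency_def orb_in g)
  also have "\<dots> = (\<Sum>\<sigma>\<in>T x. f (orb (act \<gamma> \<sigma>)))" by (rule sum_T_act[OF Gamma_carrier[OF g(1)] x])
  also have "\<dots> = (\<Sum>\<sigma>\<in>T x. f (orb \<sigma>))"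
    by (rule sum.cong[OF refl]) (use T_sub[OF x] orb_act[OF g(1)] in auto)
  finally show ?thesis .
qed

definition cnt :: "'c set \<Rightarrow> 'c set \<Rightarrow> nat" where
  "cnt x y = card {\<sigma> \<in> T (some_lift x). orb \<sigma> = y}"

text \<open>By freeness the points of an orbit correspond to the elements of
  \<open>\<Gamma>\<close>. This turns multiplicities into numbers of group elements.\<close>

lemma cnt_eq:
  assumes x: "x \<in> Q" and y: "y \<in> Q"
  shows "cnt x y = card {\<gamma> \<in> \<Gamma>. act \<gamma> (some_lift y) \<in> T (some_lift x)}"
proof -
  note l = Q_lift[OF x] Q_lift[OF y]
  have "bij_betw (\<lambda>\<gamma>. act \<gamma> (some_lift y)) {\<gamma> \<in> \<Gamma>. act \<gamma> (some_lift y) \<in> T (some_lift x)} {\<sigma> \<in> T (some_lift x). orb \<sigma> = y}"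
  proof (rule bij_betw_imageI)
    show "inj_on (\<lambda>\<gamma>. act \<gamma> (some_lift y)) {\<gamma> \<in> \<Gamma>. act \<gamma> (some_lift y) \<in> T (some_lift x)}"
    proof (rule inj_onI, clarify)
      fix \<gamma> \<delta> assume gd: "\<gamma> \<in> \<Gamma>" "\<delta> \<in> \<Gamma>" "act \<gamma> (some_lift y) = act \<delta> (some_lift y)"
      have "act (inv \<delta> \<otimes> \<gamma>) (some_lift y) = some_lift y"
        using gd l by (simp add: act_mult Gamma_carrier act_inv)
      then have "inv \<delta> \<otimes> \<gamma> = \<one>" using gd l subgroup
        by (intro free) (simp_all add: subgroup.m_closed subgroup.m_inv_closed)
      then show "\<gamma> = \<delta>" using gd by (metis Gamma_carrier inv_closed inv_inv inv_equality)
    qed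
    show "(\<lambda>\<gamma>. act \<gamma> (some_lift y)) ` {\<gamma> \<in> \<Gamma>. act \<gamma> (some_lift y) \<in> T (some_lift x)} = {\<sigma> \<in> T (some_lift x). orb \<sigma> = y}"
    proof (intro equalityI subsetI)
      fix \<sigma> assume "\<sigma> \<in> {\<sigma> \<in> T (some_lift x). orb \<sigma> = y}"
      then have s: "\<sigma> \<in> T (some_lift x)" "orb \<sigma> = orb (some_lift y)" "\<sigma> \<in> C" using l T_sub[OF l(1)] by auto
      then obtain \<gamma> where "\<gamma> \<in> \<Gamma>" "\<sigma> = act \<gamma> (some_lift y)" using orb_eq_iff[OF l(3) s(3)] by blast
      then show "\<sigma> \<in> (\<lambda>\<gamma>. act \<gamma> (some_lift y)) ` {\<gamma> \<in> \<Gamma>. act \<gamma> (some_lift y) \<in> T (some_lift x)}" using s by blast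
    qed (use l orb_act in auto)
  qed
  then show ?thesis unfolding cnt_def by (simp add: bij_betw_same_card)
qed

text \<open>Inversion in \<open>\<Gamma>\<close>, together with the symmetry of T, matches the group
  elements counted on both sides.\<close>

lemma cnt_sym: "x \<in> Q \<Longrightarrow> y \<in> Q \<Longrightarrow> cnt x y = cnt y x"
proof -
  have *: "inv \<gamma> \<in> {\<gamma> \<in> \<Gamma>. act \<gamma> (some_lift x) \<in> T (some_lift y)}"
    if x: "x \<in> Q" and y: "y \<in> Q" and g: "\<gamma> \<in> {\<gamma> \<in> \<Gamma>. act \<gamma> (some_lift y) \<in> T (some_lift x)}" for x y \<gamma>
  proof -
    note l = Q_lift[OF x] Q_lift[OF y]
    have g': "\<gamma> \<in> \<Gamma>" "\<gamma> \<in> carrier G" "act \<gamma> (some_lift y) \<in> T (some_lift x)" using g Gamma_carrier by auto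
    then have "some_lift x \<in> T (act \<gamma> (some_lift y))" using sym[of "some_lift x" "act \<gamma> (some_lift y)"] l act_closed by blast
    then have "act (inv \<gamma>) (some_lift x) \<in> T (act (inv \<gamma>) (act \<gamma> (some_lift y)))"
      using g' l act_closed by (simp add: T_act)
    then show ?thesis using g' l subgroup by (simp add: act_inv subgroup.m_inv_closed)
  qed
  assume x: "x \<in> Q" and y: "y \<in> Q"
  have "bij_betw (\<lambda>\<gamma>. inv \<gamma>) {\<gamma> \<in> \<Gamma>. act \<gamma> (some_lift y) \<in> T (some_lift x)} {\<gamma> \<in> \<Gamma>. act \<gamma> (some_lift x) \<in> T (some_lift y)}"
    by (rule bij_betwI[where g = "\<lambda>\<gamma>. inv \<gamma>"]) (use *[OF x y] *[OF y x] Gamma_carrier in auto)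
  then show ?thesis unfolding cnt_eq[OF x y] cnt_eq[OF y x] by (rule bij_betw_same_card)
qed

lemma A_cnt:
  assumes x: "x \<in> Q" shows "A f x = (\<Sum>y\<in>Q. of_nat (cnt x y) * f y)"
proof -
  note l = Q_lift[OF x]
  have "A f x = (\<Sum>\<sigma>\<in>T (some_lift x). f (orb \<sigma>))" using x by (simp add: quotient_adjacency_def)
  also have "\<dots> = (\<Sum>y\<in>Q. \<Sum>\<sigma> | \<sigma> \<in> T (some_lift x) \<and> orb \<sigma> = y. f (orb \<sigma>))"
    by (rule sum.group[symmetric]) (use T_fin[OF l(1)] T_sub[OF l(1)] finite_quotient orb_in in auto)
  also have "\<dots> = (\<Sum>y\<in>Q. of_nat (cnt x y) * f y)" by (rule sum.cong) (auto simp: cnt_def)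
  finally show ?thesis .
qed

lemma sum_cnt: "x \<in> Q \<Longrightarrow> (\<Sum>y\<in>Q. cnt x y) = card (T (some_lift x))"
proof -
  assume x: "x \<in> Q"
  note l = Q_lift[OF x]
  have "(\<Sum>y\<in>Q. cnt x y) = (\<Sum>y\<in>Q. \<Sum>\<sigma> | \<sigma> \<in> T (some_lift x) \<and> orb \<sigma> = y. 1)" by (simp add: cnt_def)
  also have "\<dots> = (\<Sum>\<sigma>\<in>T (some_lift x). 1)"
    by (rule sum.group) (use T_fin[OF l(1)] T_sub[OF l(1)] finite_quotient orb_in in auto)
  finally show ?thesis by simp
qed

text \<open>Symmetry of \<open>cnt\<close> for arbitrary lifts, obtained by applying the operator to
  an indicator function. It later lets the walk on the quotient be read backwards.\<close>

lemma card_T_orb: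
  assumes x: "x \<in> C" and y: "y \<in> C"
  shows "card {\<sigma> \<in> T x. orb \<sigma> = orb y} = card {\<sigma> \<in> T y. orb \<sigma> = orb x}"
proof -
  have *: "of_nat (card {\<sigma> \<in> T x. orb \<sigma> = orb y}) = (of_nat (cnt (orb x) (orb y)) :: complex)" if x: "x \<in> C" and y: "y \<in> C" for x y
  proof -
    have "of_nat (card {\<sigma> \<in> T x. orb \<sigma> = orb y}) = (\<Sum>\<sigma>\<in>T x. if orb \<sigma> = orb y then 1 else 0 :: complex)"
      using T_fin[OF x] by (simp add: sum.If_cases Int_def)
    also have "\<dots> = A (\<lambda>z. if z = orb y then 1 else 0) (orb x)" by (rule A_orb[OF x, symmetric])
    also have "\<dots> = of_nat (cnt (orb x) (orb y))"
      using finite_quotient orb_in[OF y]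
      by (simp add: A_cnt[OF orb_in[OF x]] if_distrib[of "\<lambda>u. _ * u"] sum.delta cong: if_cong)
    finally show ?thesis .
  qed
  have "of_nat (card {\<sigma> \<in> T x. orb \<sigma> = orb y}) = (of_nat (card {\<sigma> \<in> T y. orb \<sigma> = orb x}) :: complex)"
    unfolding *[OF x y] *[OF y x] cnt_sym[OF orb_in[OF x] orb_in[OF y]] ..
  then show ?thesis by (simp only: of_nat_eq_iff)
qed

text \<open>By symmetry the columns of the matrix \<open>cnt\<close> have the sum d of its
  rows.\<close>

lemma A_l1:
  assumes d: "\<And>x. x \<in> C \<Longrightarrow> card (T x) = d"
  shows "(\<Sum>x\<in>Q. cmod (A f x)) \<le> real d * (\<Sum>y\<in>Q. cmod (f y))"
proof -
  have "(\<Sum>x\<in>Q. cmod (A f x)) \<le> (\<Sum>x\<in>Q. \<Sum>y\<in>Q. real (cnt x y) * cmod (f y))"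
  proof (rule sum_mono)
    fix x assume "x \<in> Q"
    from norm_sum[of "\<lambda>y. of_nat (cnt x y) * f y" Q]
    show "cmod (A f x) \<le> (\<Sum>y\<in>Q. real (cnt x y) * cmod (f y))"
      unfolding A_cnt[OF \<open>x \<in> Q\<close>] by (simp add: norm_mult)
  qed
  also have "\<dots> = (\<Sum>y\<in>Q. \<Sum>x\<in>Q. real (cnt x y) * cmod (f y))" by (rule sum.swap)
  also have "\<dots> = (\<Sum>y\<in>Q. real d * cmod (f y))"
  proof (rule sum.cong[OF refl])
    fix y assume y: "y \<in> Q"
    have "(\<Sum>x\<in>Q. real (cnt x y) * cmod (f y)) = real (\<Sum>x\<in>Q. cnt y x) * cmod (f y)"
      by (simp add: sum_distrib_right cnt_sym[OF _ y])
    then show "(\<Sum>x\<in>Q. real (cnt x y) * cmod (f y)) = real d * cmod (f y)"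
      using d[OF Q_lift(1)[OF y]] by (simp only: sum_cnt[OF y])
  qed
  finally show ?thesis by (simp add: sum_distrib_left)
qed

lemma A_sum:
  assumes d: "\<And>x. x \<in> C \<Longrightarrow> card (T x) = d"
  shows "(\<Sum>x\<in>Q. A f x) = of_nat d * (\<Sum>y\<in>Q. f y)"
proof -
  have "(\<Sum>x\<in>Q. A f x) = (\<Sum>x\<in>Q. \<Sum>y\<in>Q. of_nat (cnt x y) * f y)" by (rule sum.cong[OF refl A_cnt])
  also have "\<dots> = (\<Sum>y\<in>Q. \<Sum>x\<in>Q. of_nat (cnt x y) * f y)" by (rule sum.swap)
  also have "\<dots> = (\<Sum>y\<in>Q. of_nat d * f y)"
  proof (rule sum.cong[OF refl])
    fix y assume y: "y \<in> Q"
    have "(\<Sum>x\<in>Q. of_nat (cnt x y) * f y) = of_nat (\<Sum>x\<in>Q. cnt y x) * f y"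
      by (simp add: sum_distrib_right cnt_sym[OF _ y])
    then show "(\<Sum>x\<in>Q. of_nat (cnt x y) * f y) = of_nat d * f y"
      using d[OF Q_lift(1)[OF y]] by (simp only: sum_cnt[OF y])
  qed
  finally show ?thesis by (simp add: sum_distrib_left)
qed

lemma A_supp: "x \<notin> Q \<Longrightarrow> A f x = 0"
  by (simp add: quotient_adjacency_def)

lemma A_self_adjoint: "(\<Sum>x\<in>Q. A f x * cnj (g x)) = (\<Sum>x\<in>Q. f x * cnj (A g x))"
proof -
  have "(\<Sum>x\<in>Q. A f x * cnj (g x)) = (\<Sum>x\<in>Q. \<Sum>y\<in>Q. of_nat (cnt x y) * f y * cnj (g x))"
    by (rule sum.cong) (simp_all add: A_cnt sum_distrib_right)
  also have "\<dots> = (\<Sum>y\<in>Q. \<Sum>x\<in>Q. of_nat (cnt x y) * f y * cnj (g x))" by (rule sum.swap)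
  also have "\<dots> = (\<Sum>y\<in>Q. f y * cnj (A g y))"
    by (rule sum.cong) (simp_all add: A_cnt sum_distrib_left cnt_sym mult_ac)
  finally show ?thesis .
qed

lemma l2_space_Q: "f \<in> l2_space Q \<longleftrightarrow> (\<forall>x. x \<notin> Q \<longrightarrow> f x = 0)"
  using finite_quotient by (simp add: l2_space_def)

lemma nontrivial_iff: "f \<in> l2_nontrivial act S \<Gamma> C \<longleftrightarrow> (\<forall>x. x \<notin> Q \<longrightarrow> f x = 0) \<and>
    (\<forall>h. (\<forall>x. x \<notin> Q \<longrightarrow> h x = 0) \<longrightarrow> trivial_function act S \<Gamma> C h \<longrightarrow> (\<Sum>x\<in>Q. f x * cnj (h x)) = 0)"
  using l2_inner_finite[OF finite_quotient, of f] unfolding l2_nontrivial_def by (auto simp: l2_space_Q)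

lemma A_trivial:
  assumes "trivial_function act S \<Gamma> C h" shows "trivial_function act S \<Gamma> C (A h)"
  unfolding trivial_function_def
proof (intro ballI)
  fix s \<sigma> assume s: "s \<in> S" and x: "\<sigma> \<in> C"
  have sG: "s \<in> carrier G" using s S by blast
  have "A h (orb (act s \<sigma>)) = (\<Sum>\<tau>\<in>T \<sigma>. h (orb (act s \<tau>)))"
    unfolding A_orb[OF act_closed[OF sG x]] by (rule sum_T_act[OF sG x])
  also have "\<dots> = (\<Sum>\<tau>\<in>T \<sigma>. h (orb \<tau>))"
    by (rule sum.cong[OF refl]) (use assms s T_sub[OF x] in \<open>auto simp: trivial_function_def\<close>)
  finally show "A h (orb (act s \<sigma>)) = A h (orb \<sigma>)" by (simp only: A_orb[OF x])
qed

text \<open>A maps trivial functions to trivial functions and is self-adjoint, so it preserves their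
  orthogonal complement, where its norm is controlled by its spectrum.\<close>

lemma norm_bound:
  assumes spec: "op_spectrum (l2_nontrivial act S \<Gamma> C) A \<subseteq> {z. cmod z \<le> \<rho>}" and \<rho>: "0 \<le> \<rho>"
    and f: "f \<in> l2_nontrivial act S \<Gamma> C"
  shows "l2_norm (A f) \<le> \<rho> * l2_norm f"
proof (rule selfadjoint_norm_le_spectrum[OF finite_quotient _ _ _ _ _ _ spec \<rho> f])
  let ?H = "l2_nontrivial act S \<Gamma> C"
  show "f x = 0" if "f \<in> ?H" "x \<notin> Q" for f x using that by (simp add: nontrivial_iff)
  show "(\<lambda>x. f x + a * g x) \<in> ?H" if "f \<in> ?H" "g \<in> ?H" for f g a
    using that by (auto simp: nontrivial_iff distrib_right sum.distrib mult.assoc simp flip: sum_distrib_left)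
  show "A f \<in> ?H" if "f \<in> ?H" for f
    using that A_trivial by (auto simp: nontrivial_iff A_supp A_self_adjoint)
  show "A (\<lambda>x. f x + a * g x) = (\<lambda>x. A f x + a * A g x)" for f g a
    by (rule ext) (simp add: quotient_adjacency_def sum.distrib sum_distrib_left)
  show "(\<Sum>x\<in>Q. A f x * cnj (g x)) = (\<Sum>x\<in>Q. f x * cnj (A g x))" for f g by (rule A_self_adjoint)
  \<comment> \<open>A crude bound suffices: it makes the supremum of the Rayleigh quotients finite,
    and its size does not enter the conclusion.\<close>
  show "l2_norm (A f) \<le> (\<Sum>x\<in>Q. real (card (T (some_lift x)))) * l2_norm f" if "f \<in> ?H" for f
  proof -
    have fl: "f \<in> l2_space Q" using that by (simp add: l2_nontrivial_def)
    have "l2_norm (A f) = L2_set (\<lambda>x. cmod (A f x)) Q" by (rule l2_norm_finite[OF finite_quotient A_supp])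
    also have "\<dots> \<le> (\<Sum>x\<in>Q. cmod (A f x))" by (rule L2_set_le_sum) simp
    also have "\<dots> \<le> (\<Sum>x\<in>Q. real (card (T (some_lift x))) * l2_norm f)"
    proof (rule sum_mono)
      fix x assume "x \<in> Q"
      then have "cmod (A f x) \<le> (\<Sum>\<sigma>\<in>T (some_lift x). cmod (f (orb \<sigma>)))"
        by (simp add: quotient_adjacency_def norm_sum)
      also have "\<dots> \<le> (\<Sum>\<sigma>\<in>T (some_lift x). l2_norm f)" by (intro sum_mono cmod_le_l2_norm[OF fl])
      finally show "cmod (A f x) \<le> real (card (T (some_lift x))) * l2_norm f" by simp
    qed
    finally show ?thesis by (simp add: sum_distrib_right)
  qed
qed

end

section \<open>Random walk on the building\<close>

context nonarch_local_field begin

section \<open>Invariance and symmetrization of spheres\<close>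

abbreviation "PG \<equiv> (PGL3 :: ('a ^ 3 ^ 3) set monoid)"
abbreviation "VV \<equiv> vertices abv"
abbreviation "nbr \<equiv> neighbours abv \<pi>"
abbreviation "srw \<equiv> building_srw abv \<pi>"

lemma vertex_act_in: "g \<in> carrier PG \<Longrightarrow> V \<in> VV \<Longrightarrow> vertex_act g V \<in> VV"
  by (auto simp: carrier_PGL3 elim!: verticesE) (auto simp: vertex_act_proj intro!: vtx_in invertible_mult)

lemma vertex_act_mult: "g \<in> carrier PG \<Longrightarrow> h \<in> carrier PG \<Longrightarrow> V \<in> VV \<Longrightarrow>
    vertex_act (g \<otimes>\<^bsub>PG\<^esub> h) V = vertex_act g (vertex_act h V)"
  by (auto simp: carrier_PGL3 elim!: verticesE) (auto simp: vertex_act_proj proj_mult matrix_mul_assoc)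

lemma vertex_act_one: "V \<in> VV \<Longrightarrow> vertex_act \<one>\<^bsub>PG\<^esub> V = V"
  by (auto simp: one_PGL3 vertex_act_proj elim!: verticesE)

lemma vertex_act_inv: "g \<in> carrier PG \<Longrightarrow> V \<in> VV \<Longrightarrow> vertex_act (inv\<^bsub>PG\<^esub> g) (vertex_act g V) = V"
  and vertex_act_inv': "g \<in> carrier PG \<Longrightarrow> V \<in> VV \<Longrightarrow> vertex_act g (vertex_act (inv\<^bsub>PG\<^esub> g) V) = V"
proof -
  interpret group PG by (rule group_PGL3)
  show "g \<in> carrier PG \<Longrightarrow> V \<in> VV \<Longrightarrow> vertex_act (inv\<^bsub>PG\<^esub> g) (vertex_act g V) = V"
    "g \<in> carrier PG \<Longrightarrow> V \<in> VV \<Longrightarrow> vertex_act g (vertex_act (inv\<^bsub>PG\<^esub> g) V) = V"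
    by (simp_all add: vertex_act_mult[symmetric] vertex_act_one)
qed

lemma inv_PG: "g \<in> carrier PG \<Longrightarrow> inv\<^bsub>PG\<^esub> g \<in> carrier PG"
  using group.inv_closed[OF group_PGL3] .

lemma inj_vertex_act: "g \<in> carrier PG \<Longrightarrow> inj_on (vertex_act g) VV"
  by (rule inj_on_inverseI[where g = "vertex_act (inv\<^bsub>PG\<^esub> g)"]) (rule vertex_act_inv)

lemma vertices_transitive:
  assumes "V \<in> VV" "W \<in> VV" shows "\<exists>g\<in>carrier PG. vertex_act g V = W"
proof -
  obtain A where A: "invertible A" "V = vtx A" using assms(1) by (rule verticesE)
  obtain B where B: "invertible B" "W = vtx B" using assms(2) by (rule verticesE)
  obtain A' where A': "invertible A'" "A ** A' = mat 1" "A' ** A = mat 1" by (rule invertibleE[OF A(1)])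
  have "B ** A' ** A = B" by (simp add: A' flip: matrix_mul_assoc)
  then have "vertex_act (proj (B ** A')) V = W" by (simp add: A B vertex_act_proj)
  then show ?thesis using proj_in[OF invertible_mult[OF B(1) A'(1)]] by blast
qed

lemma Sp_subset: "Sp a b V \<subseteq> VV" using Sp_in by blast

lemma Sp_act_carrier: "g \<in> carrier PG \<Longrightarrow> W \<in> Sp a b V \<Longrightarrow> vertex_act g W \<in> Sp a b (vertex_act g V)"
  by (auto simp: carrier_PGL3 intro: Sp_act)

lemma Sp_act_iff:
  assumes g: "g \<in> carrier PG" and V: "V \<in> VV" and W: "W \<in> VV"
  shows "vertex_act g W \<in> Sp a b (vertex_act g V) \<longleftrightarrow> W \<in> Sp a b V"
  using Sp_act_carrier[OF g, of W a b V] Sp_act_carrier[OF inv_PG[OF g], of "vertex_act g W" a b "vertex_act g V"]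
  by (auto simp: vertex_act_inv g V W)

lemma Sp_act_image:
  assumes g: "g \<in> carrier PG" and V: "V \<in> VV"
  shows "Sp a b (vertex_act g V) = vertex_act g ` Sp a b V"
proof (intro equalityI subsetI)
  fix W assume W: "W \<in> Sp a b (vertex_act g V)"
  then have "W \<in> VV" by (rule Sp_in)
  then have e: "W = vertex_act g (vertex_act (inv\<^bsub>PG\<^esub> g) W)" "vertex_act (inv\<^bsub>PG\<^esub> g) W \<in> VV"
    by (simp_all add: vertex_act_inv' g vertex_act_in inv_PG)
  then have "vertex_act (inv\<^bsub>PG\<^esub> g) W \<in> Sp a b V" using W Sp_act_iff[OF g V e(2)] by simp
  then show "W \<in> vertex_act g ` Sp a b V" using e(1) by blast
qed (use Sp_act_carrier[OF g] in blast)

text \<open>The operator of the sphere (a, b) has that of (b, a) as its transpose by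
  \<open>Sp_sym\<close>; their union is symmetric.\<close>

definition Tp :: "nat \<times> nat \<Rightarrow> ('a ^ 3) set set \<Rightarrow> ('a ^ 3) set set set" where
  "Tp p V = Sp (fst p) (snd p) V \<union> Sp (snd p) (fst p) V"

lemma Tp_subset: "Tp p V \<subseteq> VV" using Sp_subset by (auto simp: Tp_def)

lemma Tp_sym: "V \<in> VV \<Longrightarrow> W \<in> VV \<Longrightarrow> W \<in> Tp p V \<longleftrightarrow> V \<in> Tp p W"
  using Sp_sym[of V W] by (auto simp: Tp_def)

lemma Tp_act_image: "g \<in> carrier PG \<Longrightarrow> V \<in> VV \<Longrightarrow> Tp p (vertex_act g V) = vertex_act g ` Tp p V"
  by (simp add: Tp_def Sp_act_image image_Un)

lemma finite_Tp: "V \<in> VV \<Longrightarrow> finite (Tp p V)" by (simp add: Tp_def finite_Sp)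

lemma card_Tp_act: "g \<in> carrier PG \<Longrightarrow> V \<in> VV \<Longrightarrow> card (Tp p (vertex_act g V)) = card (Tp p V)"
  unfolding Tp_act_image by (intro card_image inj_on_subset[OF inj_vertex_act Tp_subset])

lemma card_Tp_eq: "V \<in> VV \<Longrightarrow> W \<in> VV \<Longrightarrow> card (Tp p V) = card (Tp p W)"
  using vertices_transitive[of V W] card_Tp_act by metis

text \<open>The stabilizer of V is transitive on each sphere around V, so spheres that meet
  coincide; transitivity on vertices carries the equality to every centre.\<close>

lemma Sp_eq_if_meet:
  assumes V: "V \<in> VV" and W: "W \<in> Sp a b V" "W \<in> Sp a' b' V" and U: "U \<in> VV"
  shows "Sp a b U = Sp a' b' U"
proof -
  have *: "Sp a b V \<subseteq> Sp a' b' V" if w: "W \<in> Sp a b V" "W \<in> Sp a' b' V" for a b a' b'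
  proof
    fix W' assume "W' \<in> Sp a b V"
    then obtain g where g: "invertible g" "vertex_act (proj g) V = V" "vertex_act (proj g) W = W'"
      using Sp_transitive[OF w(1)] by blast
    then show "W' \<in> Sp a' b' V" using Sp_act[OF g(1) w(2)] by simp
  qed
  have e: "Sp a b V = Sp a' b' V" using *[OF W] *[OF W(2,1)] by blast
  obtain g where g: "g \<in> carrier PG" "vertex_act g V = U" using vertices_transitive[OF V U] by blast
  show ?thesis using Sp_act_image[OF g(1) V, of a b] Sp_act_image[OF g(1) V, of a' b'] e g(2) by simp
qed

lemma Sp_swap_eq:
  assumes V: "V \<in> VV" and e: "\<And>U. U \<in> VV \<Longrightarrow> Sp a b U = Sp a' b' U"
  shows "Sp b a V = Sp b' a' V"
  using e Sp_sym[OF V] Sp_subset by blast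

lemma Tp_eq_if_meet:
  assumes V: "V \<in> VV" and W: "W \<in> Tp p V" "W \<in> Tp p' V" and U: "U \<in> VV"
  shows "Tp p U = Tp p' U"
proof -
  obtain a b a' b' where p: "p = (a, b)" "p' = (a', b')" by (cases p; cases p') auto
  have *: "Sp a b U = Sp a' b' U \<and> Sp b a U = Sp b' a' U" if "W \<in> Sp a b V" "W \<in> Sp a' b' V" for a b a' b'
    using Sp_eq_if_meet[OF V that] Sp_swap_eq[OF U] U by blast
  consider "W \<in> Sp a b V" "W \<in> Sp a' b' V" | "W \<in> Sp a b V" "W \<in> Sp b' a' V"
    | "W \<in> Sp b a V" "W \<in> Sp a' b' V" | "W \<in> Sp b a V" "W \<in> Sp b' a' V"
    using W by (auto simp: Tp_def p)
  then show ?thesis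
  proof cases
    case 1 show ?thesis using *[OF 1] by (auto simp: Tp_def p)
  next
    case 2 show ?thesis using *[OF 2] by (auto simp: Tp_def p)
  next
    case 3 show ?thesis using *[OF 3] by (auto simp: Tp_def p)
  next
    case 4 show ?thesis using *[OF 4] by (auto simp: Tp_def p)
  qed
qed

text \<open>Any admissible pair serves: by \<open>Tp_eq_if_meet\<close> all of them define the same
  class \<open>Tp\<close>.\<close>

definition pos :: "('a ^ 3) set set \<Rightarrow> ('a ^ 3) set set \<Rightarrow> nat \<times> nat" where
  "pos V W = (SOME p. W \<in> Sp (fst p) (snd p) V)"

lemma pos: "V \<in> VV \<Longrightarrow> W \<in> VV \<Longrightarrow> W \<in> Sp (fst (pos V W)) (snd (pos V W)) V"
  unfolding pos_def by (rule someI_ex) (use cartan in force)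

lemma Tp_pos: "V \<in> VV \<Longrightarrow> W \<in> VV \<Longrightarrow> W \<in> Tp (pos V W) V"
  using pos by (simp add: Tp_def)

section \<open>The walk, its symmetry and its mixture decomposition\<close>

lemma finite_nbr: "V \<in> VV \<Longrightarrow> finite (nbr V)"
  by (simp add: neighbours_eq finite_Sp)

lemma nbr_subset: "V \<in> VV \<Longrightarrow> nbr V \<subseteq> VV"
  using Sp_subset by (simp add: neighbours_eq)

definition deg :: real where "deg = 2 * (rq\<^sup>2 + rq + 1)"

lemma deg_pos: "0 < deg"
  using rq_ge_2 by (simp add: deg_def add_pos_pos)

lemma card_nbr: "V \<in> VV \<Longrightarrow> real (card (nbr V)) = deg"
  using sum_neighbours[of V "\<lambda>_. 1"] by (simp add: deg_def)

lemma card_Sp_1: "V \<in> VV \<Longrightarrow> real (card (Sp 1 0 V)) = deg / 2" "V \<in> VV \<Longrightarrow> real (card (Sp 0 1 V)) = deg / 2"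
  using sum_Sp_1[of V "\<lambda>_. 1"] by (simp_all add: deg_def)

lemma nbr_nonempty: "V \<in> VV \<Longrightarrow> nbr V \<noteq> {}"
  using card_nbr[of V] deg_pos by auto

lemma nbr_Tp: "V \<in> VV \<Longrightarrow> nbr V = Tp (1, 0) V"
  by (auto simp: neighbours_eq Tp_def)

lemma nbr_sym: "V \<in> VV \<Longrightarrow> W \<in> VV \<Longrightarrow> W \<in> nbr V \<longleftrightarrow> V \<in> nbr W"
  using Tp_sym by (simp add: nbr_Tp)

lemma set_srw: "V \<in> VV \<Longrightarrow> set_pmf (srw V t) \<subseteq> VV \<and> finite (set_pmf (srw V t))"
proof (induction t)
  case (Suc t)
  then have IH: "set_pmf (srw V t) \<subseteq> VV" "finite (set_pmf (srw V t))" by auto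
  have "set_pmf (srw V (Suc t)) = (\<Union>U\<in>set_pmf (srw V t). nbr U)"
    using IH nbr_nonempty finite_nbr by (auto simp: set_bind_pmf set_pmf_of_set subset_eq)
  then show ?case using IH nbr_subset finite_nbr by (auto simp: subset_eq)
qed simp

abbreviation EE :: "('a ^ 3) set set \<Rightarrow> nat \<Rightarrow> (('a ^ 3) set set \<Rightarrow> real) \<Rightarrow> real" where
  "EE V t f \<equiv> measure_pmf.expectation (srw V t) f"

lemma EE_eq: "V \<in> VV \<Longrightarrow> EE V t f = (\<Sum>W\<in>set_pmf (srw V t). pmf (srw V t) W * f W)"
  using set_srw[of V t] by (subst integral_measure_pmf_real[of "set_pmf (srw V t)"]) (auto simp: mult.commute)

lemma EE_cong: "V \<in> VV \<Longrightarrow> (\<And>W. W \<in> VV \<Longrightarrow> f W = g W) \<Longrightarrow> EE V t f = EE V t g"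
  using set_srw[of V t] by (simp add: EE_eq) (intro sum.cong, auto)

lemma EE_mono: "V \<in> VV \<Longrightarrow> (\<And>W. W \<in> VV \<Longrightarrow> f W \<le> g W) \<Longrightarrow> EE V t f \<le> EE V t g"
  using set_srw[of V t] by (simp add: EE_eq) (intro sum_mono mult_left_mono, auto)

lemma EE_linear: "V \<in> VV \<Longrightarrow> EE V t (\<lambda>W. a * f W + b) = a * EE V t f + b"
proof -
  assume V: "V \<in> VV"
  have "(\<Sum>W\<in>set_pmf (srw V t). pmf (srw V t) W) = 1" using set_srw[OF V] by (intro sum_pmf_eq_1) auto
  then show ?thesis using V
    by (simp add: EE_eq distrib_left sum.distrib sum_distrib_left mult.left_commute flip: sum_distrib_right)
qed

lemma EE_Suc:
  assumes V: "V \<in> VV"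
  shows "EE V (Suc t) f = EE V t (\<lambda>U. (\<Sum>W\<in>nbr U. f W) / deg)"
proof -
  note s = set_srw[OF V, of t]
  have "EE V (Suc t) f = (\<Sum>U\<in>set_pmf (srw V t). pmf (srw V t) U *\<^sub>R measure_pmf.expectation (pmf_of_set (nbr U)) f)"
    unfolding building_srw.simps
    by (rule pmf_expectation_bind) (use s finite_nbr nbr_nonempty in \<open>auto simp: set_pmf_of_set subset_eq\<close>)
  also have "\<dots> = (\<Sum>U\<in>set_pmf (srw V t). pmf (srw V t) U * ((\<Sum>W\<in>nbr U. f W) / deg))"
  proof (rule sum.cong[OF refl])
    fix U assume "U \<in> set_pmf (srw V t)"
    then have "U \<in> VV" using s by auto
    then show "pmf (srw V t) U *\<^sub>R measure_pmf.expectation (pmf_of_set (nbr U)) f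
      = pmf (srw V t) U * ((\<Sum>W\<in>nbr U. f W) / deg)"
      by (simp add: integral_pmf_of_set nbr_nonempty finite_nbr card_nbr)
  qed
  finally show ?thesis by (simp only: EE_eq[OF V, of t])
qed

lemma pmf_srw_EE: "pmf (srw V t) W = EE V t (\<lambda>U. if U = W then 1 else 0)"
  by (subst integral_measure_pmf_real[of "{W}"]) (auto split: if_splits)

lemma pmf_srw_Suc:
  assumes V: "V \<in> VV" and W: "W \<in> VV"
  shows "pmf (srw V (Suc t)) W = (\<Sum>U\<in>nbr W. pmf (srw V t) U) / deg"
proof -
  have "pmf (srw V (Suc t)) W = EE V t (\<lambda>U. (if W \<in> nbr U then 1 else 0) / deg)"
    unfolding pmf_srw_EE EE_Suc[OF V] by (rule EE_cong[OF V]) (simp add: finite_nbr)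
  also have "\<dots> = EE V t (\<lambda>U. (if U \<in> nbr W then 1 else 0) / deg)"
    by (rule EE_cong[OF V]) (simp add: nbr_sym[OF _ W])
  also have "\<dots> = (\<Sum>U\<in>nbr W. pmf (srw V t) U) / deg"
    by (subst integral_measure_pmf_real[of "nbr W"]) (auto simp: finite_nbr W sum_divide_distrib split: if_splits)
  finally show ?thesis .
qed

lemma srw_Suc_left: "srw V (Suc t) = bind_pmf (pmf_of_set (nbr V)) (\<lambda>U. srw U t)"
proof (induction t)
  case 0
  show ?case by (simp add: bind_return_pmf bind_return_pmf')
next
  case (Suc t)
  show ?case by (subst building_srw.simps(2), subst Suc) (simp add: bind_assoc_pmf)
qed

lemma pmf_srw_Suc_left:
  assumes V: "V \<in> VV"
  shows "pmf (srw V (Suc t)) W = (\<Sum>U\<in>nbr V. pmf (srw U t) W) / deg"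
  unfolding srw_Suc_left pmf_bind
  by (simp add: integral_pmf_of_set nbr_nonempty finite_nbr card_nbr V)

text \<open>Reversibility, by comparing the decompositions at the last and at the first step; the
  graph is undirected and regular.\<close>

lemma pmf_srw_sym: "V \<in> VV \<Longrightarrow> W \<in> VV \<Longrightarrow> pmf (srw V t) W = pmf (srw W t) V"
proof (induction t arbitrary: V W)
  case 0
  show ?case by (simp add: indicator_def)
next
  case (Suc t)
  have "(\<Sum>U\<in>nbr W. pmf (srw V t) U) = (\<Sum>U\<in>nbr W. pmf (srw U t) V)"
    by (rule sum.cong) (use Suc nbr_subset in auto)
  then show ?case using Suc.prems by (simp only: pmf_srw_Suc[of V W] pmf_srw_Suc_left[of W])
qed

text \<open>Equivariance of the walk, inherited step by step from that of the neighbourhoods; it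
  makes transition probabilities depend only on the relative position.\<close>

lemma srw_act: "g \<in> carrier PG \<Longrightarrow> V \<in> VV \<Longrightarrow> srw (vertex_act g V) t = map_pmf (vertex_act g) (srw V t)"
proof (induction t)
  case (Suc t)
  have "pmf_of_set (nbr (vertex_act g U)) = map_pmf (vertex_act g) (pmf_of_set (nbr U))" if U: "U \<in> VV" for U
    using Suc.prems U inj_on_subset[OF inj_vertex_act[OF Suc.prems(1)] nbr_subset[OF U]]
      nbr_nonempty[OF U] finite_nbr[OF U]
    by (subst map_pmf_of_set_inj) (simp_all add: nbr_Tp vertex_act_in Tp_act_image)
  then show ?case using Suc set_srw[OF Suc.prems(2), of t]
    by (auto simp: map_bind_pmf bind_map_pmf subset_eq intro!: bind_pmf_cong)
qed simp

lemma pmf_srw_act: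
  assumes g: "g \<in> carrier PG" and V: "V \<in> VV" and W: "W \<in> VV"
  shows "pmf (srw (vertex_act g V) t) (vertex_act g W) = pmf (srw V t) W"
proof (cases "W \<in> set_pmf (srw V t)")
  case True
  then show ?thesis unfolding srw_act[OF g V]
    using set_srw[OF V, of t] inj_on_subset[OF inj_vertex_act[OF g]] by (intro pmf_map_inj) auto
next
  case False
  then have "vertex_act g W \<notin> set_pmf (srw (vertex_act g V) t)"
    unfolding srw_act[OF g V] using set_srw[OF V, of t] inj_vertex_act[OF g] W by (auto dest: inj_onD)
  then show ?thesis using False by (simp add: set_pmf_iff)
qed

lemma pmf_srw_Sp:
  assumes "V \<in> VV" "V' \<in> VV" "W \<in> Sp a b V" "W' \<in> Sp a b V'"
  shows "pmf (srw V t) W = pmf (srw V' t) W'"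
proof -
  obtain g where g: "invertible g" "vertex_act (proj g) V = V'" "vertex_act (proj g) W = W'"
    using Sp_transitive[OF assms(3,4)] by blast
  then show ?thesis using pmf_srw_act[OF proj_in[OF g(1)] assms(1) Sp_in[OF assms(3)], of t] by simp
qed

text \<open>Within one sphere this is transitivity; points of opposite spheres are compared by
  reversing the walk.\<close>

lemma pmf_srw_Tp:
  assumes V: "V \<in> VV" "V' \<in> VV" and W: "W \<in> Tp p V" "W' \<in> Tp p V'"
  shows "pmf (srw V t) W = pmf (srw V' t) W'"
proof -
  obtain a b where p: "p = (a, b)" by (cases p)
  have *: "pmf (srw V t) W = pmf (srw V' t) W'" if V: "V \<in> VV" "V' \<in> VV" and "W \<in> Sp a b V" "W' \<in> Sp b a V'" for V V' W W' a b
  proof -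
    have "V' \<in> Sp a b W'" "W' \<in> VV" using Sp_sym_imp that Sp_in by blast+
    then show ?thesis using pmf_srw_Sp[OF V(1) _ that(3), of W' V' t] pmf_srw_sym[OF V(2)] by simp
  qed
  show ?thesis using W *[OF V] pmf_srw_Sp[OF V] by (auto simp: Tp_def p)
qed

text \<open>
  The law of the walk from \<open>V\<close> is a mixture of uniform distributions on the classes \<open>Tp p V\<close>, whose weights do
  not depend on \<open>V\<close>; they are read off from the walk from a fixed vertex \<open>\<zeta>\<close>.
\<close>

lemma EE_mixture:
  assumes Z: "\<zeta> \<in> VV" and V: "V \<in> VV"
  shows "EE V t f = EE \<zeta> t (\<lambda>W. (\<Sum>W'\<in>Tp (pos \<zeta> W) V. f W') / real (card (Tp (pos \<zeta> W) V)))"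
proof -
  let ?B = "set_pmf (srw \<zeta> t)" and ?C = "set_pmf (srw V t)"
  have B: "finite ?B" "?B \<subseteq> VV" and C: "finite ?C" "?C \<subseteq> VV" using set_srw[OF Z] set_srw[OF V] by auto
  let ?T = "\<lambda>W. Tp (pos \<zeta> W) V"
  have TC: "?T W \<subseteq> ?C" if W: "W \<in> ?B" for W
  proof
    fix W' assume W': "W' \<in> ?T W"
    have "pmf (srw \<zeta> t) W = pmf (srw V t) W'"
      by (rule pmf_srw_Tp[OF Z V Tp_pos[OF Z] W']) (use W B in auto)
    then show "W' \<in> ?C" using W by (simp add: set_pmf_iff)
  qed
  have "EE \<zeta> t (\<lambda>W. (\<Sum>W'\<in>?T W. f W') / real (card (?T W)))
     = (\<Sum>W\<in>?B. \<Sum>W' | W' \<in> ?C \<and> W' \<in> ?T W. pmf (srw \<zeta> t) W * f W' / real (card (?T W)))"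
    unfolding EE_eq[OF Z]
  proof (rule sum.cong[OF refl])
    fix W assume "W \<in> ?B"
    then have "{W'. W' \<in> ?C \<and> W' \<in> ?T W} = ?T W" using TC by blast
    then show "pmf (srw \<zeta> t) W * ((\<Sum>W'\<in>?T W. f W') / real (card (?T W)))
      = (\<Sum>W' | W' \<in> ?C \<and> W' \<in> ?T W. pmf (srw \<zeta> t) W * f W' / real (card (?T W)))"
      by (simp add: sum_distrib_left sum_divide_distrib)
  qed
  also have "\<dots> = (\<Sum>W'\<in>?C. \<Sum>W | W \<in> ?B \<and> W' \<in> ?T W. pmf (srw \<zeta> t) W * f W' / real (card (?T W)))"
    by (rule sum.swap_restrict[OF B(1) C(1)])
  also have "\<dots> = (\<Sum>W'\<in>?C. pmf (srw V t) W' * f W')"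
  proof (rule sum.cong[OF refl])
    fix W' assume W'C: "W' \<in> ?C"
    then have W': "W' \<in> VV" using C by auto
    let ?p = "pos V W'"
    have m: "W' \<in> Tp ?p V" by (rule Tp_pos[OF V W'])
    \<comment> \<open>The W whose class contains W' form the class \<open>Tp ?p \<zeta>\<close>. All
      of them carry the mass of W', and their number cancels the denominator.\<close>
    have same: "W \<in> ?B \<and> W' \<in> ?T W \<longleftrightarrow> W \<in> Tp ?p \<zeta>" for W
    proof
      assume W: "W \<in> ?B \<and> W' \<in> ?T W"
      then have "Tp (pos \<zeta> W) \<zeta> = Tp ?p \<zeta>" using Tp_eq_if_meet[OF V _ m Z] by blast
      then show "W \<in> Tp ?p \<zeta>" using Tp_pos[OF Z, of W] W B by blast
    next
      assume W: "W \<in> Tp ?p \<zeta>"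
      then have WV: "W \<in> VV" using Tp_subset by blast
      have "pmf (srw \<zeta> t) W = pmf (srw V t) W'" by (rule pmf_srw_Tp[OF Z V W m])
      then have "W \<in> ?B" using W'C by (simp add: set_pmf_iff)
      moreover have "?T W = Tp ?p V" by (rule Tp_eq_if_meet[OF Z Tp_pos[OF Z WV] W V])
      ultimately show "W \<in> ?B \<and> W' \<in> ?T W" using m by simp
    qed
    have val: "pmf (srw \<zeta> t) W = pmf (srw V t) W' \<and> card (?T W) = card (Tp ?p \<zeta>)" if W: "W \<in> Tp ?p \<zeta>" for W
    proof -
      have WV: "W \<in> VV" using W Tp_subset by blast
      have "?T W = Tp ?p V" by (rule Tp_eq_if_meet[OF Z Tp_pos[OF Z WV] W V])
      then show ?thesis using pmf_srw_Tp[OF Z V W m] card_Tp_eq[OF V Z] by simp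
    qed
    have ne: "card (Tp ?p \<zeta>) \<noteq> 0"
      using card_Tp_eq[OF Z V, of ?p] m finite_Tp[OF V, of ?p] by auto
    have "(\<Sum>W | W \<in> ?B \<and> W' \<in> ?T W. pmf (srw \<zeta> t) W * f W' / real (card (?T W)))
      = (\<Sum>W\<in>Tp ?p \<zeta>. pmf (srw V t) W' * f W' / real (card (Tp ?p \<zeta>)))"
      unfolding same by (rule sum.cong) (use val in auto)
    also have "\<dots> = pmf (srw V t) W' * f W'" using ne by simp
    finally show "(\<Sum>W | W \<in> ?B \<and> W' \<in> ?T W. pmf (srw \<zeta> t) W * f W' / real (card (?T W))) = pmf (srw V t) W' * f W'" .
  qed
  finally show ?thesis by (simp add: EE_eq V)
qed

section \<open>Increments of height and colour\<close>

definition drift :: real where "drift = (rq\<^sup>2 - 1) / (rq\<^sup>2 + rq + 1)"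

text \<open>After subtracting \<open>drift\<close> the increments are centred, so the cross term
  vanishes in each step and their variances, at most 1, add up.\<close>

lemma hgt_second_moment:
  assumes V: "V \<in> VV"
  shows "EE V t (\<lambda>W. (real_of_int (hgt W - hgt V) - drift * real t)\<^sup>2) \<le> real t"
proof (induction t)
  case 0
  show ?case by (simp add: EE_eq[OF V])
next
  case (Suc t)
  let ?x = "\<lambda>U. real_of_int (hgt U - hgt V) - drift * real t"
  have D: "0 < rq\<^sup>2 + rq + 1" using rq_ge_2 by (simp add: add_pos_pos)
  have dr: "drift * (rq\<^sup>2 + rq + 1) = rq\<^sup>2 - 1" using D by (simp add: drift_def)
  have step: "(\<Sum>W\<in>nbr U. (real_of_int (hgt W - hgt V) - drift * real (Suc t))\<^sup>2) / deg \<le> 1 * (?x U)\<^sup>2 + 1" if U: "U \<in> VV" for U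
  proof -
    define x where "x = ?x U"
    have "(\<Sum>W\<in>nbr U. (real_of_int (hgt W - hgt V) - drift * real (Suc t))\<^sup>2)
       = (\<Sum>W\<in>nbr U. (\<lambda>j. (x + real_of_int j - drift)\<^sup>2) (hgt W - hgt U))"
      by (rule sum.cong[OF refl]) (simp add: x_def algebra_simps)
    also have "\<dots> = 2 * (rq\<^sup>2 * (x + 1 - drift)\<^sup>2 + rq * (x - drift)\<^sup>2 + (x - 1 - drift)\<^sup>2)"
      unfolding sum_neighbours[OF U, of "\<lambda>j. (x + real_of_int j - drift)\<^sup>2"] by simp
    \<comment> \<open>The coefficient of 2 x is, up to the factor q^2 + q + 1, the mean increment
      minus \<open>drift\<close>; it vanishes by \<open>dr\<close>.\<close>
    also have "\<dots> = 2 * ((rq\<^sup>2 + rq + 1) * x\<^sup>2 + 2 * x * (rq\<^sup>2 - 1 - drift * (rq\<^sup>2 + rq + 1))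
        + (rq\<^sup>2 + 1) - 2 * drift * (rq\<^sup>2 - 1) + drift * (drift * (rq\<^sup>2 + rq + 1)))"
      by (simp add: power2_eq_square algebra_simps)
    also have "\<dots> = 2 * ((rq\<^sup>2 + rq + 1) * x\<^sup>2 + (rq\<^sup>2 + 1) - drift * (rq\<^sup>2 - 1))"
      unfolding dr by (simp add: algebra_simps)
    also have "\<dots> \<le> 2 * ((rq\<^sup>2 + rq + 1) * x\<^sup>2 + (rq\<^sup>2 + rq + 1))"
    proof -
      have "0 \<le> rq\<^sup>2 - 1" using rq_ge_2 by (simp add: one_le_power)
      then have "0 \<le> drift * (rq\<^sup>2 - 1)" using D by (simp add: drift_def)
      then show ?thesis using rq_ge_2 by simp
    qed
    also have "\<dots> = deg * (x\<^sup>2 + 1)" by (simp add: deg_def algebra_simps)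
    finally show ?thesis using deg_pos by (simp add: x_def pos_divide_le_eq mult.commute)
  qed
  have "EE V (Suc t) (\<lambda>W. (real_of_int (hgt W - hgt V) - drift * real (Suc t))\<^sup>2) \<le> EE V t (\<lambda>U. 1 * (?x U)\<^sup>2 + 1)"
    unfolding EE_Suc[OF V] by (rule EE_mono[OF V step])
  also have "\<dots> \<le> real t + 1" unfolding EE_linear[OF V] using Suc by simp
  finally show ?case by simp
qed

text \<open>Half of the neighbours have each of the two other colours. The colour thus performs a
  walk on a triangle, with nontrivial eigenvalue -1/2, the rate in
  \<open>col_equidistribution\<close>.\<close>

lemma col_nbr_count:
  assumes U: "U \<in> VV" and c: "c \<in> {0, 1, 2}"
  shows "(\<Sum>W\<in>nbr U. if col W = c then 1 else 0) / deg = (- 1 / 2) * (if col U = c then 1 else 0) + 1 / (2::real)"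
proof -
  have 1: "(\<Sum>W\<in>Sp 1 0 U. if col W = c then 1 else 0) = (if (col U + 1) mod 3 = c then deg / 2 else 0)"
  proof -
    have "(\<Sum>W\<in>Sp 1 0 U. if col W = c then 1 else 0) = (\<Sum>W\<in>Sp 1 0 U. if (col U + 1) mod 3 = c then 1 else (0::real))"
      by (rule sum.cong) (use col_Sp[OF U, of _ 1 0] in auto)
    then show ?thesis by (simp add: card_Sp_1[OF U, simplified])
  qed
  have 2: "(\<Sum>W\<in>Sp 0 1 U. if col W = c then 1 else 0) = (if (col U + 2) mod 3 = c then deg / 2 else 0)"
  proof -
    have "(\<Sum>W\<in>Sp 0 1 U. if col W = c then 1 else 0) = (\<Sum>W\<in>Sp 0 1 U. if (col U + 2) mod 3 = c then 1 else (0::real))"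
      by (rule sum.cong) (use col_Sp[OF U, of _ 0 1] in auto)
    then show ?thesis by (simp add: card_Sp_1[OF U, simplified])
  qed
  have "(\<Sum>W\<in>nbr U. if col W = c then 1 else 0) =
     (if (col U + 1) mod 3 = c then deg / 2 else 0) + (if (col U + 2) mod 3 = c then deg / 2 else 0)"
    unfolding neighbours_eq[OF U] 1[symmetric] 2[symmetric]
    by (rule sum.union_disjoint) (simp_all only: finite_Sp[OF U] Sp_1_disjoint[OF U])
  then show ?thesis using col_range[OF U] c deg_pos by (auto split: if_splits)
qed

lemma col_equidistribution:
  assumes V: "V \<in> VV" and c: "c \<in> {0, 1, 2}"
  shows "\<bar>EE V t (\<lambda>W. if col W = c then 1 else 0) - 1 / 3\<bar> \<le> (1 / 2) ^ t"
proof (induction t)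
  case 0
  show ?case by (simp add: EE_eq[OF V])
next
  case (Suc t)
  have "EE V (Suc t) (\<lambda>W. if col W = c then 1 else 0) = EE V t (\<lambda>U. (- 1 / 2) * (if col U = c then 1 else 0) + 1 / 2)"
    unfolding EE_Suc[OF V] by (rule EE_cong[OF V col_nbr_count[OF _ c]])
  also have "\<dots> = (- 1 / 2) * EE V t (\<lambda>W. if col W = c then 1 else 0) + 1 / 2" by (rule EE_linear[OF V])
  finally have "EE V (Suc t) (\<lambda>W. if col W = c then 1 else 0) - 1 / 3
      = - ((EE V t (\<lambda>W. if col W = c then 1 else 0) - 1 / 3) / 2)" by (simp add: field_simps)
  then have "\<bar>EE V (Suc t) (\<lambda>W. if col W = c then 1 else 0) - 1 / 3\<bar>
      = \<bar>EE V t (\<lambda>W. if col W = c then 1 else 0) - 1 / 3\<bar> / 2" by (simp only: abs_minus_cancel abs_divide abs_numeral)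
  then show ?case using Suc by simp
qed

end

section \<open>Random walk on a Ramanujan complex\<close>

locale ramanujan_walk = nonarch_local_field abv \<pi> for abv :: "'a::field \<Rightarrow> real" and \<pi> +
  fixes \<Gamma> :: "('a ^ 3 ^ 3) set set"
  assumes ramanujan: "ramanujan_complex abv \<pi> \<Gamma>"
    and finite_X: "finite (quotient_vertices abv \<Gamma>)"
begin

text \<open>Vertices as 0-cells, the form in which the Ramanujan condition speaks about
  them.\<close>

definition CC :: "('a ^ 3) set set set set" where "CC = (\<lambda>V. {V}) ` VV"

definition orbc :: "('a ^ 3) set set \<Rightarrow> ('a ^ 3) set set set set" where
  "orbc V = orbit cell_act \<Gamma> {V}"

definition Tc :: "nat \<times> nat \<Rightarrow> ('a ^ 3) set set set \<Rightarrow> ('a ^ 3) set set set set" where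
  "Tc p \<sigma> = (\<lambda>V. {V}) ` Tp p (the_elem \<sigma>)"

lemma lattice_facts: "subgroup \<Gamma> PG" "subtopology (PGL3_topology abv) \<Gamma> = discrete_topology \<Gamma>" "torsion_free \<Gamma>"
  using ramanujan by (simp_all add: ramanujan_complex_def PGL3_lattice_def)

lemma orbc_eq: "orbc V = (\<lambda>V. {V}) ` orbit vertex_act \<Gamma> V"
  by (simp add: orbc_def orbit_def cell_act_def image_image)

lemma quotient_CC: "quotient_set cell_act \<Gamma> CC = (`) (\<lambda>V. {V}) ` quotient_vertices abv \<Gamma>"
  by (simp add: quotient_set_def CC_def image_image quotient_vertices_def orbc_eq[unfolded orbc_def])

lemma singleton_image_inj: "inj ((`) (\<lambda>V. {V}))"
  by (rule inj_image_eq_iff[THEN iffD1, THEN injI, rotated]) (auto intro: injI)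

lemma PSL3_subset: "PSL3 \<subseteq> carrier PG"
  by (auto simp: PSL3_eq carrier_PGL3 invertible_det_nz)

lemma cell_act_closed: "g \<in> carrier PG \<Longrightarrow> \<sigma> \<in> CC \<Longrightarrow> cell_act g \<sigma> \<in> CC"
  by (auto simp: CC_def cell_act_def vertex_act_in)

lemma cell_act_mult: "g \<in> carrier PG \<Longrightarrow> h \<in> carrier PG \<Longrightarrow> \<sigma> \<in> CC \<Longrightarrow>
    cell_act (g \<otimes>\<^bsub>PG\<^esub> h) \<sigma> = cell_act g (cell_act h \<sigma>)"
  by (auto simp: CC_def cell_act_def vertex_act_mult)

lemma cell_act_one: "\<sigma> \<in> CC \<Longrightarrow> cell_act \<one>\<^bsub>PG\<^esub> \<sigma> = \<sigma>"
  by (auto simp: CC_def cell_act_def vertex_act_one)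

lemma cell_act_free: "\<gamma> \<in> \<Gamma> \<Longrightarrow> \<sigma> \<in> CC \<Longrightarrow> cell_act \<gamma> \<sigma> = \<sigma> \<Longrightarrow> \<gamma> = \<one>\<^bsub>PG\<^esub>"
  unfolding CC_def cell_act_def by (elim imageE, rule free_action[OF lattice_facts]) simp_all

lemma finite_quotient_CC: "finite (quotient_set cell_act \<Gamma> CC)"
  unfolding quotient_CC using finite_X by simp

sublocale cellq: free_quotient PG cell_act \<Gamma> PSL3 CC
  by (intro free_quotient.intro free_quotient_axioms.intro group_PGL3 lattice_facts PSL3_subset
      cell_act_closed cell_act_mult cell_act_one cell_act_free finite_quotient_CC)

abbreviation "QQ \<equiv> quotient_set cell_act \<Gamma> CC"

lemma CC_I: "V \<in> VV \<Longrightarrow> {V} \<in> CC" by (simp add: CC_def)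

lemma inj_sing: "inj_on (\<lambda>V. {V}) A" by (simp add: inj_on_def)

lemma geometric_Tc: "geometric_operator cell_act (carrier PG) CC (Tc p)"
  unfolding geometric_operator_def
  by (auto simp: CC_def Tc_def cell_act_def Tp_act_image image_image finite_Tp dest: Tp_subset[THEN subsetD])

sublocale top: symmetric_geometric_operator PG cell_act \<Gamma> PSL3 CC "Tc p" for p
proof
  show "geometric_operator cell_act (carrier PG) CC (Tc p)" by (rule geometric_Tc)
  show "y \<in> Tc p x \<longleftrightarrow> x \<in> Tc p y" if "x \<in> CC" "y \<in> CC" for x y
    using that Tp_sym[of _ _ p] by (auto simp: CC_def Tc_def)
qed

text \<open>The factor 2 accounts for the two opposite spheres in \<open>Tp\<close>.\<close>

definition rad :: "nat \<times> nat \<Rightarrow> real" where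
  "rad p = 2 * ((real (fst p) + 1)\<^sup>2 * (real (snd p) + 1)\<^sup>2 * rq ^ (fst p + snd p))"

lemma rad_nonneg: "0 \<le> rad p"
  using rq_ge_2 by (simp add: rad_def)

lemma sum_wt_Tp: assumes V: "V \<in> VV" shows "(\<Sum>W\<in>Tp p V. wt W) \<le> rad p * wt V"
proof -
  have "(\<Sum>W\<in>Tp p V. wt W) \<le> (\<Sum>W\<in>Sp (fst p) (snd p) V. wt W) + (\<Sum>W\<in>Sp (snd p) (fst p) V. wt W)"
    unfolding Tp_def using sum.union_inter[OF finite_Sp[OF V] finite_Sp[OF V], of wt "fst p" "snd p" "snd p" "fst p"]
      sum_nonneg[of "Sp (fst p) (snd p) V \<inter> Sp (snd p) (fst p) V" wt] wt_pos by (simp add: less_imp_le)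
  also have "\<dots> \<le> rad p * wt V"
    using sum_wt_Sp[OF V, of "fst p" "snd p"] sum_wt_Sp[OF V, of "snd p" "fst p"]
    by (simp add: rad_def algebra_simps)
  finally show ?thesis .
qed

lemma CC_subset_cells: "CC \<subseteq> cells abv \<pi>"
proof
  fix \<sigma> assume "\<sigma> \<in> CC"
  then obtain A where A: "invertible A" "\<sigma> = {vtx A}" by (auto simp: CC_def elim: verticesE)
  have "mat \<pi> ** A = A ** mat \<pi>" by (rule mat_mult_commute)
  moreover have "lat (A ** mat \<pi>) \<subset> lat A"
    using abv_det_dg_neq_1[of 1 1 1] det_dg[of 1 1 1] dg_mat[of 1] abv_unif
    by (intro lat_strict[OF A(1)]) (auto simp: mat_mk9 intg_mk9)
  ultimately have "scale_set \<pi> (lat A) \<subset> lat A" by (simp add: scale_set_lat)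
  then show "\<sigma> \<in> cells abv \<pi>"
    unfolding cells_def using A by (auto simp: O_lattice_iff vtx_def intro!: exI[of _ "[lat A]"])
qed

text \<open>Here the spectral half of the Ramanujan condition enters; on the building, the Schur
  test with weight \<open>wt\<close> locates the spectrum.\<close>

lemma spectrum_Tc: "op_spectrum (l2_nontrivial cell_act PSL3 \<Gamma> CC) (quotient_adjacency cell_act \<Gamma> CC (Tc p)) \<subseteq> {z. cmod z \<le> rad p}"
proof -
  have "op_spectrum (l2_nontrivial cell_act PSL3 \<Gamma> CC) (quotient_adjacency cell_act \<Gamma> CC (Tc p))
      \<subseteq> op_spectrum (l2_space CC) (adjacency CC (Tc p))"
  proof -
    have R: "ramanujan_on cell_act (cells abv \<pi>) \<Gamma>" using ramanujan by (simp add: ramanujan_complex_def)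
    have "CC \<subseteq> cells abv \<pi> \<and> (\<forall>g\<in>carrier PG. cell_act g ` CC \<subseteq> CC) \<and>
      geometric_operator cell_act (carrier PG) CC (Tc p)"
      by (intro conjI ballI image_subsetI CC_subset_cells geometric_Tc cell_act_closed)
    then show ?thesis by (rule R[unfolded ramanujan_on_def, THEN spec, THEN spec, THEN mp])
  qed
  also have "\<dots> \<subseteq> {z. cmod z \<le> rad p}"
  proof (rule op_spectrum_adjacency_subset[where w = "\<lambda>\<sigma>. wt (the_elem \<sigma>)"])
    fix x assume x: "x \<in> CC"
    show "finite (Tc p x)" "Tc p x \<subseteq> CC" by (rule top.T_fin[OF x] top.T_sub[OF x])+
    show "y \<in> Tc p x \<longleftrightarrow> x \<in> Tc p y" if "y \<in> CC" for y by (rule top.sym[OF x that])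
    show "0 < wt (the_elem x)" by (rule wt_pos)
    obtain V where V: "V \<in> VV" "x = {V}" using x by (auto simp: CC_def)
    show "(\<Sum>y\<in>Tc p x. wt (the_elem y)) \<le> rad p * wt (the_elem x)"
      using sum_wt_Tp[OF V(1), of p] by (simp add: V(2) Tc_def sum.reindex[OF inj_sing] o_def)
  qed (rule rad_nonneg)
  finally show ?thesis .
qed

lemma card_Tc: "V \<in> VV \<Longrightarrow> card (Tc p {V}) = card (Tp p V)"
  by (simp add: Tc_def card_image[OF inj_sing])

lemma A_orbc: "V \<in> VV \<Longrightarrow> quotient_adjacency cell_act \<Gamma> CC (Tc p) f (orbc V) = (\<Sum>W\<in>Tp p V. f (orbc W))"
  unfolding orbc_def by (subst top.A_orb[OF CC_I]) (simp_all add: Tc_def sum.reindex[OF inj_sing])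

lemma QQ_eq: "QQ = orbc ` VV"
  by (auto simp: quotient_set_def CC_def orbc_def)

lemma QQ_E: assumes "x \<in> QQ" obtains V where "V \<in> VV" "x = orbc V"
  using assms by (auto simp: QQ_eq)

lemma orbc_in: "V \<in> VV \<Longrightarrow> orbc V \<in> QQ" by (auto simp: QQ_eq)

lemma orbc_eq_iff: "V \<in> VV \<Longrightarrow> W \<in> VV \<Longrightarrow> orbc W = orbc V \<longleftrightarrow> (\<exists>\<gamma>\<in>\<Gamma>. W = vertex_act \<gamma> V)"
  unfolding orbc_def using cellq.orb_eq_iff[OF CC_I CC_I, of V W] by (simp add: cell_act_def)

lemma card_Tp_orbc:
  assumes V: "V \<in> VV" and W: "W \<in> VV"
  shows "card {U \<in> Tp p V. orbc U = orbc W} = card {U \<in> Tp p W. orbc U = orbc V}"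
proof -
  have *: "card {U \<in> Tp p V. orbc U = x} = card {\<sigma> \<in> Tc p {V}. orbit cell_act \<Gamma> \<sigma> = x}" for V x
  proof -
    have "{\<sigma> \<in> Tc p {V}. orbit cell_act \<Gamma> \<sigma> = x} = (\<lambda>V. {V}) ` {U \<in> Tp p V. orbc U = x}"
      by (auto simp: Tc_def orbc_def)
    then show ?thesis by (simp add: card_image[OF inj_sing])
  qed
  show ?thesis unfolding * using top.card_T_orb[OF CC_I[OF V] CC_I[OF W]] by (simp add: orbc_def)
qed

lemma card_Tp_const: "V \<in> VV \<Longrightarrow> x \<in> CC \<Longrightarrow> card (Tc p x) = card (Tp p V)"
  by (auto simp: CC_def card_Tc intro: card_Tp_eq)

lemma card_Tp_ge: "V \<in> VV \<Longrightarrow> rq ^ (2 * (fst p + snd p)) \<le> real (card (Tp p V))"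
proof -
  assume V: "V \<in> VV"
  have "card {W \<in> Sp (fst p) (snd p) V. hgt W = hgt V + int (fst p + snd p)} \<le> card (Tp p V)"
    by (rule card_mono[OF finite_Tp[OF V]]) (auto simp: Tp_def)
  then show ?thesis using card_Sp_top_ge[OF V, of "fst p" "snd p"] by linarith
qed

lemma card_Tp_le: "V \<in> VV \<Longrightarrow> real (card (Tp p V)) \<le> 32 * rq ^ (2 * (fst p + snd p))"
  using card_Sp_le[of V "fst p" "snd p"] card_Sp_le[of V "snd p" "fst p"]
    card_Un_le[of "Sp (fst p) (snd p) V" "Sp (snd p) (fst p) V"] by (simp add: Tp_def add.commute)

lemma card_Tp_pos: "V \<in> VV \<Longrightarrow> 0 < real (card (Tp p V))"
  by (rule less_le_trans[OF _ card_Tp_ge]) (use rq_ge_2 in simp_all)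

section \<open>The trivial part of a point mass\<close>

context
  fixes \<zeta> assumes Z: "\<zeta> \<in> VV"
begin

text \<open>\<open>\<Gamma>\<close> may permute the colours, so a vertex of X carries a set of
  colours rather than a single one.\<close>

definition Cols :: "int set" where "Cols = col ` orbit vertex_act \<Gamma> \<zeta>"

definition Y :: "('a ^ 3) set set set set set" where "Y = orbc ` {W \<in> VV. col W \<in> Cols}"

lemma Gamma_VV: "\<gamma> \<in> \<Gamma> \<Longrightarrow> V \<in> VV \<Longrightarrow> vertex_act \<gamma> V \<in> VV"
  by (rule vertex_act_in[OF cellq.Gamma_carrier])

lemma Cols_subset: "Cols \<subseteq> {0, 1, 2}"
  using Gamma_VV[OF _ Z] col_range by (fastforce simp: Cols_def orbit_def)

lemma Cols_nonempty: "Cols \<noteq> {}"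
  using subgroup.one_closed[OF lattice_facts(1)] by (auto simp: Cols_def orbit_def)

text \<open>An element of PGL_3 shifts all colours by the same amount, so a colour in
  \<open>Cols\<close> stays in \<open>Cols\<close> under \<open>\<Gamma>\<close>.\<close>

lemma orbc_Y_iff: assumes W: "W \<in> VV" shows "orbc W \<in> Y \<longleftrightarrow> col W \<in> Cols"
proof
  assume "orbc W \<in> Y"
  then obtain W' where W': "W' \<in> VV" "col W' \<in> Cols" "orbc W = orbc W'" by (auto simp: Y_def)
  then obtain \<gamma> where g: "\<gamma> \<in> \<Gamma>" "W = vertex_act \<gamma> W'" using orbc_eq_iff[OF W'(1) W] by blast
  obtain \<delta> where d: "\<delta> \<in> \<Gamma>" "col W' = col (vertex_act \<delta> \<zeta>)" using W'(2) by (auto simp: Cols_def orbit_def)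
  obtain A where A: "invertible A" "\<gamma> = proj A" using cellq.Gamma_carrier[OF g(1)] by (auto simp: carrier_PGL3)
  have "col W = col (vertex_act \<gamma> (vertex_act \<delta> \<zeta>))"
    using col_act[OF A(1) W'(1)] col_act[OF A(1) Gamma_VV[OF d(1) Z]] by (simp add: g A d)
  also have "\<dots> = col (vertex_act (\<gamma> \<otimes>\<^bsub>PG\<^esub> \<delta>) \<zeta>)"
    using g d Z by (simp add: vertex_act_mult cellq.Gamma_carrier)
  also have "\<dots> \<in> Cols" using subgroup.m_closed[OF lattice_facts(1) g(1) d(1)] by (auto simp: Cols_def orbit_def)
  finally show "col W \<in> Cols" .
qed (use W in \<open>auto simp: Y_def\<close>)

lemma Y_subset: "Y \<subseteq> QQ" by (auto simp: Y_def QQ_eq)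

lemma finite_Y: "finite Y" by (rule finite_subset[OF Y_subset cellq.finite_quotient])

lemma zeta_Y: "orbc \<zeta> \<in> Y"
proof -
  have "col \<zeta> = col (vertex_act \<one>\<^bsub>PG\<^esub> \<zeta>)" by (simp add: vertex_act_one Z)
  then have "col \<zeta> \<in> Cols" using subgroup.one_closed[OF lattice_facts(1)] unfolding Cols_def orbit_def by blast
  then show ?thesis using Z by (simp add: orbc_Y_iff)
qed

lemma card_Y_pos: "0 < real (card Y)"
  using zeta_Y finite_Y by (auto simp: card_gt_0_iff)

text \<open>A vertex whose colour occurs in the orbit of \<open>\<zeta>\<close> is reached from that
  orbit by PSL_3, along which trivial functions do not change.\<close>

lemma trivial_const_Y:
  assumes h: "trivial_function cell_act PSL3 \<Gamma> CC h" and x: "x \<in> Y"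
  shows "h x = h (orbc \<zeta>)"
proof -
  obtain W where W: "W \<in> VV" "col W \<in> Cols" "x = orbc W" using x by (auto simp: Y_def)
  then obtain \<gamma> where g: "\<gamma> \<in> \<Gamma>" "col W = col (vertex_act \<gamma> \<zeta>)" by (auto simp: Cols_def orbit_def)
  have gz: "vertex_act \<gamma> \<zeta> \<in> VV" by (rule Gamma_VV[OF g(1) Z])
  obtain s where s: "s \<in> PSL3" "vertex_act s (vertex_act \<gamma> \<zeta>) = W"
    using PSL3_transitive[OF gz W(1)] g by auto
  have "h (orbit cell_act \<Gamma> (cell_act s {vertex_act \<gamma> \<zeta>})) = h (orbit cell_act \<Gamma> {vertex_act \<gamma> \<zeta>})"
    using h s(1) CC_I[OF gz] unfolding trivial_function_def by blast
  then have "h (orbc W) = h (orbc (vertex_act \<gamma> \<zeta>))" by (simp add: cell_act_def s orbc_def)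
  also have "orbc (vertex_act \<gamma> \<zeta>) = orbc \<zeta>" using orbc_eq_iff[OF Z gz] g(1) by blast
  finally show ?thesis by (simp add: W)
qed

text \<open>
  \<open>u\<close> is the projection to the trivial functions of the point mass at the orbit of \<open>\<zeta>\<close>, and \<open>f0\<close> its
  nontrivial part: by transitivity of \<open>PSL\<^sub>3(F)\<close> on each colour, trivial functions are constant on \<open>Y\<close>.
\<close>

definition u :: "('a ^ 3) set set set set \<Rightarrow> real" where
  "u x = (if x \<in> Y then 1 / real (card Y) else 0)"

definition f0 :: "('a ^ 3) set set set set \<Rightarrow> real" where
  "f0 x = (if x = orbc \<zeta> then 1 else 0) - u x"

lemma sum_u: "(\<Sum>x\<in>QQ. u x) = 1"
proof -
  have "(\<Sum>x\<in>QQ. u x) = (\<Sum>x\<in>QQ \<inter> Y. 1 / real (card Y))"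
    unfolding u_def by (simp add: sum.If_cases cellq.finite_quotient)
  also have "QQ \<inter> Y = Y" using Y_subset by auto
  finally show ?thesis using card_Y_pos by simp
qed

lemma f0_l1: "(\<Sum>x\<in>QQ. \<bar>f0 x\<bar>) \<le> 2"
proof -
  have "(\<Sum>x\<in>QQ. \<bar>f0 x\<bar>) \<le> (\<Sum>x\<in>QQ. (if x = orbc \<zeta> then 1 else 0) + u x)"
    by (rule sum_mono) (auto simp: f0_def u_def abs_le_iff)
  also have "\<dots> = 2" using orbc_in[OF Z] sum_u by (simp add: sum.distrib sum.delta cellq.finite_quotient)
  finally show ?thesis .
qed

lemma f0_nontrivial: "(\<lambda>x. complex_of_real (f0 x)) \<in> l2_nontrivial cell_act PSL3 \<Gamma> CC"
  unfolding top.nontrivial_iff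
proof (intro conjI allI impI)
  fix x assume "x \<notin> QQ"
  then show "complex_of_real (f0 x) = 0" using Y_subset orbc_in[OF Z] by (auto simp: f0_def u_def)
next
  fix h assume h: "trivial_function cell_act PSL3 \<Gamma> CC h"
  have "(\<Sum>x\<in>QQ. complex_of_real (u x) * cnj (h x)) = (\<Sum>x\<in>QQ. complex_of_real (u x) * cnj (h (orbc \<zeta>)))"
    by (rule sum.cong[OF refl]) (use trivial_const_Y[OF h] in \<open>auto simp: u_def\<close>)
  also have "\<dots> = complex_of_real (\<Sum>x\<in>QQ. u x) * cnj (h (orbc \<zeta>))" by (simp add: sum_distrib_right)
  finally have 1: "(\<Sum>x\<in>QQ. complex_of_real (u x) * cnj (h x)) = cnj (h (orbc \<zeta>))" by (simp add: sum_u)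
  have 2: "(\<Sum>x\<in>QQ. complex_of_real (if x = orbc \<zeta> then 1 else 0) * cnj (h x)) = cnj (h (orbc \<zeta>))"
    using orbc_in[OF Z] cellq.finite_quotient
    by (simp add: if_distrib[of complex_of_real] if_distrib[of "\<lambda>u. u * _"] sum.delta cong: if_cong)
  have "(\<Sum>x\<in>QQ. complex_of_real (f0 x) * cnj (h x))
    = (\<Sum>x\<in>QQ. complex_of_real (if x = orbc \<zeta> then 1 else 0) * cnj (h x)) - (\<Sum>x\<in>QQ. complex_of_real (u x) * cnj (h x))"
    by (simp add: f0_def left_diff_distrib sum_subtractf del: of_real_1 of_real_0)
  then show "(\<Sum>x\<in>QQ. complex_of_real (f0 x) * cnj (h x)) = 0" unfolding 1 2 by simp
qed

definition lft :: "('a ^ 3) set set set set \<Rightarrow> ('a ^ 3) set set" where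
  "lft x = (SOME V. V \<in> VV \<and> orbc V = x)"

lemma lft: "x \<in> QQ \<Longrightarrow> lft x \<in> VV" "x \<in> QQ \<Longrightarrow> orbc (lft x) = x"
proof -
  assume "x \<in> QQ"
  then have "\<exists>V. V \<in> VV \<and> orbc V = x" by (auto elim: QQ_E)
  from someI_ex[OF this] show "lft x \<in> VV" "orbc (lft x) = x" by (simp_all add: lft_def)
qed

definition avg :: "nat \<times> nat \<Rightarrow> (('a ^ 3) set set set set \<Rightarrow> real) \<Rightarrow> ('a ^ 3) set set set set \<Rightarrow> real" where
  "avg p f x = (\<Sum>W\<in>Tp p (lft x). f (orbc W)) / real (card (Tp p (lft x)))"

lemma avg_A: "x \<in> QQ \<Longrightarrow> complex_of_real (avg p f x)
    = quotient_adjacency cell_act \<Gamma> CC (Tc p) (\<lambda>x. complex_of_real (f x)) x / of_nat (card (Tp p \<zeta>))"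
  using A_orbc[OF lft(1), of x p "\<lambda>x. complex_of_real (f x)"] card_Tp_eq[OF Z lft(1), of x p] by (simp add: avg_def lft(2))

lemma abs_avg_A: "x \<in> QQ \<Longrightarrow> \<bar>avg p f x\<bar>
    = cmod (quotient_adjacency cell_act \<Gamma> CC (Tc p) (\<lambda>x. complex_of_real (f x)) x) / real (card (Tp p \<zeta>))"
  using arg_cong[OF avg_A, of x cmod p f] by (simp add: norm_divide)

lemma avg_l1: "(\<Sum>x\<in>QQ. \<bar>avg p f x\<bar>) \<le> (\<Sum>x\<in>QQ. \<bar>f x\<bar>)"
proof -
  have "(\<Sum>x\<in>QQ. \<bar>avg p f x\<bar>) = (\<Sum>x\<in>QQ. cmod (quotient_adjacency cell_act \<Gamma> CC (Tc p) (\<lambda>x. complex_of_real (f x)) x)) / real (card (Tp p \<zeta>))"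
    by (simp add: abs_avg_A sum_divide_distrib)
  also have "\<dots> \<le> (real (card (Tp p \<zeta>)) * (\<Sum>x\<in>QQ. cmod (complex_of_real (f x)))) / real (card (Tp p \<zeta>))"
    by (intro divide_right_mono top.A_l1 card_Tp_const[OF Z]) simp_all
  also have "\<dots> = (\<Sum>x\<in>QQ. \<bar>f x\<bar>)" using card_Tp_pos[OF Z, of p] by simp
  finally show ?thesis .
qed

lemma avg_sum: "(\<Sum>x\<in>QQ. avg p f x) = (\<Sum>x\<in>QQ. f x)"
proof -
  have "complex_of_real (\<Sum>x\<in>QQ. avg p f x) = (\<Sum>x\<in>QQ. quotient_adjacency cell_act \<Gamma> CC (Tc p) (\<lambda>x. complex_of_real (f x)) x) / of_nat (card (Tp p \<zeta>))"
    by (simp add: avg_A sum_divide_distrib)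
  also have "\<dots> = complex_of_real (\<Sum>x\<in>QQ. f x)"
    by (subst top.A_sum[OF card_Tp_const[OF Z]]) (use card_Tp_pos[OF Z, of p] in simp_all)
  finally show ?thesis by (simp only: of_real_eq_iff)
qed

text \<open>Cauchy-Schwarz passes from l^1 to l^2 at the cost of the square root of |X|. The
  nontrivial part is contracted by \<open>rad p\<close>, and the averaging divides by at least
  q^(2d), d being the radius.\<close>

lemma avg_f0_l1:
  "(\<Sum>x\<in>QQ. \<bar>avg p f0 x\<bar>) \<le> 2 * sqrt (real (card QQ)) * rad p / rq ^ (2 * (fst p + snd p))"
proof -
  let ?A = "quotient_adjacency cell_act \<Gamma> CC (Tc p) (\<lambda>x. complex_of_real (f0 x))"
  have z: "f0 x = 0" if "x \<notin> QQ" for x using f0_nontrivial that unfolding top.nontrivial_iff by simp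
  have "l2_norm ?A \<le> rad p * l2_norm (\<lambda>x. complex_of_real (f0 x))"
    by (rule top.norm_bound[OF spectrum_Tc rad_nonneg f0_nontrivial])
  also have "l2_norm (\<lambda>x. complex_of_real (f0 x)) = L2_set (\<lambda>x. \<bar>f0 x\<bar>) QQ"
    by (subst l2_norm_finite[OF cellq.finite_quotient]) (simp_all add: z)
  also have "\<dots> \<le> (\<Sum>x\<in>QQ. \<bar>f0 x\<bar>)" by (rule L2_set_le_sum) simp
  also have "\<dots> \<le> 2" by (rule f0_l1)
  finally have l2: "l2_norm ?A \<le> rad p * 2" using rad_nonneg[of p] by (simp add: mult_left_mono)
  have "(\<Sum>x\<in>QQ. cmod (?A x))\<^sup>2 = (\<Sum>x\<in>QQ. 1 * cmod (?A x))\<^sup>2" by simp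
  also have "\<dots> \<le> (\<Sum>x\<in>QQ. 1\<^sup>2) * (\<Sum>x\<in>QQ. (cmod (?A x))\<^sup>2)" by (rule Cauchy_Schwarz_ineq_sum)
  also have "\<dots> = real (card QQ) * (l2_norm ?A)\<^sup>2"
    by (subst l2_norm_finite[OF cellq.finite_quotient top.A_supp]) (simp_all add: L2_set_def sum_nonneg)
  also have "\<dots> = (sqrt (real (card QQ)) * l2_norm ?A)\<^sup>2" by (simp add: power_mult_distrib)
  finally have "(\<Sum>x\<in>QQ. cmod (?A x)) \<le> sqrt (real (card QQ)) * l2_norm ?A"
    by (rule power2_le_imp_le) (simp add: l2_norm_nonneg)
  also have "\<dots> \<le> sqrt (real (card QQ)) * (rad p * 2)" by (rule mult_left_mono[OF l2]) simp
  finally have s: "(\<Sum>x\<in>QQ. cmod (?A x)) \<le> 2 * sqrt (real (card QQ)) * rad p" by (simp add: mult_ac)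
  have q: "0 < rq ^ (2 * (fst p + snd p))" using rq_ge_2 by simp
  have "(\<Sum>x\<in>QQ. \<bar>avg p f0 x\<bar>) = (\<Sum>x\<in>QQ. cmod (?A x)) / real (card (Tp p \<zeta>))"
    by (simp add: abs_avg_A sum_divide_distrib)
  also have "\<dots> \<le> (\<Sum>x\<in>QQ. cmod (?A x)) / rq ^ (2 * (fst p + snd p))"
    using card_Tp_ge[OF Z, of p] q card_Tp_pos[OF Z, of p] by (intro divide_left_mono sum_nonneg) auto
  also have "\<dots> \<le> 2 * sqrt (real (card QQ)) * rad p / rq ^ (2 * (fst p + snd p))"
    using q by (intro divide_right_mono s) simp
  finally show ?thesis .
qed

section \<open>The law of the walk on X and the mixing of colours\<close>

definition prb :: "nat \<Rightarrow> ('a ^ 3) set set set set \<Rightarrow> real" where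
  "prb t x = EE \<zeta> t (\<lambda>W. if orbc W = x then 1 else 0)"

lemma EE_avg: "x \<in> QQ \<Longrightarrow> EE (lft x) t (\<lambda>W. f (orbc W)) = EE \<zeta> t (\<lambda>W. avg (pos \<zeta> W) f x)"
  using EE_mixture[OF Z lft(1), of x t "\<lambda>W. f (orbc W)"] by (simp add: avg_def)

text \<open>By \<open>card_Tp_orbc\<close> as many points of a class lead from
  \<open>\<zeta>\<close> to x as from x back to \<open>\<zeta>\<close>; so the law is a mixture of
  averages of the point mass at the orbit of \<open>\<zeta>\<close>.\<close>

lemma prb_avg:
  assumes x: "x \<in> QQ"
  shows "prb t x = EE \<zeta> t (\<lambda>W. avg (pos \<zeta> W) (\<lambda>y. if y = orbc \<zeta> then 1 else 0) x)"
proof -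
  have l: "lft x \<in> VV" "orbc (lft x) = x" using lft[OF x] .
  have "(\<Sum>W'\<in>Tp p \<zeta>. if orbc W' = x then 1 else 0) / real (card (Tp p \<zeta>))
     = avg p (\<lambda>y. if y = orbc \<zeta> then 1 else 0) x" for p
  proof -
    have "(\<Sum>W'\<in>Tp p \<zeta>. if orbc W' = x then 1 else (0::real)) = real (card {U \<in> Tp p \<zeta>. orbc U = orbc (lft x)})"
      using finite_Tp[OF Z] by (simp add: sum.If_cases Int_def l)
    also have "\<dots> = real (card {U \<in> Tp p (lft x). orbc U = orbc \<zeta>})" by (subst card_Tp_orbc[OF Z l(1)]) simp
    also have "\<dots> = (\<Sum>W'\<in>Tp p (lft x). if orbc W' = orbc \<zeta> then 1 else 0)"
      using finite_Tp[OF l(1)] by (simp add: sum.If_cases Int_def)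
    finally show ?thesis using card_Tp_eq[OF Z l(1), of p] by (simp add: avg_def)
  qed
  then show ?thesis unfolding prb_def EE_mixture[OF Z Z, of t "\<lambda>W. if orbc W = x then 1 else 0"] by simp
qed

lemma EE_sum: "EE \<zeta> t (\<lambda>W. \<Sum>x\<in>QQ. g W x) = (\<Sum>x\<in>QQ. EE \<zeta> t (\<lambda>W. g W x))"
  unfolding EE_eq[OF Z] sum_distrib_left by (rule sum.swap)

lemma abs_EE_le: "\<bar>EE \<zeta> t f\<bar> \<le> EE \<zeta> t (\<lambda>W. \<bar>f W\<bar>)"
  unfolding EE_eq[OF Z] by (rule order_trans[OF sum_abs]) (simp add: abs_mult)

lemma EE_add: "EE \<zeta> t (\<lambda>W. f W + g W) = EE \<zeta> t f + EE \<zeta> t g"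
  unfolding EE_eq[OF Z] by (simp add: distrib_left sum.distrib)

text \<open>Splitting the point mass into \<open>f0\<close> and \<open>u\<close> separates
  equidistribution within colours from the mixing of colours.\<close>

lemma prb_decomp:
  assumes x: "x \<in> QQ"
  shows "prb t x = EE \<zeta> t (\<lambda>W. avg (pos \<zeta> W) f0 x) + EE (lft x) t (\<lambda>W. u (orbc W))"
proof -
  have "avg p (\<lambda>y. if y = orbc \<zeta> then 1 else 0) x = avg p f0 x + avg p u x" for p
    by (simp add: avg_def f0_def sum_subtractf diff_divide_distrib)
  then show ?thesis unfolding prb_avg[OF x] EE_avg[OF x] by (simp add: EE_add)
qed

text \<open>The expectation of \<open>u\<close> is the probability of meeting a colour in
  \<open>Cols\<close>, close to k = |Cols| / 3, divided by |Y|. Since these values sum to 1 over X,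
  |Y| is close to n k, and the quotient is close to 1 / n.\<close>

lemma color_part:
  assumes t: "(1 / 2) ^ t \<le> (1 / 18 :: real)"
  shows "(\<Sum>x\<in>QQ. \<bar>EE (lft x) t (\<lambda>W. u (orbc W)) - 1 / real (card QQ)\<bar>) \<le> 36 * (1 / 2) ^ t"
proof -
  define e where "e x = EE (lft x) t (\<lambda>W. if col W \<in> Cols then 1 else 0)" for x
  define k where "k = real (card Cols) / 3"
  define \<eta> where "\<eta> = 3 * (1 / 2 :: real) ^ t"
  define n where "n = real (card QQ)"
  define m where "m = real (card Y)"
  have m: "0 < m" using card_Y_pos by (simp add: m_def)
  have n: "0 < n" using orbc_in[OF Z] cellq.finite_quotient by (auto simp: n_def card_gt_0_iff)
  have fC: "finite Cols" using Cols_subset finite_subset by blast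
  have cC: "1 \<le> card Cols" "card Cols \<le> 3"
  proof -
    show "1 \<le> card Cols" using Cols_nonempty fC by (simp add: Suc_le_eq card_gt_0_iff)
    have "card Cols \<le> card {0, 1, 2 :: int}" by (rule card_mono[OF _ Cols_subset]) simp
    then show "card Cols \<le> 3" by simp
  qed
  have ek: "\<bar>e x - k\<bar> \<le> \<eta>" if x: "x \<in> QQ" for x
  proof -
    note L = lft(1)[OF x]
    have "e x = EE (lft x) t (\<lambda>W. \<Sum>c\<in>Cols. if col W = c then 1 else 0)"
      unfolding e_def by (rule EE_cong[OF L]) (simp add: fC)
    also have "\<dots> = (\<Sum>c\<in>Cols. EE (lft x) t (\<lambda>W. if col W = c then 1 else 0))"
      unfolding EE_eq[OF L] sum_distrib_left by (rule sum.swap)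
    finally have "e x - k = (\<Sum>c\<in>Cols. EE (lft x) t (\<lambda>W. if col W = c then 1 else 0) - 1 / 3)"
      by (simp add: k_def sum_subtractf)
    also have "\<bar>\<dots>\<bar> \<le> (\<Sum>c\<in>Cols. \<bar>EE (lft x) t (\<lambda>W. if col W = c then 1 else 0) - 1 / 3\<bar>)" by (rule sum_abs)
    also have "\<dots> \<le> (\<Sum>c\<in>Cols. (1 / 2) ^ t)"
      by (rule sum_mono) (use Cols_subset col_equidistribution[OF L] in blast)
    also have "\<dots> \<le> 3 * (1 / 2) ^ t" using cC by (simp add: mult_right_mono)
    finally show ?thesis by (simp add: \<eta>_def)
  qed
  have ue: "EE (lft x) t (\<lambda>W. u (orbc W)) = e x / m" if x: "x \<in> QQ" for x
  proof -
    have "EE (lft x) t (\<lambda>W. u (orbc W)) = EE (lft x) t (\<lambda>W. (1 / m) * (if col W \<in> Cols then 1 else 0) + 0)"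
      by (rule EE_cong[OF lft(1)[OF x]]) (simp add: u_def m_def orbc_Y_iff)
    also have "\<dots> = (1 / m) * e x + 0" unfolding e_def by (rule EE_linear[OF lft(1)[OF x]])
    finally show ?thesis by simp
  qed
  \<comment> \<open>Averaging preserves the total mass of \<open>u\<close>; this determines the size
    m of Y up to the colour error.\<close>
  have "(\<Sum>x\<in>QQ. EE (lft x) t (\<lambda>W. u (orbc W))) = EE \<zeta> t (\<lambda>W. \<Sum>x\<in>QQ. avg (pos \<zeta> W) u x)"
    by (simp add: EE_avg EE_sum)
  also have "\<dots> = EE \<zeta> t (\<lambda>W. 0 * 0 + 1)" by (simp add: avg_sum sum_u)
  also have "\<dots> = 1" unfolding EE_linear[OF Z] by simp
  finally have "(\<Sum>x\<in>QQ. e x) = m" using m by (simp add: ue flip: sum_divide_distrib)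
  then have "m - n * k = (\<Sum>x\<in>QQ. e x - k)" by (simp add: n_def sum_subtractf)
  also have "\<bar>\<dots>\<bar> \<le> (\<Sum>x\<in>QQ. \<bar>e x - k\<bar>)" by (rule sum_abs)
  also have "\<dots> \<le> (\<Sum>x\<in>QQ. \<eta>)" by (rule sum_mono[OF ek])
  finally have mk: "\<bar>m - n * k\<bar> \<le> n * \<eta>" by (simp add: n_def)
  have kk: "1 / 3 \<le> k" using cC by (simp add: k_def)
  have \<eta>: "0 \<le> \<eta>" "\<eta> \<le> 1 / 6" using t by (simp_all add: \<eta>_def)
  \<comment> \<open>\<open>Cols\<close> has at least one colour, so k >= 1/3, and the hypothesis on
    t gives \<open>\<eta>\<close> <= 3/18 = 1/6.\<close>
  have "n * (1 / 6) \<le> n * (k - \<eta>)" using kk \<eta> n by (intro mult_left_mono) auto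
  then have mn: "n / 6 \<le> m" using mk by (simp add: right_diff_distrib abs_le_iff)
  have "\<bar>e x / m - 1 / n\<bar> \<le> 12 * \<eta> / n" if x: "x \<in> QQ" for x
  proof -
    have "e x / m - 1 / n = (n * (e x - k) - (m - n * k)) / (n * m)" using m n by (simp add: field_simps)
    then have "\<bar>e x / m - 1 / n\<bar> = \<bar>n * (e x - k) - (m - n * k)\<bar> / (n * m)" using m n by (simp add: abs_mult)
    also have "\<dots> \<le> (n * \<eta> + n * \<eta>) / (n * m)"
    proof (rule divide_right_mono)
      have "\<bar>n * (e x - k)\<bar> \<le> n * \<eta>" using ek[OF x] n by (simp add: abs_mult)
      then show "\<bar>n * (e x - k) - (m - n * k)\<bar> \<le> n * \<eta> + n * \<eta>" using mk by linarith
    qed (use m n in simp)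
    also have "\<dots> = 2 * \<eta> / m" using n by (simp add: field_simps)
    also have "\<dots> \<le> 2 * \<eta> / (n / 6)" using mn m n \<eta> by (intro divide_left_mono) auto
    finally show ?thesis by simp
  qed
  then have "(\<Sum>x\<in>QQ. \<bar>EE (lft x) t (\<lambda>W. u (orbc W)) - 1 / real (card QQ)\<bar>) \<le> (\<Sum>x\<in>QQ. 12 * \<eta> / n)"
    by (intro sum_mono) (simp add: ue n_def)
  also have "\<dots> = 12 * \<eta>" using n by (simp add: n_def)
  finally show ?thesis by (simp add: \<eta>_def)
qed

section \<open>Concentration of the distance and total variation bounds\<close>

definition Dd :: "('a ^ 3) set set \<Rightarrow> nat" where
  "Dd W = fst (pos \<zeta> W) + snd (pos \<zeta> W)"

lemma hgt_le_Dd: "W \<in> VV \<Longrightarrow> real_of_int (hgt W - hgt \<zeta>) \<le> real (Dd W)"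
  using hgt_le[OF Z pos[OF Z], of W] by (simp add: Dd_def)

text \<open>The height gained never exceeds the distance, so a small distance forces a small height;
  then Chebyshev's inequality applies.\<close>

lemma prob_Dd_less:
  assumes r: "r < drift * real t"
  shows "EE \<zeta> t (\<lambda>W. if real (Dd W) < r then 1 else 0) \<le> real t / (drift * real t - r)\<^sup>2"
proof -
  define c where "c = 1 / (drift * real t - r)\<^sup>2"
  have c: "0 < c" using r by (simp add: c_def)
  have "EE \<zeta> t (\<lambda>W. if real (Dd W) < r then 1 else 0)
    \<le> EE \<zeta> t (\<lambda>W. c * (real_of_int (hgt W - hgt \<zeta>) - drift * real t)\<^sup>2 + 0)"
  proof (rule EE_mono[OF Z])
    fix W assume W: "W \<in> VV"
    show "(if real (Dd W) < r then 1 else 0) \<le> c * (real_of_int (hgt W - hgt \<zeta>) - drift * real t)\<^sup>2 + 0"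
    proof (cases "real (Dd W) < r")
      case True
      then have "drift * real t - r \<le> drift * real t - real_of_int (hgt W - hgt \<zeta>)" using hgt_le_Dd[OF W] by linarith
      then have "(drift * real t - r)\<^sup>2 \<le> (drift * real t - real_of_int (hgt W - hgt \<zeta>))\<^sup>2"
        using r by (intro power_mono) auto
      then have "1 \<le> c * (drift * real t - real_of_int (hgt W - hgt \<zeta>))\<^sup>2" using r by (simp add: c_def pos_le_divide_eq)
      then show ?thesis using True by (simp add: power2_commute)
    qed (use c in simp)
  qed
  also have "\<dots> \<le> c * real t + 0"
    unfolding EE_linear[OF Z] using hgt_second_moment[OF Z] c by (intro add_mono mult_left_mono) auto
  finally show ?thesis by (simp add: c_def)
qed

text \<open>A class at distance \<open>D\<close> has a proportion \<open>\<ge> 1/32\<close> of vertices of height \<open>D\<close>, so the tail of the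
  distance is controlled by the tail of the height, which has independent increments.\<close>

lemma prob_Dd_ge:
  assumes r: "drift * real t < r"
  shows "EE \<zeta> t (\<lambda>W. if r \<le> real (Dd W) then 1 else 0) \<le> 32 * real t / (r - drift * real t)\<^sup>2"
proof -
  define c where "c = 1 / (r - drift * real t)\<^sup>2"
  have c: "0 < c" using r by (simp add: c_def)
  let ?h = "\<lambda>W. real_of_int (hgt W - hgt \<zeta>)"
  let ?g = "\<lambda>W. if r \<le> ?h W then 1 else (0::real)"
  have "EE \<zeta> t (\<lambda>W. if r \<le> real (Dd W) then 1 else 0)
    \<le> EE \<zeta> t (\<lambda>W. 32 * ((\<Sum>W'\<in>Tp (pos \<zeta> W) \<zeta>. ?g W') / real (card (Tp (pos \<zeta> W) \<zeta>))) + 0)"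
  proof (rule EE_mono[OF Z])
    fix W assume W: "W \<in> VV"
    let ?p = "pos \<zeta> W"
    show "(if r \<le> real (Dd W) then 1 else 0) \<le> 32 * ((\<Sum>W'\<in>Tp ?p \<zeta>. ?g W') / real (card (Tp ?p \<zeta>))) + 0"
    proof (cases "r \<le> real (Dd W)")
      case True
      let ?S = "{W \<in> Sp (fst ?p) (snd ?p) \<zeta>. hgt W = hgt \<zeta> + int (fst ?p + snd ?p)}"
      have "rq ^ (2 * Dd W) \<le> real (card ?S)" using card_Sp_top_ge[OF Z] by (simp add: Dd_def)
      also have "\<dots> = (\<Sum>W'\<in>?S. ?g W')" using True by (simp add: Dd_def)
      also have "\<dots> \<le> (\<Sum>W'\<in>Tp ?p \<zeta>. ?g W')"
        by (rule sum_mono2[OF finite_Tp[OF Z]]) (auto simp: Tp_def)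
      finally have 1: "rq ^ (2 * Dd W) \<le> (\<Sum>W'\<in>Tp ?p \<zeta>. ?g W')" .
      have "real (card (Tp ?p \<zeta>)) \<le> 32 * (\<Sum>W'\<in>Tp ?p \<zeta>. ?g W')"
        using card_Tp_le[OF Z, of ?p] 1 by (simp add: Dd_def)
      then show ?thesis using True card_Tp_pos[OF Z, of ?p] by (simp add: pos_le_divide_eq)
    qed (auto intro!: sum_nonneg divide_nonneg_nonneg)
  qed
  \<comment> \<open>Averaging over the class of the current position leaves the law of the walk
    unchanged, by \<open>EE_mixture\<close> with both centres at \<open>\<zeta>\<close>.\<close>
  also have "\<dots> = 32 * EE \<zeta> t ?g" unfolding EE_linear[OF Z] EE_mixture[OF Z Z, of t ?g] by simp
  also have "EE \<zeta> t ?g \<le> EE \<zeta> t (\<lambda>W. c * (?h W - drift * real t)\<^sup>2 + 0)"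
  proof (rule EE_mono[OF Z])
    fix W
    show "?g W \<le> c * (?h W - drift * real t)\<^sup>2 + 0"
    proof (cases "r \<le> ?h W")
      case True
      then have "(r - drift * real t)\<^sup>2 \<le> (?h W - drift * real t)\<^sup>2" using r by (intro power_mono) auto
      then have "1 \<le> c * (?h W - drift * real t)\<^sup>2" using r by (simp add: c_def pos_le_divide_eq)
      then show ?thesis using True by simp
    qed (use c in simp)
  qed
  also have "\<dots> \<le> c * real t + 0"
    unfolding EE_linear[OF Z] using hgt_second_moment[OF Z] c by (intro add_mono mult_left_mono) auto
  finally show ?thesis by (simp add: c_def)
qed

text \<open>Radii below r contribute at most the l^1 norm 2 of \<open>f0\<close> times their
  probability, larger radii at most 4 B by the norm bound, and the colours the last term.\<close>

lemma prb_upper: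
  assumes t: "(1 / 2) ^ t \<le> (1 / 18 :: real)" and r: "r < drift * real t" and B: "0 \<le> B"
    and D: "\<And>d. r \<le> real d \<Longrightarrow> sqrt (real (card QQ)) * (real d + 1) ^ 4 / rq ^ d \<le> B"
  shows "(\<Sum>x\<in>QQ. \<bar>prb t x - 1 / real (card QQ)\<bar>) \<le> 4 * B + 2 * real t / (drift * real t - r)\<^sup>2 + 36 * (1 / 2) ^ t"
proof -
  have main: "(\<Sum>x\<in>QQ. \<bar>avg (pos \<zeta> W) f0 x\<bar>) \<le> 2 * (if real (Dd W) < r then 1 else 0) + 4 * B" if W: "W \<in> VV" for W
  proof (cases "real (Dd W) < r")
    case True
    then show ?thesis using order_trans[OF avg_l1[of "pos \<zeta> W" f0] f0_l1] B by simp
  next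
    case False
    let ?a = "fst (pos \<zeta> W)" and ?b = "snd (pos \<zeta> W)"
    have q: "0 < rq" using rq_ge_2 by simp
    have "(real ?a + 1)\<^sup>2 * (real ?b + 1)\<^sup>2 \<le> (real (Dd W) + 1)\<^sup>2 * (real (Dd W) + 1)\<^sup>2"
      by (intro mult_mono power_mono) (auto simp: Dd_def)
    also have "\<dots> = (real (Dd W) + 1) ^ 4" by (simp flip: power_add)
    finally have p: "(real ?a + 1)\<^sup>2 * (real ?b + 1)\<^sup>2 \<le> (real (Dd W) + 1) ^ 4" .
    have "(\<Sum>x\<in>QQ. \<bar>avg (pos \<zeta> W) f0 x\<bar>) \<le> 2 * sqrt (real (card QQ)) * rad (pos \<zeta> W) / rq ^ (2 * Dd W)"
      using avg_f0_l1[of "pos \<zeta> W"] by (simp add: Dd_def)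
    also have "\<dots> = 4 * (sqrt (real (card QQ)) * ((real ?a + 1)\<^sup>2 * (real ?b + 1)\<^sup>2) / rq ^ Dd W)"
    proof -
      have 1: "rad (pos \<zeta> W) = 2 * (((real ?a + 1)\<^sup>2 * (real ?b + 1)\<^sup>2) * rq ^ Dd W)" by (simp add: rad_def Dd_def)
      have 2: "rq ^ (2 * Dd W) = rq ^ Dd W * rq ^ Dd W" by (simp add: mult_2 power_add)
      have 3: "2 * s * (2 * (P * y)) / (y * y) = 4 * (s * P / y)" if "0 < y" for s P y :: real
        using that by (simp add: field_simps)
      show ?thesis unfolding 1 2 by (rule 3) (use q in simp)
    qed
    also have "\<dots> \<le> 4 * (sqrt (real (card QQ)) * (real (Dd W) + 1) ^ 4 / rq ^ Dd W)"
      using q by (intro mult_left_mono divide_right_mono p) auto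
    also have "\<dots> \<le> 4 * B" using D[of "Dd W"] False by simp
    finally show ?thesis using False by simp
  qed
  have "(\<Sum>x\<in>QQ. \<bar>prb t x - 1 / real (card QQ)\<bar>)
     \<le> (\<Sum>x\<in>QQ. EE \<zeta> t (\<lambda>W. \<bar>avg (pos \<zeta> W) f0 x\<bar>) + \<bar>EE (lft x) t (\<lambda>W. u (orbc W)) - 1 / real (card QQ)\<bar>)"
  proof (rule sum_mono)
    fix x assume x: "x \<in> QQ"
    show "\<bar>prb t x - 1 / real (card QQ)\<bar>
      \<le> EE \<zeta> t (\<lambda>W. \<bar>avg (pos \<zeta> W) f0 x\<bar>) + \<bar>EE (lft x) t (\<lambda>W. u (orbc W)) - 1 / real (card QQ)\<bar>"
      unfolding prb_decomp[OF x] using abs_EE_le[of t "\<lambda>W. avg (pos \<zeta> W) f0 x"] by linarith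
  qed
  also have "\<dots> = EE \<zeta> t (\<lambda>W. \<Sum>x\<in>QQ. \<bar>avg (pos \<zeta> W) f0 x\<bar>)
      + (\<Sum>x\<in>QQ. \<bar>EE (lft x) t (\<lambda>W. u (orbc W)) - 1 / real (card QQ)\<bar>)"
    by (simp add: sum.distrib EE_sum)
  also have "\<dots> \<le> (2 * (real t / (drift * real t - r)\<^sup>2) + 4 * B) + 36 * (1 / 2) ^ t"
  proof (rule add_mono[OF _ color_part[OF t]])
    have "EE \<zeta> t (\<lambda>W. \<Sum>x\<in>QQ. \<bar>avg (pos \<zeta> W) f0 x\<bar>) \<le> EE \<zeta> t (\<lambda>W. 2 * (if real (Dd W) < r then 1 else 0) + 4 * B)"
      by (rule EE_mono[OF Z main])
    also have "\<dots> \<le> 2 * (real t / (drift * real t - r)\<^sup>2) + 4 * B"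
      unfolding EE_linear[OF Z] using prob_Dd_less[OF r] by simp
    finally show "EE \<zeta> t (\<lambda>W. \<Sum>x\<in>QQ. \<bar>avg (pos \<zeta> W) f0 x\<bar>) \<le> 2 * (real t / (drift * real t - r)\<^sup>2) + 4 * B" .
  qed
  finally show ?thesis by (simp add: add_ac)
qed

text \<open>The image S in X of the ball of radius r carries most of the mass of the walk but,
  having at most 16 (r+1)^2 q^(2r) elements, little uniform mass.\<close>

lemma prb_lower:
  assumes r: "drift * real t < r" "0 \<le> r"
  shows "1 - 32 * real t / (r - drift * real t)\<^sup>2 - 16 * (r + 1)\<^sup>2 * rq powr (2 * r) / real (card QQ)
     \<le> 1 / 2 * (\<Sum>x\<in>QQ. \<bar>prb t x - 1 / real (card QQ)\<bar>)"
proof -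
  define n where "n = real (card QQ)"
  have n: "0 < n" using orbc_in[OF Z] cellq.finite_quotient by (auto simp: n_def card_gt_0_iff)
  define m where "m = nat \<lfloor>r\<rfloor>"
  have m: "real m \<le> r" "\<And>d. real d < r \<Longrightarrow> d \<le> m"
    using r(2) by (auto simp: m_def le_nat_floor of_nat_floor)
  define I where "I = {p. fst p + snd p \<le> m}"
  have I: "finite I" "card I \<le> (m + 1)\<^sup>2"
  proof -
    have "I \<subseteq> {..m} \<times> {..m}" by (auto simp: I_def)
    then show "finite I" "card I \<le> (m + 1)\<^sup>2"
      using finite_subset card_mono[of "{..m} \<times> {..m}" I] by (auto simp: card_cartesian_product power2_eq_square)
  qed
  define Ball where "Ball = (\<Union>p\<in>I. Sp (fst p) (snd p) \<zeta>)"
  have BV: "Ball \<subseteq> VV" using Sp_subset by (auto simp: Ball_def)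
  have fB: "finite Ball" using I(1) finite_Sp[OF Z] by (simp add: Ball_def)
  have inB: "W \<in> Ball" if "W \<in> VV" "real (Dd W) < r" for W
    using m(2)[OF that(2)] pos[OF Z that(1)] unfolding Ball_def I_def Dd_def by blast
  have q1: "1 \<le> rq" using rq_ge_2 by simp
  have "real (card Ball) \<le> (\<Sum>p\<in>I. real (card (Sp (fst p) (snd p) \<zeta>)))"
    unfolding Ball_def by (simp flip: of_nat_sum add: card_UN_le[OF I(1)])
  also have "\<dots> \<le> (\<Sum>p\<in>I. 16 * rq ^ (2 * m))"
  proof (rule sum_mono)
    fix p assume "p \<in> I"
    then have "rq ^ (2 * (fst p + snd p)) \<le> rq ^ (2 * m)" using q1 by (intro power_increasing) (auto simp: I_def)
    then show "real (card (Sp (fst p) (snd p) \<zeta>)) \<le> 16 * rq ^ (2 * m)" using card_Sp_le[OF Z, of "fst p" "snd p"] by simp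
  qed
  also have "\<dots> = real (card I) * (16 * rq ^ (2 * m))" by simp
  also have "\<dots> \<le> (real m + 1)\<^sup>2 * (16 * rq ^ (2 * m))"
  proof (rule mult_right_mono)
    have "real (card I) \<le> real ((m + 1)\<^sup>2)" using I(2) by (rule of_nat_mono)
    then show "real (card I) \<le> (real m + 1)\<^sup>2" by (simp add: add.commute)
  qed (use q1 in simp)
  also have "rq ^ (2 * m) = rq powr real (2 * m)" using q1 by (subst powr_realpow) auto
  also have "(real m + 1)\<^sup>2 * (16 * rq powr real (2 * m)) \<le> (r + 1)\<^sup>2 * (16 * rq powr (2 * r))"
    using m(1) q1 r(2) by (intro mult_mono power_mono powr_mono) auto
  finally have cB: "real (card Ball) \<le> 16 * (r + 1)\<^sup>2 * rq powr (2 * r)" by (simp add: mult_ac)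
  define S where "S = orbc ` Ball"
  have S: "S \<subseteq> QQ" "finite S" using BV fB orbc_in by (auto simp: S_def)
  have cS: "real (card S) \<le> 16 * (r + 1)\<^sup>2 * rq powr (2 * r)"
    using cB card_image_le[OF fB, of orbc] unfolding S_def by linarith
  have "1 - EE \<zeta> t (\<lambda>W. if r \<le> real (Dd W) then 1 else 0) = EE \<zeta> t (\<lambda>W. (-1) * (if r \<le> real (Dd W) then 1 else 0) + 1)"
    unfolding EE_linear[OF Z] by simp
  also have "\<dots> \<le> EE \<zeta> t (\<lambda>W. \<Sum>x\<in>QQ. if x \<in> S \<and> orbc W = x then 1 else 0)"
  proof (rule EE_mono[OF Z])
    fix W assume W: "W \<in> VV"
    show "(-1) * (if r \<le> real (Dd W) then 1 else 0) + 1 \<le> (\<Sum>x\<in>QQ. if x \<in> S \<and> orbc W = x then 1 else (0::real))"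
    proof (cases "r \<le> real (Dd W)")
      case False
      then have "orbc W \<in> S" using inB[OF W] by (auto simp: S_def)
      then have "(\<Sum>x\<in>QQ. if x \<in> S \<and> orbc W = x then 1 else (0::real)) = (\<Sum>x\<in>QQ. if orbc W = x then 1 else 0)"
        by (intro sum.cong) auto
      then show ?thesis using orbc_in[OF W] cellq.finite_quotient False by simp
    qed (auto intro: sum_nonneg)
  qed
  also have "\<dots> = (\<Sum>x\<in>QQ. if x \<in> S then prb t x else 0)"
    unfolding EE_sum prb_def by (rule sum.cong) auto
  also have "\<dots> = (\<Sum>x\<in>S. prb t x)"
    using S cellq.finite_quotient by (simp add: sum.If_cases Int_absorb1)
  finally have PS: "1 - EE \<zeta> t (\<lambda>W. if r \<le> real (Dd W) then 1 else 0) \<le> (\<Sum>x\<in>S. prb t x)" .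
  have tot: "(\<Sum>x\<in>QQ. prb t x) = 1"
  proof -
    have "(\<Sum>x\<in>QQ. prb t x) = EE \<zeta> t (\<lambda>W. \<Sum>x\<in>QQ. if orbc W = x then 1 else 0)" unfolding prb_def by (rule EE_sum[symmetric])
    also have "\<dots> = EE \<zeta> t (\<lambda>W. 0 * 0 + 1)"
      by (rule EE_cong[OF Z]) (use orbc_in cellq.finite_quotient in simp)
    finally show ?thesis unfolding EE_linear[OF Z] by simp
  qed
  have tot': "(\<Sum>x\<in>QQ. prb t x - 1 / n) = 0" using n by (simp add: sum_subtractf tot n_def)
  have split: "(\<Sum>x\<in>QQ. g x) = (\<Sum>x\<in>S. g x) + (\<Sum>x\<in>QQ - S. g x)" for g :: "_ \<Rightarrow> real"
    using sum.subset_diff[OF S(1) cellq.finite_quotient, of g] by simp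
  \<comment> \<open>The difference of the two laws sums to 0 over X, so its excess on S is matched
    by a deficit outside S.\<close>
  have "2 * (\<Sum>x\<in>S. prb t x - 1 / n) = (\<Sum>x\<in>S. prb t x - 1 / n) - (\<Sum>x\<in>QQ - S. prb t x - 1 / n)"
    using tot' split[of "\<lambda>x. prb t x - 1 / n"] by simp
  also have "\<dots> \<le> (\<Sum>x\<in>S. \<bar>prb t x - 1 / n\<bar>) + (\<Sum>x\<in>QQ - S. \<bar>prb t x - 1 / n\<bar>)"
  proof -
    have "(\<Sum>x\<in>S. prb t x - 1 / n) \<le> (\<Sum>x\<in>S. \<bar>prb t x - 1 / n\<bar>)" by (intro sum_mono) simp
    moreover have "(\<Sum>x\<in>QQ - S. - (prb t x - 1 / n)) \<le> (\<Sum>x\<in>QQ - S. \<bar>prb t x - 1 / n\<bar>)" by (intro sum_mono) simp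
    ultimately show ?thesis unfolding sum_negf by linarith
  qed
  also have "\<dots> = (\<Sum>x\<in>QQ. \<bar>prb t x - 1 / n\<bar>)" by (rule split[symmetric])
  finally have "2 * ((\<Sum>x\<in>S. prb t x) - real (card S) / n) \<le> (\<Sum>x\<in>QQ. \<bar>prb t x - 1 / n\<bar>)"
    by (simp add: sum_subtractf)
  moreover have "real (card S) / n \<le> 16 * (r + 1)\<^sup>2 * rq powr (2 * r) / n" using cS n by (intro divide_right_mono) auto
  moreover have "1 - f - d \<le> 1 / 2 * h" if "2 * (p - c) \<le> h" "c \<le> d" "1 - e \<le> p" "e \<le> f" for c d e f h p :: real
    using that by argo
  ultimately show ?thesis using PS prob_Dd_ge[OF r(1)] unfolding n_def[symmetric] by blast
qed

end

lemma card_QQ: "card QQ = card (quotient_vertices abv \<Gamma>)"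
  unfolding quotient_CC by (intro card_image inj_on_subset[OF singleton_image_inj]) simp

text \<open>Passes from orbits of vertices, on which the walk is defined, to orbits of 0-cells, on
  which the operators act.\<close>

lemma tv_dist_prb:
  assumes Z: "\<zeta> \<in> VV"
  shows "tv_dist (map_pmf (orbit vertex_act \<Gamma>) (srw \<zeta> t)) (pmf_of_set (quotient_vertices abv \<Gamma>))
     = 1 / 2 * (\<Sum>x\<in>QQ. \<bar>prb \<zeta> t x - 1 / real (card QQ)\<bar>)"
proof -
  let ?X = "quotient_vertices abv \<Gamma>" and ?o = "orbit vertex_act \<Gamma>" and ?i = "(`) (\<lambda>V. {V})"
  let ?\<mu> = "map_pmf ?o (srw \<zeta> t)"
  have inj: "inj_on ?i ?X" using singleton_image_inj by (rule inj_on_subset) simp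
  have ne: "?X \<noteq> {}" using Z by (auto simp: quotient_vertices_def quotient_set_def)
  have mu: "pmf ?\<mu> x = prb \<zeta> t (?i x)" for x
  proof -
    have "pmf ?\<mu> x = EE \<zeta> t (indicator (?o -` {x}))" by (simp add: pmf_map)
    also have "\<dots> = prb \<zeta> t (?i x)"
      unfolding prb_def[OF Z]
      by (rule EE_cong[OF Z]) (auto simp: orbc_eq indicator_def inj_eq[OF singleton_image_inj])
    finally show ?thesis .
  qed
  have out: "pmf ?\<mu> x = 0" if "x \<notin> ?X" for x
  proof -
    have "x \<notin> set_pmf ?\<mu>" using that set_srw[OF Z, of t] by (auto simp: quotient_vertices_def quotient_set_def)
    then show ?thesis unfolding pmf_eq_0_set_pmf .
  qed
  have "(\<Sum>\<^sub>\<infinity>x. \<bar>pmf ?\<mu> x - pmf (pmf_of_set ?X) x\<bar>) = (\<Sum>\<^sub>\<infinity>x\<in>?X. \<bar>pmf ?\<mu> x - pmf (pmf_of_set ?X) x\<bar>)"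
    by (rule infsum_cong_neutral) (use ne finite_X out in auto)
  also have "\<dots> = (\<Sum>x\<in>?X. \<bar>pmf ?\<mu> x - 1 / real (card ?X)\<bar>)"
    using finite_X ne by (simp cong: sum.cong)
  also have "\<dots> = (\<Sum>x\<in>QQ. \<bar>prb \<zeta> t x - 1 / real (card QQ)\<bar>)"
    unfolding card_QQ unfolding quotient_CC by (simp add: sum.reindex[OF inj] mu)
  finally show ?thesis by (simp add: tv_dist_def)
qed

end

section \<open>Cutoff\<close>

context ramanujan_walk begin

lemma some_lift_vertex:
  assumes "v \<in> quotient_vertices abv \<Gamma>" shows "some_lift v \<in> VV"
proof -
  obtain V where V: "V \<in> VV" "v = orbit vertex_act \<Gamma> V"
    using assms by (auto simp: quotient_vertices_def quotient_set_def)
  have "v \<noteq> {}" using subgroup.one_closed[OF lattice_facts(1)] by (auto simp: V(2) orbit_def)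
  then have "some_lift v \<in> v" unfolding some_lift_def by (simp add: some_in_eq)
  then show ?thesis using Gamma_VV[OF V(1) _ V(1)] by (auto simp: V(2) orbit_def)
qed

lemma tv_upper:
  assumes v: "v \<in> quotient_vertices abv \<Gamma>"
    and t: "(1 / 2) ^ t \<le> (1 / 18 :: real)" and r: "r < drift * real t" and B: "0 \<le> B"
    and D: "\<And>d. r \<le> real d \<Longrightarrow> sqrt (real (card (quotient_vertices abv \<Gamma>))) * (real d + 1) ^ 4 / rq ^ d \<le> B"
  shows "tv_dist (quotient_srw abv \<pi> \<Gamma> v t) (pmf_of_set (quotient_vertices abv \<Gamma>))
    \<le> 1 / 2 * (4 * B + 2 * real t / (drift * real t - r)\<^sup>2 + 36 * (1 / 2) ^ t)"
  using prb_upper[OF some_lift_vertex[OF v] t r B D[folded card_QQ]]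
  unfolding quotient_srw_def tv_dist_prb[OF some_lift_vertex[OF v]] by simp

lemma tv_lower:
  assumes v: "v \<in> quotient_vertices abv \<Gamma>" and r: "drift * real t < r" "0 \<le> r"
  shows "1 - 32 * real t / (r - drift * real t)\<^sup>2
      - 16 * (r + 1)\<^sup>2 * rq powr (2 * r) / real (card (quotient_vertices abv \<Gamma>))
    \<le> tv_dist (quotient_srw abv \<pi> \<Gamma> v t) (pmf_of_set (quotient_vertices abv \<Gamma>))"
  using prb_lower[OF some_lift_vertex[OF v] r]
  unfolding quotient_srw_def tv_dist_prb[OF some_lift_vertex[OF v]] card_QQ .

end

section \<open>Numerical estimates and the choice of constants\<close>

lemma divide_square_mono: "0 < a \<Longrightarrow> a \<le> b \<Longrightarrow> 0 \<le> x \<Longrightarrow> x / b\<^sup>2 \<le> x / (a::real)\<^sup>2"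
  by (intro divide_left_mono power_mono mult_pos_pos zero_less_power) auto

text \<open>Used for s = d - L >= sqrt L, where d + 1 <= s^2 + s + 1: the decay beyond radius L
  absorbs the polynomial loss of the Schur test.\<close>

lemma ex_poly_exp_small:
  fixes \<delta> :: real assumes "0 < \<delta>"
  shows "\<exists>s0\<ge>0. \<forall>s\<ge>s0. (s\<^sup>2 + s + 1) ^ 4 * 2 powr (- s) \<le> \<delta>"
proof -
  have "((\<lambda>s::real. (s\<^sup>2 + s + 1) ^ 4 * 2 powr (- s)) \<longlongrightarrow> 0) at_top" by real_asymp
  then have "eventually (\<lambda>s. (s\<^sup>2 + s + 1) ^ 4 * 2 powr (- s) < \<delta>) at_top" using assms by (rule order_tendstoD)
  then obtain s1 where "\<forall>s\<ge>s1. (s\<^sup>2 + s + 1) ^ 4 * 2 powr (- s) < \<delta>" by (auto simp: eventually_at_top_linorder)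
  then show ?thesis by (intro exI[of _ "max 0 s1"]) (auto intro: less_imp_le)
qed

text \<open>Bounds the proportion of X covered by a ball of radius L - sqrt L.\<close>

lemma ex_poly_exp_sqrt_small:
  fixes \<delta> :: real assumes "0 < \<delta>"
  shows "\<exists>L0. \<forall>L\<ge>L0. 16 * (L + 1)\<^sup>2 * 2 powr (- (2 * sqrt L)) \<le> \<delta>"
proof -
  have "((\<lambda>L::real. 16 * (L + 1)\<^sup>2 * 2 powr (- (2 * sqrt L))) \<longlongrightarrow> 0) at_top" by real_asymp
  then have "eventually (\<lambda>L. 16 * (L + 1)\<^sup>2 * 2 powr (- (2 * sqrt L)) < \<delta>) at_top" using assms by (rule order_tendstoD)
  then show ?thesis by (auto simp: eventually_at_top_linorder intro: less_imp_le)
qed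

context nonarch_local_field begin

lemma drift_bounds: "0 < drift" "drift \<le> 1"
proof -
  have "4 \<le> rq\<^sup>2" using power_mono[OF rq_ge_2, of 2] by simp
  then show "0 < drift" "drift \<le> 1" using rq_ge_2 by (simp_all add: drift_def)
qed

lemma powr_le_2: "0 \<le> s \<Longrightarrow> rq powr (- s) \<le> 2 powr (- s)"
  using rq_ge_2 by (simp add: powr_minus powr_mono2 le_imp_inverse_le)

text \<open>Everything is expressed through \<open>L = log\<^bsub>q\<^sup>2\<^esub> n\<close>: distances concentrate at \<open>drift \<cdot> t \<pm> O(\<surd>t)\<close>, while
  spheres of radius \<open>L \<pm> \<surd>L\<close> are much larger, respectively smaller, than \<open>X\<close>.\<close>

lemma t_mix_window:
  assumes \<epsilon>: "0 < \<epsilon>" "\<epsilon> < (1::real)"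
  shows "\<exists>A L0. \<forall>\<Gamma> L. ramanujan_walk abv \<pi> \<Gamma> \<and> real (card (quotient_vertices abv \<Gamma>)) = rq powr (2 * L) \<and> L0 \<le> L
    \<longrightarrow> \<bar>real (t_mix abv \<pi> \<Gamma> \<epsilon>) - L / drift\<bar> \<le> A * sqrt L"
proof -
  define c where "c = 1 / drift"
  have c: "1 \<le> c" "drift * c = 1" using drift_bounds by (simp_all add: c_def)
  \<comment> \<open>Large enough for the Chebyshev ratio to be at most \<open>\<epsilon> / 4\<close>
    at time \<open>t1\<close>, and for the Chebyshev term of the lower bound to be at most (1 -
    \<open>\<epsilon>\<close>) / 2.\<close>
  define X where "X = max (4 * (3 * c + 1) / \<epsilon>) (64 * c / (1 - \<epsilon>))"
  have X: "4 * (3 * c + 1) / \<epsilon> \<le> X" "64 * c / (1 - \<epsilon>) \<le> X" by (simp_all add: X_def)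
  have X0: "0 < X"
    by (rule less_le_trans[OF _ X(1)]) (use c \<epsilon> in \<open>simp add: add_pos_pos\<close>)
  \<comment> \<open>One sqrt L separates the critical radius from L, and (1 + X) sqrt L is the
    deviation of the walk from that radius.\<close>
  define a where "a = 2 + X"
  obtain s0 where s0: "0 \<le> s0" "\<And>s. s0 \<le> s \<Longrightarrow> (s\<^sup>2 + s + 1) ^ 4 * 2 powr (- s) \<le> \<epsilon> / 8"
    using ex_poly_exp_small[of "\<epsilon> / 8"] \<epsilon> by auto
  obtain L1 where L1: "\<And>L. L1 \<le> L \<Longrightarrow> 16 * (L + 1)\<^sup>2 * 2 powr (- (2 * sqrt L)) \<le> (1 - \<epsilon>) / 2"
    using ex_poly_exp_sqrt_small[of "(1 - \<epsilon>) / 2"] \<epsilon> by auto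
  obtain T0 :: nat where T0: "(1 / 2) ^ T0 < min (1 / 18) (\<epsilon> / 72)"
    using real_arch_pow_inv[of "min (1 / 18) (\<epsilon> / 72)" "1 / 2"] \<epsilon> by auto
  \<comment> \<open>L >= 1 gives sqrt L <= L, s0^2 brings sqrt L into the range of the first
    estimate, L1 serves the second, and T0 makes the colours mixed at time \<open>t1\<close> >=
    L.\<close>
  define L0 where "L0 = Max {1, s0\<^sup>2, L1, real T0}"
  show ?thesis
  \<comment> \<open>The extra 1 absorbs the rounding in \<open>t1\<close>, as sqrt L >= 1.\<close>
  proof (rule exI[of _ "a * c + 1"], rule exI[of _ L0], intro allI impI, elim conjE)
    fix \<Gamma> L assume "ramanujan_walk abv \<pi> \<Gamma>" and n: "real (card (quotient_vertices abv \<Gamma>)) = rq powr (2 * L)" and "L0 \<le> L"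
    then interpret ramanujan_walk abv \<pi> \<Gamma> by simp
    have L: "1 \<le> L" "s0\<^sup>2 \<le> L" "L1 \<le> L" "real T0 \<le> L" using \<open>L0 \<le> L\<close> by (simp_all add: L0_def)
    let ?X = "quotient_vertices abv \<Gamma>" and ?s = "sqrt L"
    let ?tv = "\<lambda>v t. tv_dist (quotient_srw abv \<pi> \<Gamma> v t) (pmf_of_set ?X)"
    have s12: "1 \<le> ?s" "?s * ?s = L" using L(1) by simp_all
    have s: "1 \<le> ?s" "?s * ?s = L" "?s \<le> L" using s12 mult_left_mono[OF s12(1), of ?s] by simp_all
    have sq: "((1 + X) * ?s)\<^sup>2 = (1 + X) * (1 + X) * L"
      unfolding power_mult_distrib using L(1) by (simp add: power2_eq_square)
    have rq: "1 < rq" using rq_ge_2 by simp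
    have "0 < real (card ?X)" using n rq by simp
    then have ne: "?X \<noteq> {}" by auto
    define P where "P t \<longleftrightarrow> (\<forall>v\<in>?X. ?tv v t < \<epsilon>)" for t
    have tm: "t_mix abv \<pi> \<Gamma> \<epsilon> = (LEAST t. P t)" by (simp add: t_mix_def P_def)
    define t1 where "t1 = nat \<lceil>c * (L + a * ?s)\<rceil>"
    have La: "0 \<le> L + a * ?s" using L X0 by (simp add: a_def)
    have t1: "c * (L + a * ?s) \<le> real t1" "real t1 \<le> c * (L + a * ?s) + 1"
      unfolding t1_def using La c ceiling_correct[of "c * (L + a * ?s)"] by simp_all
    have P1: "P t1"
      unfolding P_def
    proof
      fix v assume v: "v \<in> ?X"
      have "drift * (c * (L + a * ?s)) \<le> drift * real t1" using t1(1) drift_bounds by (intro mult_left_mono) auto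
      then have dt: "L + a * ?s \<le> drift * real t1" using c(2) by (simp flip: mult.assoc)
      have gap: "(1 + X) * ?s \<le> drift * real t1 - (L + ?s)" using dt by (simp add: a_def algebra_simps)
      have gp: "0 < (1 + X) * ?s" using X0 s by simp
      have "L \<le> c * (L + a * ?s)"
      proof -
        have "1 * L \<le> c * (L + a * ?s)" using c X0 L by (intro mult_mono) (auto simp: a_def)
        then show ?thesis by simp
      qed
      then have "T0 \<le> t1" using L(4) t1(1) by linarith
      then have "(1 / 2 :: real) ^ t1 \<le> (1 / 2) ^ T0" by (intro power_decreasing) auto
      then have half: "(1 / 2 :: real) ^ t1 \<le> 1 / 18" "36 * (1 / 2 :: real) ^ t1 \<le> \<epsilon> / 2" using T0[unfolded min_less_iff_conj] by linarith+
      have B: "sqrt (real (card ?X)) * (real d + 1) ^ 4 / rq ^ d \<le> \<epsilon> / 8" if d: "L + ?s \<le> real d" for d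
      proof -
        \<comment> \<open>The excess of the radius over L; e >= sqrt L turns d = L + e into a
          quantity bounded by e^2 + e.\<close>
        define e where "e = real d - L"
        have e: "?s \<le> e" "s0 \<le> e" "0 \<le> e"
        proof -
          show "?s \<le> e" using d by (simp add: e_def)
          moreover have "s0 \<le> ?s" using L(2) by (rule real_le_rsqrt)
          ultimately show "s0 \<le> e" "0 \<le> e" using s by linarith+
        qed
        have "L \<le> e\<^sup>2" using power_mono[OF e(1), of 2] L(1) by simp
        then have d1: "real d + 1 \<le> e\<^sup>2 + e + 1" by (simp add: e_def)
        have "sqrt (real (card ?X)) = rq powr L"
          unfolding n using rq by (simp add: powr_half_sqrt[symmetric] powr_powr)
        moreover have "rq ^ d = rq powr real d" using rq by (subst powr_realpow) auto
        ultimately have "sqrt (real (card ?X)) * (real d + 1) ^ 4 / rq ^ d = (real d + 1) ^ 4 * rq powr (- e)"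
          by (simp add: e_def powr_diff)
        also have "\<dots> \<le> (e\<^sup>2 + e + 1) ^ 4 * 2 powr (- e)"
          using d1 powr_le_2[OF e(3)] by (intro mult_mono power_mono) auto
        also have "\<dots> \<le> \<epsilon> / 8" by (rule s0(2)[OF e(2)])
        finally show ?thesis .
      qed
      have r: "L + ?s < drift * real t1" using gap gp by linarith
      have ratio: "real t1 / (drift * real t1 - (L + ?s))\<^sup>2 \<le> \<epsilon> / 4"
      proof -
        have "c * (L + a * ?s) \<le> c * (L + a * L)" using s c X0 by (intro mult_left_mono add_left_mono) (auto simp: a_def)
        then have tL: "real t1 \<le> (3 * c + 1) * (1 + X) * L"
        proof -
          have "c * (L + a * L) + 1 \<le> c * (3 + X) * L + L" using L(1) by (simp add: a_def algebra_simps)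
          also have "\<dots> \<le> (3 * c + 1) * (1 + X) * L"
            using L(1) X0 c by (simp add: algebra_simps)
          finally show ?thesis using t1(2) \<open>c * (L + a * ?s) \<le> c * (L + a * L)\<close> by linarith
        qed
        have "real t1 / (drift * real t1 - (L + ?s))\<^sup>2 \<le> real t1 / ((1 + X) * ?s)\<^sup>2"
          by (rule divide_square_mono[OF gp gap]) simp
        also have "\<dots> \<le> ((3 * c + 1) * (1 + X) * L) / ((1 + X) * (1 + X) * L)"
          unfolding sq using tL X0 L by (intro divide_right_mono) auto
        also have "\<dots> = (3 * c + 1) / (1 + X)" using X0 L by simp
        also have "\<dots> \<le> \<epsilon> / 4"
        proof -
          have "4 * (3 * c + 1) \<le> X * \<epsilon>" using X(1) \<epsilon> by (simp add: pos_divide_le_eq)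
          then have "4 * (3 * c + 1) \<le> (1 + X) * \<epsilon>" using \<epsilon> by (simp add: algebra_simps)
          then show ?thesis using X0 by (simp add: pos_divide_le_eq mult.commute)
        qed
        finally show ?thesis .
      qed
      have "?tv v t1 \<le> 1 / 2 * (4 * (\<epsilon> / 8) + 2 * real t1 / (drift * real t1 - (L + ?s))\<^sup>2 + 36 * (1 / 2) ^ t1)"
        by (rule tv_upper[OF v half(1) r _ B]) (use \<epsilon> in auto)
      moreover have "x < \<epsilon>" if "x \<le> 1 / 2 * (4 * (\<epsilon> / 8) + 2 * R + p)" "R \<le> \<epsilon> / 4" "p \<le> \<epsilon> / 2" for x R p
        using that \<epsilon>(1) by argo
      ultimately show "?tv v t1 < \<epsilon>" using ratio half(2) unfolding times_divide_eq_right[symmetric] by blast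
    qed
    have up: "real (t_mix abv \<pi> \<Gamma> \<epsilon>) \<le> c * (L + a * ?s) + 1"
      using Least_le[of P, OF P1] t1(2) unfolding tm by linarith
    have low: "L - a * ?s < drift * real (t_mix abv \<pi> \<Gamma> \<epsilon>)"
    proof (rule ccontr)
      let ?t = "t_mix abv \<pi> \<Gamma> \<epsilon>"
      assume "\<not> L - a * ?s < drift * real ?t"
      then have dt: "drift * real ?t \<le> L - a * ?s" by simp
      \<comment> \<open>The least time satisfies P itself, so the total variation lower bound is
        applied at exactly this time.\<close>
      have "P ?t" unfolding tm by (rule LeastI[of P, OF P1])
      moreover obtain v where v: "v \<in> ?X" using ne by blast
      ultimately have lt: "?tv v ?t < \<epsilon>" by (simp add: P_def)
      have gap: "(1 + X) * ?s \<le> (L - ?s) - drift * real ?t" using dt by (simp add: a_def algebra_simps)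
      have gp: "0 < (1 + X) * ?s" using X0 s by simp
      have r: "drift * real ?t < L - ?s" "0 \<le> L - ?s" using gap gp s by linarith+
      have "real ?t = c * (drift * real ?t)" using c(2) by (simp add: mult.commute flip: mult.assoc)
      also have "\<dots> \<le> c * L" using dt c X0 s by (intro mult_left_mono) (auto simp: a_def intro: order_trans)
      finally have tL: "real ?t \<le> c * L" .
      have "32 * real ?t / ((L - ?s) - drift * real ?t)\<^sup>2 \<le> 32 * real ?t / ((1 + X) * ?s)\<^sup>2"
        by (rule divide_square_mono[OF gp gap]) simp
      also have "\<dots> \<le> 32 * (c * L) / ((1 + X) * (1 + X) * L)"
        unfolding sq using tL X0 L by (intro divide_right_mono) auto
      also have "\<dots> = 32 * c / ((1 + X) * (1 + X))" using L X0 by simp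
      also have "\<dots> \<le> 32 * c / (1 + X)"
        using X0 c by (intro divide_left_mono) (auto simp: mult_le_cancel_left1)
      also have "\<dots> \<le> (1 - \<epsilon>) / 2"
      proof -
        have "64 * c \<le> X * (1 - \<epsilon>)" using X(2) \<epsilon> by (simp add: pos_divide_le_eq)
        then have "64 * c \<le> (1 + X) * (1 - \<epsilon>)" using \<epsilon> by (simp add: algebra_simps)
        then show ?thesis using X0 by (simp add: pos_divide_le_eq mult.commute)
      qed
      finally have 1: "32 * real ?t / ((L - ?s) - drift * real ?t)\<^sup>2 \<le> (1 - \<epsilon>) / 2" .
      have "16 * ((L - ?s) + 1)\<^sup>2 * rq powr (2 * (L - ?s)) / real (card ?X) = 16 * ((L - ?s) + 1)\<^sup>2 * rq powr (- (2 * ?s))"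
        unfolding n using rq by (simp add: right_diff_distrib powr_diff powr_minus divide_inverse)
      also have "\<dots> \<le> 16 * (L + 1)\<^sup>2 * 2 powr (- (2 * ?s))"
        using s by (intro mult_mono power_mono powr_le_2) auto
      also have "\<dots> \<le> (1 - \<epsilon>) / 2" by (rule L1[OF L(3)])
      finally have 2: "16 * ((L - ?s) + 1)\<^sup>2 * rq powr (2 * (L - ?s)) / real (card ?X) \<le> (1 - \<epsilon>) / 2" .
      have "False" if "1 - x - y \<le> z" "x \<le> (1 - \<epsilon>) / 2" "y \<le> (1 - \<epsilon>) / 2" "z < \<epsilon>" for x y z
        using that by argo
      from this[OF tv_lower[OF v r] 1 2 lt] show False .
    qed
    have "c * (L - a * ?s) \<le> c * (drift * real (t_mix abv \<pi> \<Gamma> \<epsilon>))"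
      using low c by (intro mult_left_mono) auto
    also have "\<dots> = real (t_mix abv \<pi> \<Gamma> \<epsilon>)" using c(2) by (simp add: mult.commute flip: mult.assoc)
    finally have low': "c * L - a * c * ?s \<le> real (t_mix abv \<pi> \<Gamma> \<epsilon>)" by (simp add: algebra_simps)
    have up': "real (t_mix abv \<pi> \<Gamma> \<epsilon>) \<le> c * L + a * c * ?s + ?s"
    proof -
      have "c * (L + a * ?s) = c * L + a * c * ?s" by (simp add: algebra_simps)
      then show ?thesis using up s(1) by linarith
    qed
    have "L / drift = c * L" by (simp add: c_def)
    moreover have "(a * c + 1) * ?s = a * c * ?s + ?s" by (simp add: algebra_simps)
    ultimately show "\<bar>real (t_mix abv \<pi> \<Gamma> \<epsilon>) - L / drift\<bar> \<le> (a * c + 1) * ?s"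
      using low' up' s(1) by linarith
  qed
qed

end

theorem theorem3p1:
  fixes abv :: "'a::field \<Rightarrow> real" and \<pi> :: 'a and q :: nat and \<epsilon> :: real
  assumes "nonarch_local_field abv \<pi>"
    and "q = residue_card abv"
    and "0 < \<epsilon>" and "\<epsilon> < 1"
  shows "\<exists>(A::real) (N::nat). \<forall>\<Gamma> n. ramanujan_complex abv \<pi> \<Gamma> \<and>
           n = card (quotient_vertices abv \<Gamma>) \<and> N \<le> n \<longrightarrow>
           \<bar>real (t_mix abv \<pi> \<Gamma> \<epsilon>)
              - (real q ^ 2 + real q + 1) / (real q ^ 2 - 1) * log (real q ^ 2) (real n)\<bar>
             \<le> A * sqrt (ln (real n))"
proof -
  interpret nonarch_local_field abv \<pi> by (rule assms(1))
  have q: "real q = rq" "1 < rq" using rq_ge_2 by (simp_all add: rq_def assms(2))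
  have lq: "0 < ln (rq ^ 2)" using q(2) by (simp add: ln_realpow)
  obtain A L0 where A: "\<And>\<Gamma> L. ramanujan_walk abv \<pi> \<Gamma> \<Longrightarrow>
      real (card (quotient_vertices abv \<Gamma>)) = rq powr (2 * L) \<Longrightarrow> L0 \<le> L \<Longrightarrow>
      \<bar>real (t_mix abv \<pi> \<Gamma> \<epsilon>) - L / drift\<bar> \<le> A * sqrt L"
    using t_mix_window[OF assms(3,4)] by blast
  \<comment> \<open>The ceiling ensures L >= \<open>L0\<close>; the added 1 ensures n >= 1.\<close>
  define N where "N = nat \<lceil>(rq ^ 2) powr L0\<rceil> + 1"
  show ?thesis
  proof (intro exI[of _ "A / sqrt (ln (rq ^ 2))"] exI[of _ N] allI impI, elim conjE)
    fix \<Gamma> n assume R: "ramanujan_complex abv \<pi> \<Gamma>" and n: "n = card (quotient_vertices abv \<Gamma>)" "N \<le> n"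
    have n1: "1 \<le> n" using n(2) by (simp add: N_def)
    \<comment> \<open>An infinite set has cardinality 0, so n >= 1 shows that X is finite.\<close>
    then have "finite (quotient_vertices abv \<Gamma>)" using n(1) by (metis card.infinite not_one_le_zero)
    then have W: "ramanujan_walk abv \<pi> \<Gamma>" using R by unfold_locales
    define L where "L = log (rq ^ 2) (real n)"
    have "rq powr (2 * L) = (rq ^ 2) powr L" using q(2) by (simp add: powr_powr flip: powr_numeral)
    also have "\<dots> = real n" unfolding L_def using q(2) n1 by (intro powr_log_cancel) (auto simp: power2_eq_1_iff)
    finally have nL: "real (card (quotient_vertices abv \<Gamma>)) = rq powr (2 * L)" using n(1) by simp
    have "(rq ^ 2) powr L0 \<le> real N" unfolding N_def by linarith
    also have "\<dots> \<le> real n" using n(2) by simp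
    finally have "L0 \<le> L" unfolding L_def using q(2) n1 by (subst le_log_iff) auto
    from A[OF W nL this] have "\<bar>real (t_mix abv \<pi> \<Gamma> \<epsilon>) - L / drift\<bar> \<le> A * sqrt L" .
    also have "A * sqrt L = A / sqrt (ln (rq ^ 2)) * sqrt (ln (real n))"
      by (simp add: L_def log_def real_sqrt_divide)
    finally show "\<bar>real (t_mix abv \<pi> \<Gamma> \<epsilon>)
              - (real q ^ 2 + real q + 1) / (real q ^ 2 - 1) * log (real q ^ 2) (real n)\<bar>
             \<le> A / sqrt (ln (rq ^ 2)) * sqrt (ln (real n))"
      by (simp add: q(1) L_def drift_def mult.commute)
  qed
qed

end
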